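(* The volume function $\mathrm{vol}:S\to\mathbb R$, $(\alpha,\omega)\mapsto\mathrm{vol}(\alpha,\omega)$, is (strictly) decreasing in $\alpha$ (for each fixed $\omega$) and (strictly) increasing in $\omega$ (for each fixed $\alpha$) when $\alpha\neq0$. (Tetrahedra corresponding to points of $S$ with $\alpha=0$ are degenerate and have vanishing volume.)
   Context: Let $V$ be a $4$-dimensional real vector space with a symmetric bilinear form $\langle-,-\rangle$ of signature $---+$. Hyperbolic $3$-space is $\{\boldsymbol p\in\mathbb PV\mid\langle p,p\rangle>0\}$ with its hyperbolic metric (curvature $-1$); points $\boldsymbol p\in\mathbb PV$ with $\langle p,p\rangle=0$ are ideal points ($p\in V$ denotes a representative of $\boldsymbol p$). A labelled ideal tetrahedron is a $4$-tuple $(\boldsymbol v_1,\boldsymbol v_2,\boldsymbol v_3,\boldsymbol v_4)$ of ideal points; it is non-degenerate when its vertices do not belong to a same plane (a plane is given by a $3$-dimensional linear subspace of $V$ of signature $--+$), and degenerate otherwise. Its volume is the hyperbolic volume of the convex hull of its vertices. A Gram matrix of it is $[\langle v_i,v_j\rangle]$ for some representatives $v_i\in V$. A square matrix is doubly stochastic if its entries are non-negative and each row and column sums to $1$. Only tetrahedra admitting a doubly stochastic Gram matrix are considered; such a matrix is then unique. Let $\Delta:=\{(x,y,z)\in\mathbb R^3\mid x+y+z=1,\ x\le y+z,\ y\le z+x,\ z\le x+y\}$. The set of labelled ideal tetrahedra admitting a doubly stochastic Gram matrix, modulo isometries preserving the order of vertices, is identified with $\Delta$: $T=(r,s,t)\in\Delta$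 corresponds to the doubly stochastic Gram matrix $$G_T=\begin{pmatrix}0&r&s&t\\ r&0&t&s\\ s&t&0&r\\ t&s&r&0\end{pmatrix}.$$ Put $S:=\{(\det G_T,\sqrt{\operatorname{per}G_T})\mid T\in\Delta\}\subset\mathbb R^2$, where $\operatorname{per}A:=\sum_{\sigma\in S_m}a_{1\sigma(1)}\cdots a_{m\sigma(m)}$ is the permanent of an $m\times m$ matrix $A=[a_{ij}]$. For $(\alpha,\omega)\in S$, $\mathrm{vol}(\alpha,\omega)$ denotes the volume of any tetrahedron $T\in\Delta$ with $\det G_T=\alpha$ and $\sqrt{\operatorname{per}G_T}=\omega$ (the volume does not depend on the choice of such $T$). *)

theory Defs
  imports "HOL-Analysis.Analysis" "HOL-Combinatorics.Permutations"
begin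

text \<open>A pseudo-orthonormal basis \<open>(b, e)\<close> of a subspace \<open>W\<close>: the vectors \<open>b i\<close> have square \<open>-1\<close>,
  the single vector \<open>e\<close> has square \<open>1\<close>. Orthonormality makes these vectors distinct and linearly
  independent, so the existence of \<open>(b, e)\<close> says that \<open>W\<close> has dimension \<open>CARD('n) + 1\<close> and that the
  restriction of \<open>B\<close> to \<open>W\<close> has signature \<open>- \<dots> - +\<close> (\<open>CARD('n)\<close> minus signs).\<close>

definition lorentz_basis ::
  "('v::real_vector \<Rightarrow> 'v \<Rightarrow> real) \<Rightarrow> 'v set \<Rightarrow> ('n::finite \<Rightarrow> 'v) \<Rightarrow> 'v \<Rightarrow> bool" where
  "lorentz_basis B W b e \<longleftrightarrow>
     span (insert e (range b)) = W \<and>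
     (\<forall>i j. B (b i) (b j) = (if i = j then - 1 else 0)) \<and>
     (\<forall>i. B (b i) e = 0 \<and> B e (b i) = 0) \<and>
     B e e = 1"

text \<open>Points of the projective space are the lines \<open>span {v}\<close> with \<open>v \<noteq> 0\<close>.\<close>

definition hyp_points :: "('v::real_vector \<Rightarrow> 'v \<Rightarrow> real) \<Rightarrow> 'v set set" where
  "hyp_points B = {span {v} | v. v \<noteq> 0 \<and> B v v > 0}"

definition ideal_points :: "('v::real_vector \<Rightarrow> 'v \<Rightarrow> real) \<Rightarrow> 'v set set" where
  "ideal_points B = {span {v} | v. v \<noteq> 0 \<and> B v v = 0}"

text \<open>Geodesic convexity in hyperbolic space compactified by its ideal points. For two points of this
  closed ball with representatives chosen so that \<open>B v w \<ge> 0\<close> (both in the same half of the closed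
  light cone), the geodesic segment joining them is the projectivisation of the cone spanned by
  \<open>v\<close> and \<open>w\<close>.\<close>

definition geodesically_convex :: "('v::real_vector \<Rightarrow> 'v \<Rightarrow> real) \<Rightarrow> 'v set set \<Rightarrow> bool" where
  "geodesically_convex B C \<longleftrightarrow>
     C \<subseteq> hyp_points B \<union> ideal_points B \<and>
     (\<forall>v w. v \<noteq> 0 \<longrightarrow> w \<noteq> 0 \<longrightarrow> span {v} \<in> C \<longrightarrow> span {w} \<in> C \<longrightarrow> B v w \<ge> 0 \<longrightarrow>
       (\<forall>x\<ge>0. \<forall>y\<ge>0. x *\<^sub>R v + y *\<^sub>R w \<noteq> 0 \<longrightarrow> span {x *\<^sub>R v + y *\<^sub>R w} \<in> C))"

text \<open>The hyperbolic metric at the point \<open>span {p}\<close>. Tangent vectors are vectors of \<open>V\<close> modulo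
  \<open>p\<close>, normalised at the representative \<open>p\<close>; if \<open>u'\<close> and \<open>w'\<close> are the components of \<open>u\<close> and \<open>w\<close>
  orthogonal to \<open>p\<close>, then the metric of curvature \<open>-1\<close> is \<open>- B u' w' / B p p\<close>.\<close>

definition hyp_metric :: "('v::real_vector \<Rightarrow> 'v \<Rightarrow> real) \<Rightarrow> 'v \<Rightarrow> 'v \<Rightarrow> 'v \<Rightarrow> real" where
  "hyp_metric B p u w =
     (let u' = u - (B u p / B p p) *\<^sub>R p;
          w' = w - (B w p / B p p) *\<^sub>R p
      in - B u' w' / B p p)"

text \<open>The affine chart \<open>x \<mapsto> span {e + \<Sum>i. x i b i}\<close> of the projective space contains all of hyperbolic
  space (as the open unit ball); \<open>b i\<close> is the \<open>i\<close>-th coordinate vector field. The hyperbolic volume is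
  the Riemannian one, with density the square root of the determinant of the metric.\<close>

definition chart :: "(3 \<Rightarrow> 'v::real_vector) \<Rightarrow> 'v \<Rightarrow> real^3 \<Rightarrow> 'v" where
  "chart b e x = e + (\<Sum>i\<in>UNIV. (x $ i) *\<^sub>R b i)"

definition hyp_volume ::
  "('v::real_vector \<Rightarrow> 'v \<Rightarrow> real) \<Rightarrow> (3 \<Rightarrow> 'v) \<Rightarrow> 'v \<Rightarrow> 'v set set \<Rightarrow> real" where
  "hyp_volume B b e C =
     measure
       (density lborel (\<lambda>x. ennreal (sqrt (det (\<chi> i j. hyp_metric B (chart b e x) (b i) (b j))))))
       {x. span {chart b e x} \<in> C \<inter> hyp_points B}"

definition ideal_tetrahedron :: "('v::real_vector \<Rightarrow> 'v \<Rightarrow> real) \<Rightarrow> (4 \<Rightarrow> 'v set) \<Rightarrow> bool" where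
  "ideal_tetrahedron B P \<longleftrightarrow> (\<forall>i. P i \<in> ideal_points B)"

definition degenerate :: "('v::real_vector \<Rightarrow> 'v \<Rightarrow> real) \<Rightarrow> (4 \<Rightarrow> 'v set) \<Rightarrow> bool" where
  "degenerate B P \<longleftrightarrow>
     (\<exists>W (w :: 2 \<Rightarrow> 'v) f. lorentz_basis B W w f \<and> (\<forall>i. P i \<subseteq> W))"

definition tetrahedron_volume ::
  "('v::real_vector \<Rightarrow> 'v \<Rightarrow> real) \<Rightarrow> (3 \<Rightarrow> 'v) \<Rightarrow> 'v \<Rightarrow> (4 \<Rightarrow> 'v set) \<Rightarrow> real" where
  "tetrahedron_volume B b e P = hyp_volume B b e (geodesically_convex B hull range P)"

definition is_gram_matrix ::
  "('v::real_vector \<Rightarrow> 'v \<Rightarrow> real) \<Rightarrow> (4 \<Rightarrow> 'v set) \<Rightarrow> real^4^4 \<Rightarrow> bool" where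
  "is_gram_matrix B P G \<longleftrightarrow>
     (\<exists>v. (\<forall>i. v i \<noteq> 0 \<and> P i = span {v i}) \<and> G = (\<chi> i j. B (v i) (v j)))"

definition doubly_stochastic :: "real^'n^'n \<Rightarrow> bool" where
  "doubly_stochastic A \<longleftrightarrow>
     (\<forall>i j. A $ i $ j \<ge> 0) \<and>
     (\<forall>i. (\<Sum>j\<in>UNIV. A $ i $ j) = 1) \<and>
     (\<forall>j. (\<Sum>i\<in>UNIV. A $ i $ j) = 1)"

definition permanent :: "'a::comm_ring_1^'n^'n \<Rightarrow> 'a" where
  "permanent A = (\<Sum>p | p permutes (UNIV :: 'n set). \<Prod>i\<in>UNIV. A $ i $ p i)"

definition shapes :: "(real \<times> real \<times> real) set" where
  "shapes = {(x, y, z). x + y + z = 1 \<and> x \<le> y + z \<and> y \<le> z + x \<and> z \<le> x + y}"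

fun shape_gram :: "real \<times> real \<times> real \<Rightarrow> real^4^4" where
  "shape_gram (r, s, t) = vector
     [vector [0, r, s, t],
      vector [r, 0, t, s],
      vector [s, t, 0, r],
      vector [t, s, r, 0]]"

text \<open>\<open>P\<close> belongs to the class, modulo isometries preserving the order of vertices, that is identified
  with the point \<open>T\<close> of \<open>shapes\<close>.\<close>

definition has_shape ::
  "('v::real_vector \<Rightarrow> 'v \<Rightarrow> real) \<Rightarrow> (4 \<Rightarrow> 'v set) \<Rightarrow> real \<times> real \<times> real \<Rightarrow> bool" where
  "has_shape B P T \<longleftrightarrow>
     T \<in> shapes \<and> ideal_tetrahedron B P \<and>
     doubly_stochastic (shape_gram T) \<and> is_gram_matrix B P (shape_gram T)"

definition det_per :: "real \<times> real \<times> real \<Rightarrow> real \<times> real" where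
  "det_per T = (det (shape_gram T), sqrt (permanent (shape_gram T)))"

definition det_per_region :: "(real \<times> real) set" where
  "det_per_region = det_per ` shapes"

text \<open>The common volume of the tetrahedra with invariants \<open>(\<alpha>, \<omega>)\<close>; meaningful for
  \<open>(\<alpha>, \<omega>) \<in> det_per_region\<close>.\<close>

definition vol ::
  "('v::real_vector \<Rightarrow> 'v \<Rightarrow> real) \<Rightarrow> (3 \<Rightarrow> 'v) \<Rightarrow> 'v \<Rightarrow> real \<Rightarrow> real \<Rightarrow> real" where
  "vol B b e \<alpha> \<omega> =
     (THE c. \<exists>T P. has_shape B P T \<and> det_per T = (\<alpha>, \<omega>) \<and> c = tetrahedron_volume B b e P)"

end

(*
  Write p = sum_i u_i v_i for the point of the tetrahedron with barycentric weights u. In these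
  projective coordinates the hyperbolic volume form is sqrt(-det G) du / B(p,p)^2, and B(p,p) is
  the quadratic form of the Gram matrix G. Two elementary integrations and one application of
  Tonelli's theorem reduce the integral to
    vol = int_{r/s}^oo sin C ln m / (m^2 - 2 m cos C + 1) dm,
  where A, B, C are the angles of the Euclidean triangle with sides r, s, t, that is, the dihedral
  angles. The integrand is the derivative of -(L(cot A) + L(cot B)), where L is the Lobachevsky
  function as a function of the cotangent: L'(q) = (ln 2 - ln(1 + q^2)/2) / (1 + q^2). Since L is
  odd, vol = L(cot A) + L(cot B) + L(cot C) - L(oo).

  Order the sides as s <= t <= r. On a level curve of the determinant or of the permanent the
  middle side t is a parameter. For constant determinant the sign of the derivative of the volume
  is that of a second divided difference of the strictly convex function x ln x. For constant
  permanent it is the sign of a weighted sum of ln (r/t) and ln (t/s), which follows from the bounds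
  2(x - 1)/(x + 1) <= ln x <= (x - 1/x)/2 for x >= 1.
*)
theory Submission
  imports Defs "HOL-Real_Asymp.Real_Asymp"
begin

section \<open>The Lobachevsky function in cotangent coordinates\<close>

text \<open>The cotangents of the dihedral angles are algebraic in the sides: (s^2 + t^2 - r^2) /
  \<rho> and its permutations, where \<rho>^2 = -det G. By Heron's formula \<rho> is four times the
  area of the triangle of perimeter 1. Level curves can thus be differentiated without inverse
  trigonometric functions. Both signs rest on one cancellation. The volume has derivative -sum ln (2
  sin A) A', and the law of sines gives ln (2 sin A) = ln r - ln R with the circumradius R. The
  angles sum to pi, so R drops out and only logarithms of ratios of sides remain. L(oo) cancels in
  every comparison; positivity of the volume is read off the integrand. The obstacle in the integral
  is the logarithm left by integrating out two weights. It is expanded as an integral over m from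
  r/s to oo; after the exchange the remaining weight meets only a rational function. At det G = 0
  the cotangents have denominator 0. There the volume vanishes for a geometric reason, and
  monotonicity up to this boundary is positivity elsewhere.\<close>

definition lob_density :: "real \<Rightarrow> real" where
  "lob_density q = (ln 2 - ln (1 + q\<^sup>2) / 2) / (1 + q\<^sup>2)"

text \<open>The substitution q = cot \<theta> turns dq / (1 + q^2) into -d\<theta> and the numerator
  of the density into ln (2 sin \<theta>). Hence \<open>lob (cot \<theta>)\<close> has derivative
  -ln (2 sin \<theta>) in \<theta>; the normalisation at 0 is the one at the right angle.\<close>

definition lob :: "real \<Rightarrow> real" where
  "lob = (SOME F. F 0 = 0 \<and> (\<forall>q. (F has_real_derivative lob_density q) (at q)))"

lemma one_plus_sq_pos: "1 + (q::real)\<^sup>2 > 0"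
  by (simp add: add_pos_nonneg)

lemma lob_spec: "lob 0 = 0 \<and> (\<forall>q. (lob has_real_derivative lob_density q) (at q))"
proof -
  have "isCont lob_density q" for q
    unfolding lob_density_def using one_plus_sq_pos[of q] by (intro continuous_intros) auto
  then obtain F where F: "\<And>q. (F has_vector_derivative lob_density q) (at q)"
    using einterval_antiderivative[of "-\<infinity>" "\<infinity>" lob_density] by auto
  let ?G = "\<lambda>q. F q - F 0"
  have "?G 0 = 0 \<and> (\<forall>q. (?G has_real_derivative lob_density q) (at q))"
    using F by (auto simp: has_real_derivative_iff_has_vector_derivative intro!: derivative_eq_intros)
  then show ?thesis unfolding lob_def by (rule someI[where P="\<lambda>F. F 0 = 0 \<and> (\<forall>q. (F has_real_derivative lob_density q) (at q))"])
qed

lemma lob_0 [simp]: "lob 0 = 0"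
  using lob_spec by blast

lemma DERIV_lob: "(lob has_real_derivative lob_density q) (at q)"
  using lob_spec by blast

lemmas DERIV_lob' [derivative_intros] = DERIV_lob[THEN DERIV_chain2]

lemma isCont_lob: "isCont lob q"
  using DERIV_lob DERIV_isCont by blast

lemma continuous_on_lob [continuous_intros]:
  "continuous_on A f \<Longrightarrow> continuous_on A (\<lambda>x. lob (f x))"
  using continuous_on_compose2[of UNIV lob A f] isCont_lob
  by (simp add: continuous_at_imp_continuous_on)

lemma lob_minus: "lob (- q) = - lob q"
proof -
  have "((\<lambda>q. lob q + lob (- q)) has_real_derivative 0) (at q)" for q
    by (auto intro!: derivative_eq_intros simp: lob_density_def)
  then have "lob q + lob (- q) = lob 0 + lob (- 0)"
    by (intro DERIV_isconst_all) auto
  then show ?thesis by simp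
qed

lemma lob_density_nonpos:
  assumes "q \<ge> 2"
  shows "lob_density q \<le> 0"
proof -
  have "(2::real)\<^sup>2 \<le> 1 + q\<^sup>2" using assms power_mono[of 2 q 2] by simp
  then have "ln ((2::real)\<^sup>2) \<le> ln (1 + q\<^sup>2)" by (subst ln_le_cancel_iff) (auto simp: one_plus_sq_pos)
  then have "2 * ln 2 \<le> ln (1 + q\<^sup>2)" by (simp only: ln_realpow)
  then show ?thesis using one_plus_sq_pos[of q]
    unfolding lob_density_def by (intro divide_nonpos_pos) auto
qed

text \<open>The density behaves like -(ln q) / q^2. It is nonpositive from 2 on, so
  \<open>lob\<close> decreases there. The exponent -3/2 belongs to a power that dominates (ln q) /
  q^2 and is still integrable, which bounds \<open>lob\<close> from below.\<close>

lemma lob_convergent: "\<exists>L. (lob \<longlongrightarrow> L) at_top"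
proof -
  have "eventually (\<lambda>q::real. - (q powr (-3/2)) \<le> lob_density q) at_top"
    unfolding lob_density_def by real_asymp
  then obtain q0 where q0: "\<And>q. q \<ge> q0 \<Longrightarrow> - (q powr (-3/2)) \<le> lob_density q"
    by (auto simp: eventually_at_top_linorder)
  define a where "a = max q0 2"
  have bnd: "lob q \<ge> lob a - 2 * a powr (-1/2)" if "q \<ge> a" for q
  proof -
    have "lob a - 2 * a powr (-1/2) \<le> lob q - 2 * q powr (-1/2)"
    proof (rule DERIV_nonneg_imp_nondecreasing[OF that])
      fix x assume x: "a \<le> x" "x \<le> q"
      then have "x > 0" "x \<ge> q0" by (auto simp: a_def)
      then show "\<exists>y. ((\<lambda>q. lob q - 2 * q powr (-1/2)) has_real_derivative y) (at x) \<and> 0 \<le> y"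
        using q0[of x]
        by (intro exI[of _ "lob_density x + x powr (-3/2)"]) (auto intro!: derivative_eq_intros simp: algebra_simps)
    qed
    then show ?thesis using powr_ge_zero[of q "-1/2"] by linarith
  qed
  have dec: "lob y \<le> lob x" if "a \<le> x" "x \<le> y" for x y
  proof (rule DERIV_nonpos_imp_nonincreasing[OF that(2)])
    fix u assume "x \<le> u" "u \<le> y"
    then show "\<exists>z. (lob has_real_derivative z) (at u) \<and> z \<le> 0"
      using that DERIV_lob lob_density_nonpos[of u] by (force simp: a_def)
  qed
  define L where "L = (INF x\<in>{a..}. lob x)"
  have bdd: "bdd_below (lob ` {a..})" using bnd by (auto intro!: bdd_belowI2)
  have "(lob \<longlongrightarrow> L) at_top"
  proof (rule decreasing_tendsto)
    show "eventually (\<lambda>n. L \<le> lob n) at_top"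
      using eventually_ge_at_top[of a] by eventually_elim (auto simp: L_def intro!: cINF_lower bdd)
  next
    fix x assume "L < x"
    then obtain y where y: "y \<ge> a" "lob y < x"
      unfolding L_def by (subst (asm) cINF_less_iff) (auto intro!: bdd)
    show "eventually (\<lambda>n. lob n < x) at_top"
      using eventually_ge_at_top[of y] by eventually_elim (use dec y in fastforce)
  qed
  then show ?thesis ..
qed

definition lob_limit :: real where
  "lob_limit = (SOME L. (lob \<longlongrightarrow> L) at_top)"

lemma lob_tendsto: "(lob \<longlongrightarrow> lob_limit) at_top"
  unfolding lob_limit_def using lob_convergent by (rule someI_ex)

text \<open>Consider the triangle with sides m and 1 that enclose the angle C, where c = cos C and
  \<sigma> = sin C. Its other angles have cotangents (m - c) / \<sigma> and (1 / m - c) / \<sigma>.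
  Their sum is constant in m, so the derivative of the two Lobachevsky terms only sees the logarithm
  of the ratio of the sines, which is m. For m tending to infinity these angles tend to 0 and pi -
  C, hence \<open>lob_limit\<close> and \<open>lob (c / \<sigma>)\<close>.\<close>

lemma nn_integral_lob_tail:
  fixes c \<sigma> k :: real
  assumes c: "c\<^sup>2 + \<sigma>\<^sup>2 = 1" and \<sigma>: "\<sigma> > 0" and k: "k \<ge> 1"
  shows "(\<integral>\<^sup>+m. ennreal (\<sigma> * ln m / (m\<^sup>2 - 2 * c * m + 1)) * indicator {k..} m \<partial>lborel) =
    ennreal (lob ((k - c) / \<sigma>) + lob ((1 / k - c) / \<sigma>) + lob (c / \<sigma>) - lob_limit)"
proof -
  have pos: "m\<^sup>2 - 2 * c * m + 1 > 0" for m
  proof -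
    have "m\<^sup>2 - 2 * c * m + 1 = (m - c)\<^sup>2 + \<sigma>\<^sup>2" using c by (simp add: power2_eq_square algebra_simps)
    then show ?thesis using \<sigma> by (simp add: add_nonneg_pos)
  qed
  define F where "F = (\<lambda>m. - lob ((m - c) / \<sigma>) - lob ((1 / m - c) / \<sigma>))"
  have "(\<integral>\<^sup>+m. ennreal (\<sigma> * ln m / (m\<^sup>2 - 2 * c * m + 1)) * indicator {k..} m \<partial>lborel) =
    ennreal ((- lob_limit - lob ((0 - c) / \<sigma>)) - F k)"
  proof (rule nn_integral_FTC_atLeast)
    fix m assume m: "k \<le> m"
    then have m1: "m \<ge> 1" using k by simp
    have q1: "1 + ((m - c) / \<sigma>)\<^sup>2 = (m\<^sup>2 - 2 * c * m + 1) / \<sigma>\<^sup>2"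
      using \<sigma> c by (simp add: power_divide field_simps power2_eq_square)
    have "1 + ((1 / m - c) / \<sigma>)\<^sup>2 = (\<sigma>\<^sup>2 + (1 / m - c)\<^sup>2) / \<sigma>\<^sup>2"
      using \<sigma> by (simp add: power_divide field_simps)
    also have "\<sigma>\<^sup>2 + (1 / m - c)\<^sup>2 = (m\<^sup>2 - 2 * c * m + 1) / m\<^sup>2"
    proof -
      have "\<sigma>\<^sup>2 + (1 / m - c)\<^sup>2 = 1 - 2 * c / m + 1 / m\<^sup>2" using c by (simp add: power2_diff power_divide)
      then show ?thesis using m1 by (simp add: field_simps power2_eq_square)
    qed
    finally have q2: "1 + ((1 / m - c) / \<sigma>)\<^sup>2 = (m\<^sup>2 - 2 * c * m + 1) / \<sigma>\<^sup>2 / m\<^sup>2" by simp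
    define X where "X = (m\<^sup>2 - 2 * c * m + 1) / \<sigma>\<^sup>2"
    have X: "X > 0" using pos \<sigma> by (simp add: X_def)
    have d1: "lob_density ((m - c) / \<sigma>) = (ln 2 - ln X / 2) / X"
      unfolding lob_density_def q1 X_def ..
    have d2: "lob_density ((1 / m - c) / \<sigma>) = (ln 2 - ln X / 2 + ln m) / X * m\<^sup>2"
      unfolding lob_density_def q2 X_def[symmetric] using m1 X
      by (simp add: ln_div ln_realpow diff_divide_distrib)
    have "(F has_real_derivative (- (lob_density ((m - c) / \<sigma>) * (1 / \<sigma>)) -
        lob_density ((1 / m - c) / \<sigma>) * (- (1 / m\<^sup>2) / \<sigma>))) (at m)"
      unfolding F_def using m1 \<sigma>
      by (auto intro!: derivative_eq_intros simp: power2_eq_square field_simps)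
    also have "- (lob_density ((m - c) / \<sigma>) * (1 / \<sigma>)) - lob_density ((1 / m - c) / \<sigma>) * (- (1 / m\<^sup>2) / \<sigma>)
       = ln m / X / \<sigma>"
      unfolding d1 d2 using m1 X \<sigma> by (simp add: field_simps)
    also have "\<dots> = \<sigma> * ln m / (m\<^sup>2 - 2 * c * m + 1)"
      unfolding X_def using \<sigma> by (simp add: power2_eq_square)
    finally show "(F has_real_derivative \<sigma> * ln m / (m\<^sup>2 - 2 * c * m + 1)) (at m)" .
    show "0 \<le> \<sigma> * ln m / (m\<^sup>2 - 2 * c * m + 1)" using pos[of m] \<sigma> m1 by simp
  next
    have 1: "filterlim (\<lambda>m. (m - c) / \<sigma>) at_top at_top" using \<sigma> by real_asymp
    have 2: "((\<lambda>m. (1 / m - c) / \<sigma>) \<longlongrightarrow> (0 - c) / \<sigma>) at_top"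
      using \<sigma> by (intro tendsto_intros tendsto_divide_0[OF tendsto_const]) (auto simp: filterlim_at_top_imp_at_infinity filterlim_ident)
    show "(F \<longlongrightarrow> - lob_limit - lob ((0 - c) / \<sigma>)) at_top"
      unfolding F_def
      by (intro tendsto_intros filterlim_compose[OF lob_tendsto 1] isCont_tendsto_compose[OF isCont_lob 2])
  qed simp
  also have "(- lob_limit - lob ((0 - c) / \<sigma>)) - F k =
      lob ((k - c) / \<sigma>) + lob ((1 / k - c) / \<sigma>) + lob (c / \<sigma>) - lob_limit"
    using lob_minus[of "c / \<sigma>"] by (simp add: F_def)
  finally show ?thesis .
qed

section \<open>Monotonicity along the level curves\<close>

lemma ln_ge_pade:
  fixes x :: real
  assumes "x \<ge> 1"
  shows "2 * (x - 1) / (x + 1) \<le> ln x"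
proof -
  have "ln 1 - 2 * (1 - 1) / (1 + 1) \<le> ln x - 2 * (x - 1) / (x + 1)"
  proof (rule DERIV_nonneg_imp_nondecreasing[OF assms])
    fix u :: real assume u: "1 \<le> u" "u \<le> x"
    have "1 / u - 4 / (u + 1)\<^sup>2 = (u - 1)\<^sup>2 / (u * (u + 1)\<^sup>2)"
      using u by (simp add: divide_simps) (simp add: power2_eq_square algebra_simps)
    then have "0 \<le> 1 / u - 4 / (u + 1)\<^sup>2" using u by simp
    moreover have "((\<lambda>x. ln x - 2 * (x - 1) / (x + 1)) has_real_derivative 1 / u - 4 / (u + 1)\<^sup>2) (at u)"
      using u by (auto intro!: derivative_eq_intros simp: power2_eq_square algebra_simps)
    ultimately show "\<exists>y. ((\<lambda>x. ln x - 2 * (x - 1) / (x + 1)) has_real_derivative y) (at u) \<and> 0 \<le> y"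
      by blast
  qed
  then show ?thesis by simp
qed

lemma ln_le_half_diff_inverse:
  fixes x :: real
  assumes "x \<ge> 1"
  shows "ln x \<le> (x - 1 / x) / 2"
proof -
  have "(1 - 1 / 1) / 2 - ln 1 \<le> (x - 1 / x) / 2 - ln x"
  proof (rule DERIV_nonneg_imp_nondecreasing[OF assms])
    fix u :: real assume u: "1 \<le> u" "u \<le> x"
    have "(1 + 1 / u\<^sup>2) / 2 - 1 / u = (u - 1)\<^sup>2 / (2 * u\<^sup>2)"
      using u by (simp add: divide_simps) (simp add: power2_eq_square algebra_simps)
    then have "0 \<le> (1 + 1 / u\<^sup>2) / 2 - 1 / u" using u by simp
    moreover have "((\<lambda>x. (x - 1 / x) / 2 - ln x) has_real_derivative (1 + 1 / u\<^sup>2) / 2 - 1 / u) (at u)"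
      using u by (auto intro!: derivative_eq_intros simp: power2_eq_square)
    ultimately show "\<exists>y. ((\<lambda>x. (x - 1 / x) / 2 - ln x) has_real_derivative y) (at u) \<and> 0 \<le> y"
      by blast
  qed
  then show ?thesis by simp
qed

text \<open>This is the sign of the derivative of the volume along a level curve of the permanent,
  cleared of denominators. The upper bound for ln (t / s) and the lower bound for ln (r / t) both
  yield the factor (r - t)(t - s). What remains is X (t + s) / (2 t) < (X + 2 t (r - s)) 2 r / (r +
  t), where the first fraction is at most 1 and the second at least 1.\<close>

lemma weighted_ln_ineq:
  fixes r s t :: real
  assumes "0 < s" "s < t" "t < r" "r < s + t"
  defines "w \<equiv> r\<^sup>2 + s\<^sup>2 + t\<^sup>2"
  shows "(r - t) * s * (2 * s * (r + t) - w) * ln (t / s) < (t - s) * r * (2 * r * (s + t) - w) * ln (r / t)"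
proof -
  define X where "X = 2 * s * (r + t) - w"
  have eq: "2 * r * (s + t) - w = X + 2 * t * (r - s)" by (simp add: X_def algebra_simps)
  \<comment> \<open>The coefficient on the right-hand side equals 2 s t - (s + t - r)^2.\<close>
  have "(s + t - r)\<^sup>2 < s\<^sup>2" using assms by (intro power_strict_mono) auto
  also have "s\<^sup>2 < 2 * s * t" using assms by (simp add: power2_eq_square)
  finally have pos: "2 * r * (s + t) - w > 0" by (simp add: w_def power2_eq_square algebra_simps)
  have ln1: "ln (r / t) > 0" "ln (t / s) > 0" using assms by (simp_all add: ln_div)
  show ?thesis
  proof (cases "X \<le> 0")
    case True
    then have "(r - t) * s * X * ln (t / s) \<le> 0" using assms ln1
      by (intro mult_nonpos_nonneg mult_nonneg_nonpos) auto
    moreover have "(t - s) * r * (2 * r * (s + t) - w) * ln (r / t) > 0"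
      using assms ln1 pos by (intro mult_pos_pos) auto
    ultimately show ?thesis by (simp add: X_def)
  next
    case False
    then have X: "X > 0" by simp
    have "ln (t / s) \<le> (t / s - 1 / (t / s)) / 2" using assms by (intro ln_le_half_diff_inverse) auto
    also have "\<dots> = (t - s) * (t + s) / (2 * t * s)" using assms by (simp add: field_simps)
    finally have "(r - t) * s * X * ln (t / s) \<le> (r - t) * s * X * ((t - s) * (t + s) / (2 * t * s))"
      using assms X by (intro mult_left_mono mult_nonneg_nonneg) auto
    also have "\<dots> = (r - t) * (t - s) * (X * ((t + s) / (2 * t)))" using assms by (simp add: field_simps)
    also have "\<dots> < (r - t) * (t - s) * ((X + 2 * t * (r - s)) * (2 * r / (r + t)))"
    proof -
      have "(t + s) / (2 * t) \<le> 1" "1 \<le> 2 * r / (r + t)" using assms by (auto simp: field_simps)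
      then have "X * ((t + s) / (2 * t)) \<le> X" "X + 2 * t * (r - s) \<le> (X + 2 * t * (r - s)) * (2 * r / (r + t))"
        using X pos eq mult_left_mono[of "(t + s) / (2 * t)" 1 X]
          mult_left_mono[of 1 "2 * r / (r + t)" "X + 2 * t * (r - s)"] by auto
      moreover have "2 * t * (r - s) > 0" using assms by simp
      ultimately have "X * ((t + s) / (2 * t)) < (X + 2 * t * (r - s)) * (2 * r / (r + t))" by linarith
      then show ?thesis using assms by (intro mult_strict_left_mono) auto
    qed
    also have "\<dots> = (t - s) * r * (X + 2 * t * (r - s)) * (2 * (r / t - 1) / (r / t + 1))"
    proof -
      have "(r / t - 1) / (r / t + 1) = (r - t) / (r + t)" using assms by (simp add: divide_simps)
      then have "2 * (r / t - 1) / (r / t + 1) = 2 * (r - t) / (r + t)" by (metis times_divide_eq_right)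
      then show ?thesis by simp
    qed
    also have "\<dots> \<le> (t - s) * r * (X + 2 * t * (r - s)) * ln (r / t)"
      using assms pos eq by (intro mult_left_mono mult_nonneg_nonneg ln_ge_pade) auto
    finally show ?thesis by (simp add: eq X_def)
  qed
qed

text \<open>Strict convexity of x ln x by means of the tangent at q: both outer values lie strictly
  above it, and the weights w - q and q - p cancel the linear terms.\<close>

lemma xlnx_chord:
  fixes p q w :: real
  assumes "0 < p" "p < q" "q < w"
  shows "(w - p) * q * ln q < (w - q) * p * ln p + (q - p) * w * ln w"
proof -
  have ln_less: "1 - 1 / x < ln x" if "x > 0" "x \<noteq> 1" for x :: real
  proof -
    have "ln (1 / x) \<le> 1 / x - 1" "ln (1 / x) \<noteq> 1 / x - 1"
      using that ln_le_minus_one[of "1 / x"] ln_eq_minus_one[of "1 / x"] by auto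
    then show ?thesis using that by (simp add: ln_div)
  qed
  have "w - q < w * ln (w / q)"
    using ln_less[of "w / q"] assms by (simp add: field_simps)
  then have 1: "(q - p) * (w - q) < (q - p) * (w * ln (w / q))" using assms by (intro mult_strict_left_mono) auto
  have "p - q < p * ln (p / q)"
    using ln_less[of "p / q"] assms by (simp add: field_simps)
  then have 2: "(w - q) * (p - q) < (w - q) * (p * ln (p / q))" using assms by (intro mult_strict_left_mono) auto
  have "0 < (q - p) * (w * ln (w / q)) + (w - q) * (p * ln (p / q))"
    using add_strict_mono[OF 1 2] by (simp add: algebra_simps)
  then show ?thesis using assms by (simp add: ln_div algebra_simps)
qed

section \<open>Level curves of the permanent\<close>

text \<open>The argument is the cotangent of the angle A opposite r, and 2 s t / \<rho> is 1 / sin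
  A, so the numerator of the density is ln (2 sin A). By the law of sines 2 sin A = r / R with
  circumradius R = r s t / \<rho>. The point of this form is that the first logarithm is the same
  for all three sides.\<close>

lemma shape_cotangent:
  fixes r s t :: real
  assumes "r + s + t = 1" "r > 0" "s > 0" "t > 0" "\<rho> > 0"
    and "\<rho>\<^sup>2 = (1 - 2 * r) * (1 - 2 * s) * (1 - 2 * t)"
  shows "lob_density ((s\<^sup>2 + t\<^sup>2 - r\<^sup>2) / \<rho>) = (ln (\<rho> / (r * s * t)) + ln r) * (\<rho>\<^sup>2 / (4 * s\<^sup>2 * t\<^sup>2))"
proof -
  define Y where "Y = 2 * s * t / \<rho>"
  have Y: "Y > 0" using assms by (simp add: Y_def)
  have "\<rho>\<^sup>2 + (s\<^sup>2 + t\<^sup>2 - r\<^sup>2)\<^sup>2 = 4 * s\<^sup>2 * t\<^sup>2"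
  proof -
    have r: "r = 1 - s - t" using assms by simp
    show ?thesis unfolding assms(6) r by (simp add: power2_eq_square algebra_simps)
  qed
  then have "1 + ((s\<^sup>2 + t\<^sup>2 - r\<^sup>2) / \<rho>)\<^sup>2 = Y\<^sup>2"
    using assms(5) by (simp add: Y_def power_divide field_simps)
  then have "lob_density ((s\<^sup>2 + t\<^sup>2 - r\<^sup>2) / \<rho>) = (ln 2 - ln Y) / Y\<^sup>2"
    using Y by (simp add: lob_density_def ln_realpow)
  also have "ln 2 - ln Y = ln (\<rho> / (r * s * t)) + ln r"
    using assms by (simp add: Y_def ln_div ln_mult)
  also have "(ln (\<rho> / (r * s * t)) + ln r) / Y\<^sup>2 =
      (ln (\<rho> / (r * s * t)) + ln r) * (\<rho>\<^sup>2 / (4 * s\<^sup>2 * t\<^sup>2))"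
    by (simp add: Y_def power_divide power_mult_distrib)
  finally show ?thesis .
qed

text \<open>When t moves along a level curve of the permanent, the derivative of the cotangent of
  the angle opposite r has a numerator proportional to the left side. The right side exposes a
  factor s t, which cancels against the denominator of the density.\<close>

lemma fixed_permanent_identity:
  fixes r s t :: real
  assumes "r + s + t = 1"
  shows "(s\<^sup>2 + t\<^sup>2 - r\<^sup>2) * (r - s) * (r - t) - r * ((1 - 2 * r) * (1 - 2 * s) * (1 - 2 * t)) =
    s * t * (r\<^sup>2 + s\<^sup>2 + t\<^sup>2 - 2 * r * (s + t))"
proof -
  have r: "r = 1 - s - t" using assms by simp
  show ?thesis unfolding r by (simp add: power2_eq_square algebra_simps)
qed

lemma DERIV_lob_quotient:
  fixes f \<rho> :: "real \<Rightarrow> real"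
  assumes "(f has_real_derivative f') (at x)" "(\<rho> has_real_derivative \<rho>') (at x)" "\<rho> x > 0"
  shows "((\<lambda>x. lob ((w - 2 * (f x)\<^sup>2) / \<rho> x)) has_real_derivative
    lob_density ((w - 2 * (f x)\<^sup>2) / \<rho> x) * (- (4 * f x * f' * \<rho> x + (w - 2 * (f x)\<^sup>2) * \<rho>') / (\<rho> x)\<^sup>2)) (at x)"
  using assms
  by (auto intro!: derivative_eq_intros simp: power2_eq_square field_simps)

text \<open>\<open>r'\<close> and \<open>s'\<close> are the derivatives in t forced by constant r +
  s + t and constant r^2 + s^2 + t^2, and \<open>\<rho>'\<close> is the resulting derivative of
  \<rho>. Each summand is K plus the logarithm of a side, times a coefficient that is minus the
  derivative of an angle. The angles sum to pi, so the coefficients sum to 0, which is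
  \<open>zero\<close>; K disappears and \<open>weighted_ln_ineq\<close> decides the sign.\<close>

lemma fixed_permanent_derivative_pos:
  fixes r s t \<rho> :: real
  assumes sum: "r + s + t = 1" and ord: "0 < s" "s < t" "t < r" "r < 1 / 2" and \<rho>: "\<rho> > 0"
    and \<rho>2: "\<rho>\<^sup>2 = (1 - 2 * r) * (1 - 2 * s) * (1 - 2 * t)"
  defines "w \<equiv> r\<^sup>2 + s\<^sup>2 + t\<^sup>2"
  defines "\<rho>' \<equiv> 4 * (r - t) * (t - s) / \<rho>"
  defines "r' \<equiv> - (t - s) / (r - s)" and "s' \<equiv> - (r - t) / (r - s)"
  defines "summand \<equiv> \<lambda>f f'. lob_density ((w - 2 * f\<^sup>2) / \<rho>) * (- (4 * f * f' * \<rho> + (w - 2 * f\<^sup>2) * \<rho>') / \<rho>\<^sup>2)"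
  shows "0 < summand r r' + summand s s' + summand t 1"
proof -
  have pos: "r > 0" "s > 0" "t > 0" using ord by auto
  define K where "K = ln (\<rho> / (r * s * t))"
  define A where "A = (\<lambda>a b c :: real. w - 2 * a * (b + c))"
  have w: "w - 2 * r\<^sup>2 = s\<^sup>2 + t\<^sup>2 - r\<^sup>2" "w - 2 * s\<^sup>2 = r\<^sup>2 + t\<^sup>2 - s\<^sup>2" "w - 2 * t\<^sup>2 = r\<^sup>2 + s\<^sup>2 - t\<^sup>2"
    by (simp_all add: w_def)
  have \<rho>2': "\<rho>\<^sup>2 = (1 - 2 * s) * (1 - 2 * r) * (1 - 2 * t)" "\<rho>\<^sup>2 = (1 - 2 * t) * (1 - 2 * r) * (1 - 2 * s)"
    using \<rho>2 by (simp_all only: mult.assoc mult.commute mult.left_commute)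
  have K: "\<rho> / (s * r * t) = \<rho> / (r * s * t)" "\<rho> / (t * r * s) = \<rho> / (r * s * t)"
    by (simp_all only: mult.assoc mult.commute mult.left_commute)
  have dr: "lob_density ((w - 2 * r\<^sup>2) / \<rho>) = (K + ln r) * (\<rho>\<^sup>2 / (4 * s\<^sup>2 * t\<^sup>2))"
    unfolding w K_def using sum pos \<rho> \<rho>2 by (intro shape_cotangent) auto
  have ds: "lob_density ((w - 2 * s\<^sup>2) / \<rho>) = (K + ln s) * (\<rho>\<^sup>2 / (4 * r\<^sup>2 * t\<^sup>2))"
    unfolding w K_def K(1)[symmetric] using sum pos \<rho> \<rho>2' by (intro shape_cotangent) auto
  have dt: "lob_density ((w - 2 * t\<^sup>2) / \<rho>) = (K + ln t) * (\<rho>\<^sup>2 / (4 * r\<^sup>2 * s\<^sup>2))"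
    unfolding w K_def K(2)[symmetric] using sum pos \<rho> \<rho>2' by (intro shape_cotangent) auto
  have idr: "(w - 2 * r\<^sup>2) * (r - s) * (r - t) - r * \<rho>\<^sup>2 = s * t * A r s t"
    using fixed_permanent_identity[of r s t] sum unfolding \<rho>2 w A_def by (simp add: w_def)
  have ids: "(w - 2 * s\<^sup>2) * (s - r) * (s - t) - s * \<rho>\<^sup>2 = r * t * A s r t"
    using fixed_permanent_identity[of s r t] sum unfolding \<rho>2'(1) w A_def by (simp add: w_def add.commute)
  have idt: "(w - 2 * t\<^sup>2) * (t - r) * (t - s) - t * \<rho>\<^sup>2 = r * s * A t r s"
    using fixed_permanent_identity[of t r s] sum unfolding \<rho>2'(2) w A_def by (simp add: w_def add.commute add.left_commute)
  have tr: "summand r r' = - (K + ln r) * ((t - s) * A r s t / (\<rho> * (r - s) * s * t))"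
  proof -
    have "4 * r * r' * \<rho> + (w - 2 * r\<^sup>2) * \<rho>' =
        4 * (t - s) / (\<rho> * (r - s)) * ((w - 2 * r\<^sup>2) * (r - s) * (r - t) - r * \<rho>\<^sup>2)"
      unfolding r'_def \<rho>'_def using ord \<rho> by (simp add: divide_simps) (simp add: algebra_simps power2_eq_square)
    note e = this[unfolded idr]
    show ?thesis unfolding summand_def dr e
      using pos \<rho> ord by (simp add: divide_simps power2_eq_square) (simp add: algebra_simps)
  qed
  have ts: "summand s s' = - (K + ln s) * ((r - t) * A s r t / (\<rho> * (r - s) * r * t))"
  proof -
    have "4 * s * s' * \<rho> + (w - 2 * s\<^sup>2) * \<rho>' =
        4 * (r - t) / (\<rho> * (r - s)) * ((w - 2 * s\<^sup>2) * (s - r) * (s - t) - s * \<rho>\<^sup>2)"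
      unfolding s'_def \<rho>'_def using ord \<rho> by (simp add: divide_simps) (simp add: algebra_simps power2_eq_square)
    note e = this[unfolded ids]
    show ?thesis unfolding summand_def ds e
      using pos \<rho> ord by (simp add: divide_simps power2_eq_square) (simp add: algebra_simps)
  qed
  have tt: "summand t 1 = (K + ln t) * (A t r s / (\<rho> * r * s))"
  proof -
    have "4 * t * 1 * \<rho> + (w - 2 * t\<^sup>2) * \<rho>' =
        - 4 / \<rho> * ((w - 2 * t\<^sup>2) * (t - r) * (t - s) - t * \<rho>\<^sup>2)"
      unfolding \<rho>'_def using ord \<rho> by (simp add: divide_simps) (simp add: algebra_simps power2_eq_square)
    note e = this[unfolded idt]
    show ?thesis unfolding summand_def dt e
      using pos \<rho> ord by (simp add: divide_simps power2_eq_square)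
  qed
  have zero: "A t r s / (\<rho> * r * s) =
     (t - s) * A r s t / (\<rho> * (r - s) * s * t) + (r - t) * A s r t / (\<rho> * (r - s) * r * t)"
  proof -
    have "(r - s) * t * A t r s = (t - s) * r * A r s t + (r - t) * s * A s r t"
      by (simp add: A_def w_def power2_eq_square algebra_simps)
    then have "(r - s) * t * A t r s / (\<rho> * (r - s) * r * s * t) =
      ((t - s) * r * A r s t + (r - t) * s * A s r t) / (\<rho> * (r - s) * r * s * t)" by simp
    then show ?thesis using pos \<rho> ord by (simp add: add_divide_distrib)
  qed
  have "summand r r' + summand s s' + summand t 1 =
     (ln t - ln r) * ((t - s) * A r s t / (\<rho> * (r - s) * s * t)) +
     (ln t - ln s) * ((r - t) * A s r t / (\<rho> * (r - s) * r * t))"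
  proof -
    have "- (K + a) * U + - (K + b) * V + (K + c) * (U + V) = (c - a) * U + (c - b) * V" for a b c U V
      by (simp add: algebra_simps)
    then show ?thesis unfolding tr ts tt zero .
  qed
  also have "\<dots> = ((t - s) * r * (- A r s t) * ln (r / t) - (r - t) * s * (- A s r t) * ln (t / s)) / (\<rho> * (r - s) * r * s * t)"
    using pos \<rho> ord by (simp add: ln_div diff_divide_distrib) (simp add: divide_simps, simp add: algebra_simps)
  also have "\<dots> > 0"
  proof -
    have "(r - t) * s * (- A s r t) * ln (t / s) < (t - s) * r * (- A r s t) * ln (r / t)"
      using weighted_ln_ineq[of s t r] ord sum by (simp add: A_def w_def algebra_simps)
    then show ?thesis using pos \<rho> ord by (intro divide_pos_pos mult_pos_pos) auto
  qed
  finally show ?thesis .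
qed

text \<open>For perimeter 1 this is sixteen times the squared area of the triangle with sides r, s,
  t (Heron), and also minus the Gram determinant (\<open>det_shape_gram\<close>).\<close>

definition shape_disc :: "real \<times> real \<times> real \<Rightarrow> real" where
  "shape_disc = (\<lambda>(r, s, t). (1 - 2 * r) * (1 - 2 * s) * (1 - 2 * t))"

text \<open>The quotients are the cotangents of the angles of the triangle with sides r, s, t. Where
  \<open>shape_disc\<close> is 0 they are 0 by division by zero, so the value represents a volume
  only where \<open>shape_disc\<close> is positive.\<close>

definition lob_volume :: "real \<times> real \<times> real \<Rightarrow> real" where
  "lob_volume = (\<lambda>(r, s, t). let w = r\<^sup>2 + s\<^sup>2 + t\<^sup>2; \<rho> = sqrt (shape_disc (r, s, t)) in
     lob ((w - 2 * r\<^sup>2) / \<rho>) + lob ((w - 2 * s\<^sup>2) / \<rho>) + lob ((w - 2 * t\<^sup>2) / \<rho>) - lob_limit)"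

text \<open>Constant sum and constant sum of squares fix S = r s + s t + t r, so t determines the
  sum and the product of r and s. Everything is governed by 3 t^2 - 2 t + S, which equals (t - r)(t
  - s): it is negative exactly while t lies strictly between the other sides, and the derivative of
  \<open>\<delta>\<close> is -8 times it.\<close>

lemma fixed_permanent_curve:
  fixes r\<^sub>1 s\<^sub>1 t\<^sub>1 r\<^sub>2 s\<^sub>2 t\<^sub>2 :: real
  assumes sum: "r\<^sub>1 + s\<^sub>1 + t\<^sub>1 = 1" "r\<^sub>2 + s\<^sub>2 + t\<^sub>2 = 1"
    and ord: "s\<^sub>1 \<le> t\<^sub>1" "t\<^sub>1 \<le> r\<^sub>1" "r\<^sub>1 < 1 / 2" "s\<^sub>2 \<le> t\<^sub>2" "t\<^sub>2 \<le> r\<^sub>2" "r\<^sub>2 \<le> 1 / 2"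
    and per: "r\<^sub>1\<^sup>2 + s\<^sub>1\<^sup>2 + t\<^sub>1\<^sup>2 = r\<^sub>2\<^sup>2 + s\<^sub>2\<^sup>2 + t\<^sub>2\<^sup>2"
    and less: "t\<^sub>1 < t\<^sub>2"
  shows "shape_disc (r\<^sub>1, s\<^sub>1, t\<^sub>1) < shape_disc (r\<^sub>2, s\<^sub>2, t\<^sub>2)" (is ?disc)
    and "lob_volume (r\<^sub>1, s\<^sub>1, t\<^sub>1) < lob_volume (r\<^sub>2, s\<^sub>2, t\<^sub>2)" (is ?vol)
proof -
  define w where "w = r\<^sub>1\<^sup>2 + s\<^sub>1\<^sup>2 + t\<^sub>1\<^sup>2"
  define S where "S = (1 - w) / 2"
  \<comment> \<open>This is (r - s)^2, written as (r + s - 2 t)^2 - 4 (t - r)(t - s), so that a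
    negative product makes it visibly positive.\<close>
  define disc where "disc = (\<lambda>t. (1 - 3 * t)\<^sup>2 - 4 * (3 * t\<^sup>2 - 2 * t + S))"
  define r where "r = (\<lambda>t. (1 - t + sqrt (disc t)) / 2)"
  define s where "s = (\<lambda>t. (1 - t - sqrt (disc t)) / 2)"
  \<comment> \<open>\<open>shape_disc\<close> is 8 times the value at 1/2 of the monic cubic with
    roots r, s, t, and t^3 - t^2 + S t is the product r s t because t is a root.\<close>
  define \<delta> where "\<delta> = (\<lambda>t. 1 - 2 * w - 8 * (t ^ 3 - t\<^sup>2 + S * t))"
  define \<rho> where "\<rho> = (\<lambda>t. sqrt (\<delta> t))"
  define f where "f = (\<lambda>t. lob ((w - 2 * (r t)\<^sup>2) / \<rho> t) + lob ((w - 2 * (s t)\<^sup>2) / \<rho> t) + lob ((w - 2 * t\<^sup>2) / \<rho> t))"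
  have triple: "disc c = (a - b)\<^sup>2" "\<delta> c = shape_disc (a, b, c)" "(c - a) * (c - b) = 3 * c\<^sup>2 - 2 * c + S"
    if "a + b + c = 1" "a\<^sup>2 + b\<^sup>2 + c\<^sup>2 = w" for a b c
  proof -
    have c: "c = 1 - a - b" using that by simp
    have S: "S = a * b + (a + b) * (1 - a - b)"
      unfolding S_def that(2)[symmetric] c by (simp add: power2_eq_square field_simps)
    have w: "w = 1 - 2 * S" by (simp add: S_def field_simps)
    show "disc c = (a - b)\<^sup>2" "\<delta> c = shape_disc (a, b, c)" "(c - a) * (c - b) = 3 * c\<^sup>2 - 2 * c + S"
      unfolding disc_def \<delta>_def shape_disc_def w c unfolding S
      by (simp_all add: power2_eq_square power3_eq_cube algebra_simps)
  qed
  have ends: "r c = a" "s c = b" "\<delta> c = shape_disc (a, b, c)" "3 * c\<^sup>2 - 2 * c + S \<le> 0"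
    "lob_volume (a, b, c) = f c - lob_limit"
    if "a + b + c = 1" "a\<^sup>2 + b\<^sup>2 + c\<^sup>2 = w" "b \<le> c" "c \<le> a" for a b c
  proof -
    show rs: "r c = a" "s c = b" using that triple(1)[OF that(1,2)] by (simp_all add: r_def s_def)
    show d: "\<delta> c = shape_disc (a, b, c)" by (rule triple(2)[OF that(1,2)])
    show "3 * c\<^sup>2 - 2 * c + S \<le> 0"
      using that by (simp only: triple(3)[OF that(1,2), symmetric] mult_nonpos_nonneg diff_le_0_iff_le diff_ge_0_iff_ge)
    show "lob_volume (a, b, c) = f c - lob_limit"
      by (simp only: lob_volume_def Let_def prod.case that(2) f_def \<rho>_def rs d)
  qed
  have w: "r\<^sub>1\<^sup>2 + s\<^sub>1\<^sup>2 + t\<^sub>1\<^sup>2 = w" "r\<^sub>2\<^sup>2 + s\<^sub>2\<^sup>2 + t\<^sub>2\<^sup>2 = w" using per by (simp_all add: w_def)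
  note e1 = ends[OF sum(1) w(1) ord(1,2)] and e2 = ends[OF sum(2) w(2) ord(4,5)]
  \<comment> \<open>Strict convexity of the quadratic, which is at most 0 at both ends.\<close>
  have quad_neg: "3 * u\<^sup>2 - 2 * u + S < 0" if "t\<^sub>1 < u" "u < t\<^sub>2" for u
  proof -
    have "(t\<^sub>2 - t\<^sub>1) * (3 * u\<^sup>2 - 2 * u + S) = (t\<^sub>2 - u) * (3 * t\<^sub>1\<^sup>2 - 2 * t\<^sub>1 + S) +
        (u - t\<^sub>1) * (3 * t\<^sub>2\<^sup>2 - 2 * t\<^sub>2 + S) - 3 * (t\<^sub>2 - u) * (u - t\<^sub>1) * (t\<^sub>2 - t\<^sub>1)"
      by (simp add: power2_eq_square algebra_simps)
    moreover have "(t\<^sub>2 - u) * (3 * t\<^sub>1\<^sup>2 - 2 * t\<^sub>1 + S) \<le> 0" "(u - t\<^sub>1) * (3 * t\<^sub>2\<^sup>2 - 2 * t\<^sub>2 + S) \<le> 0"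
      "0 < 3 * (t\<^sub>2 - u) * (u - t\<^sub>1) * (t\<^sub>2 - t\<^sub>1)"
      using that e1(4) e2(4) by (auto intro: mult_nonneg_nonpos)
    ultimately have "(t\<^sub>2 - t\<^sub>1) * (3 * u\<^sup>2 - 2 * u + S) < 0" by linarith
    then show ?thesis using less by (simp add: mult_less_0_iff)
  qed
  have d\<delta>: "(\<delta> has_real_derivative - 8 * (3 * u\<^sup>2 - 2 * u + S)) (at u)" for u
    unfolding \<delta>_def by (auto intro!: derivative_eq_intros simp: power2_eq_square algebra_simps)
  have \<delta>_cont: "continuous_on A \<delta>" for A unfolding \<delta>_def by (intro continuous_intros)
  have \<delta>_less: "\<delta> t\<^sub>1 < \<delta> u" if "t\<^sub>1 < u" "u \<le> t\<^sub>2" for u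
  proof (rule DERIV_pos_imp_increasing_open[OF that(1) _ \<delta>_cont])
    fix v assume "t\<^sub>1 < v" "v < u"
    then show "\<exists>y. (\<delta> has_real_derivative y) (at v) \<and> 0 < y"
      using d\<delta> quad_neg[of v] that by (intro exI[of _ "- 8 * (3 * v\<^sup>2 - 2 * v + S)"]) auto
  qed
  show ?disc using \<delta>_less[OF less] e1(3) e2(3) by simp
  \<comment> \<open>Positive at the left end, \<open>\<delta>\<close> stays positive because it
    increases along the curve.\<close>
  have "\<delta> t\<^sub>1 > 0" unfolding e1(3) shape_disc_def using ord by auto
  then have \<delta>_pos: "\<delta> u > 0" if "t\<^sub>1 \<le> u" "u \<le> t\<^sub>2" for u
    using \<delta>_less[of u] that by (cases "u = t\<^sub>1") auto
  have rs: "r u + s u + u = 1" for u by (simp add: r_def s_def field_simps)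
  have "f t\<^sub>1 < f t\<^sub>2"
  proof (rule DERIV_pos_imp_increasing_open[OF less])
    have "continuous_on {t\<^sub>1..t\<^sub>2} \<rho>" "continuous_on {t\<^sub>1..t\<^sub>2} r" "continuous_on {t\<^sub>1..t\<^sub>2} s"
      unfolding r_def s_def \<rho>_def disc_def by (intro continuous_intros \<delta>_cont; simp)+
    then show "continuous_on {t\<^sub>1..t\<^sub>2} f"
      unfolding f_def using \<delta>_pos by (intro continuous_intros) (auto simp: \<rho>_def less_imp_neq[symmetric])
  next
    fix u assume u: "t\<^sub>1 < u" "u < t\<^sub>2"
    define d where "d = sqrt (disc u)"
    have disc: "disc u > 0"
      unfolding disc_def diff_gt_0_iff_gt
      by (rule less_le_trans[OF _ zero_le_power2]) (use quad_neg[OF u] in simp)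
    then have d: "d > 0" "d\<^sup>2 = disc u" by (simp_all add: d_def)
    have rd: "r u = (1 - u + d) / 2" and sd: "s u = (1 - u - d) / 2" by (simp_all add: r_def s_def d_def)
    have per_u: "(r u)\<^sup>2 + (s u)\<^sup>2 + u\<^sup>2 = w"
    proof -
      have "(r u)\<^sup>2 + (s u)\<^sup>2 + u\<^sup>2 = ((1 - u)\<^sup>2 + d\<^sup>2) / 2 + u\<^sup>2"
        unfolding rd sd by (simp add: power2_eq_square field_simps)
      then show ?thesis unfolding d(2) disc_def S_def by (simp add: power2_eq_square field_simps)
    qed
    note tr = triple[OF rs per_u]
    have "(r u - u) * (u - s u) > 0"
      using tr(3) quad_neg[OF u] by (simp add: algebra_simps)
    moreover have "s u < r u" using d rd sd by simp
    ultimately have su: "s u < u" and ur: "u < r u" by (auto simp: zero_less_mult_iff)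
    have "u < 1 / 2" using u ord by linarith
    moreover have "(1 - 2 * r u) * (1 - 2 * s u) * (1 - 2 * u) > 0"
      using \<delta>_pos[of u] u tr(2) by (simp add: shape_disc_def)
    ultimately have r_half: "r u < 1 / 2" using su by (simp add: zero_less_mult_iff)
    then have s_pos: "0 < s u" using rs[of u] \<open>u < 1 / 2\<close> by linarith
    have \<rho>: "\<rho> u > 0" "(\<rho> u)\<^sup>2 = (1 - 2 * r u) * (1 - 2 * s u) * (1 - 2 * u)"
      using \<delta>_pos[of u] u tr(2) by (simp_all add: \<rho>_def shape_disc_def)
    have "(disc has_real_derivative (2 - 6 * u)) (at u)"
      unfolding disc_def by (auto intro!: derivative_eq_intros simp: power2_eq_square algebra_simps)
    from DERIV_chain2[OF DERIV_real_sqrt[OF disc] this]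
    have dd: "((\<lambda>u. sqrt (disc u)) has_real_derivative (1 - 3 * u) / d) (at u)"
      by (rule DERIV_cong) (use d in \<open>simp add: d_def field_simps\<close>)
    have sum3: "1 - 3 * u = r u + s u - 2 * u" using rs[of u] by simp
    have rsd: "r u - s u = d" by (simp add: rd sd field_simps)
    have dr: "(r has_real_derivative - (u - s u) / (r u - s u)) (at u)"
    proof -
      have "(r has_real_derivative (- 1 + (1 - 3 * u) / d) / 2) (at u)"
        unfolding r_def
        by (rule DERIV_cdivide[OF DERIV_add[OF DERIV_diff[OF DERIV_const DERIV_ident] dd], THEN DERIV_cong]) simp
      also have "(- 1 + (1 - 3 * u) / d) / 2 = - (u - s u) / (r u - s u)"
        unfolding rsd sum3 using d(1) rsd by (simp add: field_simps)
      finally show ?thesis .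
    qed
    have ds: "(s has_real_derivative - (r u - u) / (r u - s u)) (at u)"
    proof -
      have "(s has_real_derivative (- 1 - (1 - 3 * u) / d) / 2) (at u)"
        unfolding s_def
        by (rule DERIV_cdivide[OF DERIV_diff[OF DERIV_diff[OF DERIV_const DERIV_ident] dd], THEN DERIV_cong]) simp
      also have "(- 1 - (1 - 3 * u) / d) / 2 = - (r u - u) / (r u - s u)"
        unfolding rsd sum3 using d(1) rsd by (simp add: field_simps)
      finally show ?thesis .
    qed
    have d\<rho>: "(\<rho> has_real_derivative 4 * (r u - u) * (u - s u) / \<rho> u) (at u)"
    proof -
      have "(\<rho> has_real_derivative (- 8 * (3 * u\<^sup>2 - 2 * u + S)) / (2 * \<rho> u)) (at u)"
        unfolding \<rho>_def using \<delta>_pos[of u] u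
        by (auto intro!: derivative_eq_intros d\<delta> simp: field_simps)
      also have "(- 8 * (3 * u\<^sup>2 - 2 * u + S)) / (2 * \<rho> u) = 4 * (r u - u) * (u - s u) / \<rho> u"
        unfolding tr(3)[symmetric] using \<rho>(1) by (simp add: field_simps)
      finally show ?thesis .
    qed
    note D = DERIV_add[OF DERIV_add[OF DERIV_lob_quotient[OF dr d\<rho> \<rho>(1)] DERIV_lob_quotient[OF ds d\<rho> \<rho>(1)]]
        DERIV_lob_quotient[OF DERIV_ident d\<rho> \<rho>(1)], of w w w]
    show "\<exists>y. (f has_real_derivative y) (at u) \<and> 0 < y"
      unfolding f_def
      by (rule exI, rule conjI, rule D)
        (rule fixed_permanent_derivative_pos[OF rs s_pos su ur r_half \<rho>, unfolded per_u])
  qed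
  then show ?vol using e1(5) e2(5) by simp
qed

section \<open>Level curves of the determinant\<close>

text \<open>The cubic increases up to 1/3 and decreases afterwards. It enters because b^2 (1 - 2 b)
  - a b c = b (b - a)(c - b) when a + b + c = 1: for w the constant product, the inequality says
  that y lies strictly between the other two variables.\<close>

lemma cubic_unimodal:
  fixes y\<^sub>1 y y\<^sub>2 w :: real
  assumes "0 < y\<^sub>1" "y\<^sub>1 < y" "y < y\<^sub>2" "w \<le> y\<^sub>1\<^sup>2 * (1 - 2 * y\<^sub>1)" "w \<le> y\<^sub>2\<^sup>2 * (1 - 2 * y\<^sub>2)"
  shows "w < y\<^sup>2 * (1 - 2 * y)"
proof (cases "y \<le> 1 / 3")
  case True
  have "2 * (y\<^sup>2 + y * y\<^sub>1 + y\<^sub>1\<^sup>2) < y + y\<^sub>1"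
  proof -
    have "y * y \<le> 1 / 3 * y" "y * y\<^sub>1 \<le> 1 / 3 * y\<^sub>1" "y\<^sub>1 * y\<^sub>1 \<le> 1 / 3 * y\<^sub>1"
      using True assms by (auto intro!: mult_right_mono)
    then show ?thesis using assms(2) unfolding power2_eq_square distrib_left by linarith
  qed
  then have "0 < (y - y\<^sub>1) * (y + y\<^sub>1 - 2 * (y\<^sup>2 + y * y\<^sub>1 + y\<^sub>1\<^sup>2))" using assms by simp
  also have "\<dots> = y\<^sup>2 * (1 - 2 * y) - y\<^sub>1\<^sup>2 * (1 - 2 * y\<^sub>1)"
    by (simp add: power2_eq_square algebra_simps)
  finally show ?thesis using assms by simp
next
  case False
  have "y + y\<^sub>2 < 2 * (y\<^sup>2 + y * y\<^sub>2 + y\<^sub>2\<^sup>2)"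
  proof -
    have "1 / 3 * y \<le> y * y" "1 / 3 * y\<^sub>2 \<le> y * y\<^sub>2" "1 / 3 * y\<^sub>2 \<le> y\<^sub>2 * y\<^sub>2"
      using False assms by (auto intro!: mult_right_mono)
    then show ?thesis using assms(3) unfolding power2_eq_square distrib_left by linarith
  qed
  then have "0 < (y\<^sub>2 - y) * (2 * (y\<^sup>2 + y * y\<^sub>2 + y\<^sub>2\<^sup>2) - y - y\<^sub>2)" using assms by simp
  also have "\<dots> = y\<^sup>2 * (1 - 2 * y) - y\<^sub>2\<^sup>2 * (1 - 2 * y\<^sub>2)"
    by (simp add: power2_eq_square algebra_simps)
  finally show ?thesis using assms by simp
qed

text \<open>For x = 1 - 2 r, and y, z likewise, x / \<rho> is the cotangent of half the angle
  opposite r, and the argument is the double-angle formula. It depends on x and \<rho> alone, so for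
  constant determinant each Lobachevsky term is a function of a single variable.\<close>

lemma DERIV_lob_half_angle:
  fixes x y z \<rho> :: real
  assumes sum: "x + y + z = 1" and pos: "x > 0" "y > 0" "z > 0" "\<rho> > 0" and prod: "\<rho>\<^sup>2 = x * y * z"
  shows "((\<lambda>x. lob ((x - \<rho>\<^sup>2 / x) / (2 * \<rho>))) has_real_derivative
    (ln (4 * \<rho> / ((x + y) * (x + z) * (y + z))) + ln (y + z)) * (2 * \<rho> / (x * (x + y) * (x + z)))) (at x)"
proof -
  have "x\<^sup>2 + \<rho>\<^sup>2 = x * (x + y * z)" unfolding prod by (simp add: power2_eq_square algebra_simps)
  also have "x + y * z = (x + y) * (x + z)"
  proof -
    have x: "x = 1 - y - z" using sum by simp
    show ?thesis unfolding x by (simp add: power2_eq_square algebra_simps)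
  qed
  finally have fac: "x\<^sup>2 + \<rho>\<^sup>2 = x * ((x + y) * (x + z))" .
  define Y where "Y = (x + y) * (x + z) / (2 * \<rho>)"
  have Y: "Y > 0" using pos by (simp add: Y_def)
  have Y_eq: "Y = (x\<^sup>2 + \<rho>\<^sup>2) / (2 * \<rho> * x)" unfolding fac Y_def using pos by simp
  have "1 + ((x - \<rho>\<^sup>2 / x) / (2 * \<rho>))\<^sup>2 = Y\<^sup>2"
    unfolding Y_eq using pos by (simp add: power_divide divide_simps) (simp add: power2_eq_square algebra_simps)
  then have "lob_density ((x - \<rho>\<^sup>2 / x) / (2 * \<rho>)) = (ln 2 - ln Y) / Y\<^sup>2"
    using Y by (simp add: lob_density_def ln_realpow)
  moreover have "ln 2 - ln Y = ln (4 * \<rho> / ((x + y) * (x + z) * (y + z))) + ln (y + z)"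
    using pos ln_mult[of 2 "2::real"] by (simp add: Y_def ln_div ln_mult)
  moreover have "((\<lambda>x. lob ((x - \<rho>\<^sup>2 / x) / (2 * \<rho>))) has_real_derivative
    lob_density ((x - \<rho>\<^sup>2 / x) / (2 * \<rho>)) * ((1 + \<rho>\<^sup>2 / x\<^sup>2) / (2 * \<rho>))) (at x)"
    using pos by (auto intro!: derivative_eq_intros simp: power2_eq_square field_simps)
  moreover have "(1 + \<rho>\<^sup>2 / x\<^sup>2) / (2 * \<rho>) = Y / x"
    unfolding Y_eq using pos by (simp add: field_simps power2_eq_square)
  moreover have "a / Y\<^sup>2 * (Y / x) = a * (2 * \<rho> / (x * (x + y) * (x + z)))" for a
    unfolding Y_def using pos by (simp add: divide_simps power2_eq_square)
  ultimately show ?thesis by metis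
qed

text \<open>The factors after the summands are the derivatives of x and z in y when x + y + z and x
  y z are constant. K cancels because (z - y)(z + y) + (y - x)(y + x) = (z - x)(z + x). The rest is
  the three-point inequality for x ln x at the nodes x + y < x + z < y + z, which are twice the
  sides.\<close>

lemma fixed_det_derivative_neg:
  fixes x y z \<rho> K :: real
  assumes ord: "0 < x" "x < y" "y < z" and \<rho>: "\<rho> > 0"
  defines "summand \<equiv> \<lambda>a b c. (K + ln (b + c)) * (2 * \<rho> / (a * (a + b) * (a + c)))"
  shows "summand x y z * (- x * (z - y) / (y * (z - x))) + summand z x y * (- z * (y - x) / (y * (z - x))) + summand y x z * 1 < 0"
proof -
  define P where "P = (x + y) * (x + z) * (y + z)"
  define c where "c = 2 * \<rho> / (y * (z - x) * P)"
  have P: "P > 0" using ord by (simp add: P_def)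
  then have c: "c > 0" using ord \<rho> by (simp add: c_def)
  have ex: "summand x y z * (- x * (z - y) / (y * (z - x))) = - (c * ((z - y) * (y + z)) * (K + ln (y + z)))"
    unfolding summand_def c_def P_def using ord by (simp add: divide_simps)
  have ez: "summand z x y * (- z * (y - x) / (y * (z - x))) = - (c * ((y - x) * (x + y)) * (K + ln (x + y)))"
    unfolding summand_def c_def P_def using ord by (simp add: divide_simps add.commute)
  have ey: "summand y x z * 1 = c * ((z - x) * (x + z)) * (K + ln (x + z))"
    unfolding summand_def c_def P_def using ord by (simp add: divide_simps add.commute)
  have "summand x y z * (- x * (z - y) / (y * (z - x))) + summand z x y * (- z * (y - x) / (y * (z - x))) + summand y x z * 1
     = - c * ((z - y) * (y + z) * ln (y + z) + (y - x) * (x + y) * ln (x + y) - (z - x) * (x + z) * ln (x + z))"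
    unfolding ex ey ez by (simp add: algebra_simps)
  also have "\<dots> < 0"
    using xlnx_chord[of "x + y" "x + z" "y + z"] ord c by simp
  finally show ?thesis .
qed

text \<open>The middle variable y is the parameter; x and z are the two roots with sum 1 - y and
  product \<rho>^2 / y. For x = 1 - 2 r and so on, x y + y z + z x is 1 - 2 (r^2 + s^2 + t^2), so
  the conclusion about it compares permanents.\<close>

lemma fixed_product_curve:
  fixes x\<^sub>1 y\<^sub>1 z\<^sub>1 x\<^sub>2 y\<^sub>2 z\<^sub>2 \<rho> :: real
  assumes sum: "x\<^sub>1 + y\<^sub>1 + z\<^sub>1 = 1" "x\<^sub>2 + y\<^sub>2 + z\<^sub>2 = 1"
    and ord: "0 < x\<^sub>1" "x\<^sub>1 \<le> y\<^sub>1" "y\<^sub>1 \<le> z\<^sub>1" "0 < x\<^sub>2" "x\<^sub>2 \<le> y\<^sub>2" "y\<^sub>2 \<le> z\<^sub>2"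
    and prod: "x\<^sub>1 * y\<^sub>1 * z\<^sub>1 = \<rho>\<^sup>2" "x\<^sub>2 * y\<^sub>2 * z\<^sub>2 = \<rho>\<^sup>2" and \<rho>: "\<rho> > 0"
    and less: "y\<^sub>1 < y\<^sub>2"
  defines "m \<equiv> \<lambda>x. lob ((x - \<rho>\<^sup>2 / x) / (2 * \<rho>))"
  shows "x\<^sub>1 * y\<^sub>1 + y\<^sub>1 * z\<^sub>1 + z\<^sub>1 * x\<^sub>1 < x\<^sub>2 * y\<^sub>2 + y\<^sub>2 * z\<^sub>2 + z\<^sub>2 * x\<^sub>2" (is ?per)
    and "m x\<^sub>2 + m y\<^sub>2 + m z\<^sub>2 < m x\<^sub>1 + m y\<^sub>1 + m z\<^sub>1" (is ?vol)
proof -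
  define disc where "disc = (\<lambda>y. (1 - y)\<^sup>2 - 4 * (\<rho>\<^sup>2 / y))"
  define x where "x = (\<lambda>y. (1 - y - sqrt (disc y)) / 2)"
  define z where "z = (\<lambda>y. (1 - y + sqrt (disc y)) / 2)"
  define f where "f = (\<lambda>y. m (x y) + m (z y) + m y)"
  define g where "g = (\<lambda>y. y * (1 - y) + \<rho>\<^sup>2 / y)"
  have ends: "x b = a" "z b = c" "\<rho>\<^sup>2 \<le> b\<^sup>2 * (1 - 2 * b)" "g b = a * b + b * c + c * a" "disc b \<ge> 0"
    if "a + b + c = 1" "0 < a" "a \<le> b" "b \<le> c" "a * b * c = \<rho>\<^sup>2" for a b c
  proof -
    have quot: "\<rho>\<^sup>2 / b = a * c" using that by (simp add: that(5)[symmetric])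
    have sum: "1 - b = a + c" using that by simp
    have "disc b = (c - a)\<^sup>2" unfolding disc_def quot sum by (simp add: power2_eq_square algebra_simps)
    then show "x b = a" "z b = c" "disc b \<ge> 0" using that by (simp_all add: x_def z_def sum)
    show "g b = a * b + b * c + c * a" unfolding g_def quot sum by (simp add: algebra_simps)
    have "b\<^sup>2 * (1 - 2 * b) - \<rho>\<^sup>2 = b * ((b - a) * (c - b))"
    proof -
      have b: "1 - 2 * b = a + c - b" using that by simp
      show ?thesis unfolding that(5)[symmetric] b by (simp add: power2_eq_square algebra_simps)
    qed
    moreover have "b * ((b - a) * (c - b)) \<ge> 0" using that by simp
    ultimately show "\<rho>\<^sup>2 \<le> b\<^sup>2 * (1 - 2 * b)" by linarith
  qed
  note e1 = ends[OF sum(1) ord(1-3) prod(1)] and e2 = ends[OF sum(2) ord(4-6) prod(2)]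
  have y1: "y\<^sub>1 > 0" using ord by simp
  have y2: "y\<^sub>2 < 1" using ord sum by linarith
  have inner: "\<rho>\<^sup>2 < u\<^sup>2 * (1 - 2 * u)" if "y\<^sub>1 < u" "u < y\<^sub>2" for u
    using cubic_unimodal[OF y1 that e1(3) e2(3)] .
  \<comment> \<open>\<open>disc u\<close> is (z - x)^2 and (1 - 3 u)^2 is (x + z - 2 u)^2, so the
    second inequality places u strictly between x and z.\<close>
  have disc_pos: "0 < disc u" "(1 - 3 * u)\<^sup>2 < disc u" if "y\<^sub>1 < u" "u < y\<^sub>2" for u
  proof -
    have "\<rho>\<^sup>2 / u < u * (1 - 2 * u)"
      using inner[OF that] that y1 by (simp add: divide_simps power2_eq_square algebra_simps)
    moreover have "disc u - (1 - 3 * u)\<^sup>2 = 4 * (u * (1 - 2 * u) - \<rho>\<^sup>2 / u)"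
      by (simp add: disc_def power2_eq_square algebra_simps)
    ultimately have "0 < disc u - (1 - 3 * u)\<^sup>2" by simp
    then show "(1 - 3 * u)\<^sup>2 < disc u" by simp
    then show "0 < disc u" using zero_le_power2[of "1 - 3 * u"] by linarith
  qed
  have disc_nonneg: "0 \<le> disc u" if "y\<^sub>1 \<le> u" "u \<le> y\<^sub>2" for u
    using that disc_pos[of u] e1(5) e2(5) by (cases "u = y\<^sub>1"; cases "u = y\<^sub>2") auto
  have xz: "x u + u + z u = 1" "x u * u * z u = \<rho>\<^sup>2" "x u > 0" "z u > 0"
    if "y\<^sub>1 \<le> u" "u \<le> y\<^sub>2" for u
  proof -
    have u: "u > 0" "u < 1" using y1 y2 that by auto
    show "x u + u + z u = 1" by (simp add: x_def z_def field_simps)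
    have "4 * (x u * z u) = (1 - u)\<^sup>2 - (sqrt (disc u))\<^sup>2"
      by (simp add: x_def z_def power2_eq_square field_simps)
    also have "\<dots> = 4 * (\<rho>\<^sup>2 / u)" using disc_nonneg[OF that] by (simp add: disc_def)
    finally have p: "x u * z u = \<rho>\<^sup>2 / u" by simp
    then show "x u * u * z u = \<rho>\<^sup>2" using u by (simp add: field_simps)
    show z: "z u > 0" using u disc_nonneg[OF that] by (simp add: z_def add_pos_nonneg)
    have "x u * z u > 0" using p u \<rho> by simp
    then show "x u > 0" using z by (simp add: zero_less_mult_iff)
  qed
  have g_less: "g y\<^sub>1 < g y\<^sub>2"
  proof (rule DERIV_pos_imp_increasing_open[OF less])
    fix u assume u: "y\<^sub>1 < u" "u < y\<^sub>2"
    have "(g has_real_derivative (1 - 2 * u - \<rho>\<^sup>2 / u\<^sup>2)) (at u)"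
      unfolding g_def using u y1 by (auto intro!: derivative_eq_intros simp: power2_eq_square)
    moreover have "0 < 1 - 2 * u - \<rho>\<^sup>2 / u\<^sup>2" using inner[OF u] u y1 by (simp add: field_simps)
    ultimately show "\<exists>y. (g has_real_derivative y) (at u) \<and> 0 < y" by blast
  next
    show "continuous_on {y\<^sub>1..y\<^sub>2} g" unfolding g_def using y1 by (intro continuous_intros) auto
  qed
  then show ?per using e1(4) e2(4) by simp
  have "f y\<^sub>2 < f y\<^sub>1"
  proof (rule DERIV_neg_imp_decreasing_open[OF less])
    have "continuous_on {y\<^sub>1..y\<^sub>2} x" "continuous_on {y\<^sub>1..y\<^sub>2} z"
      unfolding x_def z_def disc_def using y1 by (intro continuous_intros; force)+
    then show "continuous_on {y\<^sub>1..y\<^sub>2} f"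
      unfolding f_def m_def using xz(3,4) y1 \<rho>
      by (intro continuous_intros) (auto simp: less_imp_neq[symmetric])
  next
    fix u assume u: "y\<^sub>1 < u" "u < y\<^sub>2"
    then have u': "y\<^sub>1 \<le> u" "u \<le> y\<^sub>2" "u > 0" using y1 by auto
    define d where "d = sqrt (disc u)"
    have d: "d > 0" using disc_pos[OF u] by (simp add: d_def)
    have zx: "z u - x u = d" by (simp add: x_def z_def d_def field_simps)
    have "\<bar>1 - 3 * u\<bar> < d" unfolding d_def using disc_pos[OF u] by (intro real_less_rsqrt) simp
    then have lt: "x u < u" "u < z u" by (auto simp: x_def z_def d_def[symmetric])
    have "(disc has_real_derivative (- 2 * (1 - u) + 4 * (\<rho>\<^sup>2 / u\<^sup>2))) (at u)"
      unfolding disc_def using u' by (auto intro!: derivative_eq_intros simp: power2_eq_square)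
    from DERIV_chain2[OF DERIV_real_sqrt[OF disc_pos(1)[OF u]] this]
    have dd: "((\<lambda>u. sqrt (disc u)) has_real_derivative (- (1 - u) + 2 * (\<rho>\<^sup>2 / u\<^sup>2)) / d) (at u)"
      by (rule DERIV_cong) (use d in \<open>simp add: d_def field_simps\<close>)
    have e: "(- (1 - u) + 2 * (\<rho>\<^sup>2 / u\<^sup>2)) / d = (2 * x u * z u - u * (x u + z u)) / (u * d)"
    proof -
      have "1 - u = x u + z u" using xz(1)[OF u'(1,2)] by simp
      moreover have "\<rho>\<^sup>2 / u\<^sup>2 = x u * z u / u"
        using xz(2)[OF u'(1,2)] u' by (simp add: field_simps power2_eq_square)
      ultimately show ?thesis using u' d by (simp add: divide_simps) (simp add: algebra_simps)
    qed
    have dx: "(x has_real_derivative - x u * (z u - u) / (u * (z u - x u))) (at u)"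
    proof -
      have "(x has_real_derivative (- 1 - E) / 2) (at u)"
        if "((\<lambda>u. sqrt (disc u)) has_real_derivative E) (at u)" for E
        unfolding x_def
        by (rule DERIV_cdivide[OF DERIV_diff[OF DERIV_diff[OF DERIV_const DERIV_ident] that], THEN DERIV_cong]) simp
      from this[OF dd[unfolded e]]
      have "(x has_real_derivative (- 1 - (2 * x u * z u - u * (x u + z u)) / (u * d)) / 2) (at u)" .
      also have "(- 1 - (2 * x u * z u - u * (x u + z u)) / (u * d)) / 2 = - x u * (z u - u) / (u * (z u - x u))"
        unfolding zx[symmetric] using d[folded zx] u' by (simp add: divide_simps) (simp add: algebra_simps)
      finally show ?thesis .
    qed
    have dz: "(z has_real_derivative - z u * (u - x u) / (u * (z u - x u))) (at u)"
    proof -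
      have "(z has_real_derivative (- 1 + E) / 2) (at u)"
        if "((\<lambda>u. sqrt (disc u)) has_real_derivative E) (at u)" for E
        unfolding z_def
        by (rule DERIV_cdivide[OF DERIV_add[OF DERIV_diff[OF DERIV_const DERIV_ident] that], THEN DERIV_cong]) simp
      from this[OF dd[unfolded e]]
      have "(z has_real_derivative (- 1 + (2 * x u * z u - u * (x u + z u)) / (u * d)) / 2) (at u)" .
      also have "(- 1 + (2 * x u * z u - u * (x u + z u)) / (u * d)) / 2 = - z u * (u - x u) / (u * (z u - x u))"
        unfolding zx[symmetric] using d[folded zx] u' by (simp add: divide_simps) (simp add: algebra_simps)
      finally show ?thesis .
    qed
    define K where "K = ln (4 * \<rho> / ((x u + u) * (x u + z u) * (u + z u)))"
    note xz = xz[OF u'(1,2)]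
    have mx: "(m has_real_derivative (K + ln (u + z u)) * (2 * \<rho> / (x u * (x u + u) * (x u + z u)))) (at (x u))"
      unfolding m_def K_def by (rule DERIV_lob_half_angle) (use xz u' \<rho> in auto)
    have mz: "(m has_real_derivative (K + ln (x u + u)) * (2 * \<rho> / (z u * (z u + x u) * (z u + u)))) (at (z u))"
    proof -
      have "K = ln (4 * \<rho> / ((z u + x u) * (z u + u) * (x u + u)))" by (simp add: K_def ac_simps)
      then show ?thesis
        unfolding m_def by (simp only:) (rule DERIV_lob_half_angle; use xz u' \<rho> in \<open>simp add: ac_simps\<close>)
    qed
    have my: "(m has_real_derivative (K + ln (x u + z u)) * (2 * \<rho> / (u * (u + x u) * (u + z u)))) (at u)"
    proof -
      have "K = ln (4 * \<rho> / ((u + x u) * (u + z u) * (x u + z u)))" by (simp add: K_def ac_simps)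
      then show ?thesis
        unfolding m_def by (simp only:) (rule DERIV_lob_half_angle; use xz u' \<rho> in \<open>simp add: ac_simps\<close>)
    qed
    note D = DERIV_add[OF DERIV_add[OF DERIV_chain2[OF mx dx] DERIV_chain2[OF mz dz]] DERIV_chain2[OF my DERIV_ident]]
    show "\<exists>y. (f has_real_derivative y) (at u) \<and> y < 0"
      unfolding f_def
      by (rule exI, rule conjI, rule D) (rule fixed_det_derivative_neg[OF xz(3) lt \<rho>])
  qed
  then show ?vol using e1(1,2) e2(1,2) by (simp add: f_def)
qed

lemma lob_volume_half_angle:
  fixes r s t :: real
  assumes sum: "r + s + t = 1" and less: "r < 1 / 2" "s < 1 / 2" "t < 1 / 2"
  defines "\<rho> \<equiv> sqrt (shape_disc (r, s, t))"
  defines "m \<equiv> \<lambda>x. lob ((x - \<rho>\<^sup>2 / x) / (2 * \<rho>))"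
  shows "lob_volume (r, s, t) = m (1 - 2 * r) + m (1 - 2 * s) + m (1 - 2 * t) - lob_limit"
proof -
  have \<rho>2: "\<rho>\<^sup>2 = (1 - 2 * r) * (1 - 2 * s) * (1 - 2 * t)" using less by (simp add: \<rho>_def shape_disc_def)
  have *: "(1 - 2 * a - (1 - 2 * a) * (1 - 2 * b) * (1 - 2 * c) / (1 - 2 * a)) / (2 * \<rho>) =
      (a\<^sup>2 + b\<^sup>2 + c\<^sup>2 - 2 * a\<^sup>2) / \<rho>" if "a + b + c = 1" "a < 1 / 2" for a b c
  proof -
    have "(1 - 2 * a) * (1 - 2 * b) * (1 - 2 * c) / (1 - 2 * a) = (1 - 2 * b) * (1 - 2 * c)" using that by simp
    moreover have "1 - 2 * a - (1 - 2 * b) * (1 - 2 * c) = 2 * (a\<^sup>2 + b\<^sup>2 + c\<^sup>2 - 2 * a\<^sup>2)"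
    proof -
      have a: "a = 1 - b - c" using that by simp
      show ?thesis unfolding a by (simp add: power2_eq_square algebra_simps)
    qed
    ultimately have "1 - 2 * a - (1 - 2 * a) * (1 - 2 * b) * (1 - 2 * c) / (1 - 2 * a) =
        2 * (a\<^sup>2 + b\<^sup>2 + c\<^sup>2 - 2 * a\<^sup>2)" by (simp only:)
    then show ?thesis by (simp only: mult_divide_mult_cancel_left_if) simp
  qed
  show ?thesis
    using *[of r s t] *[of s r t] *[of t r s] sum less
    by (simp add: m_def \<rho>2 lob_volume_def Let_def \<rho>_def[symmetric] ac_simps)
qed

lemma fixed_det_curve:
  fixes r\<^sub>1 s\<^sub>1 t\<^sub>1 r\<^sub>2 s\<^sub>2 t\<^sub>2 :: real
  assumes sum: "r\<^sub>1 + s\<^sub>1 + t\<^sub>1 = 1" "r\<^sub>2 + s\<^sub>2 + t\<^sub>2 = 1"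
    and ord: "s\<^sub>1 \<le> t\<^sub>1" "t\<^sub>1 \<le> r\<^sub>1" "r\<^sub>1 < 1 / 2" "s\<^sub>2 \<le> t\<^sub>2" "t\<^sub>2 \<le> r\<^sub>2" "r\<^sub>2 < 1 / 2"
    and det: "shape_disc (r\<^sub>1, s\<^sub>1, t\<^sub>1) = shape_disc (r\<^sub>2, s\<^sub>2, t\<^sub>2)"
    and less: "t\<^sub>1 < t\<^sub>2"
  shows "r\<^sub>1\<^sup>2 + s\<^sub>1\<^sup>2 + t\<^sub>1\<^sup>2 < r\<^sub>2\<^sup>2 + s\<^sub>2\<^sup>2 + t\<^sub>2\<^sup>2" (is ?per)
    and "lob_volume (r\<^sub>1, s\<^sub>1, t\<^sub>1) < lob_volume (r\<^sub>2, s\<^sub>2, t\<^sub>2)" (is ?vol)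
proof -
  define \<rho> where "\<rho> = sqrt (shape_disc (r\<^sub>1, s\<^sub>1, t\<^sub>1))"
  have \<rho>': "\<rho> = sqrt (shape_disc (r\<^sub>2, s\<^sub>2, t\<^sub>2))" by (simp add: \<rho>_def det)
  have \<rho>: "\<rho> > 0" using ord by (simp add: \<rho>_def shape_disc_def)
  have \<rho>1: "\<rho>\<^sup>2 = (1 - 2 * r\<^sub>1) * (1 - 2 * s\<^sub>1) * (1 - 2 * t\<^sub>1)" using ord by (simp add: \<rho>_def shape_disc_def)
  have \<rho>2: "\<rho>\<^sup>2 = (1 - 2 * r\<^sub>2) * (1 - 2 * s\<^sub>2) * (1 - 2 * t\<^sub>2)" using ord by (simp add: \<rho>' shape_disc_def)
  \<comment> \<open>Passing from r to 1 - 2 r reverses the order of the sides, so the curve runs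
    from the second shape to the first one.\<close>
  note curve = fixed_product_curve[of "1 - 2 * r\<^sub>2" "1 - 2 * t\<^sub>2" "1 - 2 * s\<^sub>2" "1 - 2 * r\<^sub>1" "1 - 2 * t\<^sub>1" "1 - 2 * s\<^sub>1" \<rho>]
  have half: "s\<^sub>1 < 1 / 2" "t\<^sub>1 < 1 / 2" "s\<^sub>2 < 1 / 2" "t\<^sub>2 < 1 / 2" using ord by auto
  have sq: "(1 - 2 * a) * (1 - 2 * b) + (1 - 2 * b) * (1 - 2 * c) + (1 - 2 * c) * (1 - 2 * a) = 1 - 2 * (a\<^sup>2 + b\<^sup>2 + c\<^sup>2)"
    if "a + b + c = 1" for a b c :: real
  proof -
    have a: "a = 1 - b - c" using that by simp
    show ?thesis unfolding a by (simp add: power2_eq_square algebra_simps)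
  qed
  show ?per
    using curve(1) sum ord less \<rho> \<rho>1 \<rho>2 sq[of r\<^sub>1 t\<^sub>1 s\<^sub>1] sq[of r\<^sub>2 t\<^sub>2 s\<^sub>2] by (simp add: ac_simps)
  show ?vol
    using curve(2) sum ord less \<rho> \<rho>1 \<rho>2 lob_volume_half_angle[OF sum(1) ord(3) half(1,2)]
      lob_volume_half_angle[OF sum(2) ord(6) half(3,4)]
    by (simp add: ac_simps \<rho>_def[symmetric] \<rho>'[symmetric])
qed

section \<open>Integrating the inverse square of the Gram form\<close>

lemma Basis_real3: "(Basis :: (real^3) set) = {axis 1 1, axis 2 1, axis 3 1}"
  by (auto simp: Basis_vec_def UNIV_3)

lemma vector_3_eq_sum:
  "(vector [a, b, c] :: real^3) = a *\<^sub>R axis 1 1 + b *\<^sub>R axis 2 1 + c *\<^sub>R axis 3 1"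
  by (simp add: vec_eq_iff forall_3 axis_def)

lemma nn_integral_real3:
  fixes f :: "real^3 \<Rightarrow> ennreal"
  assumes [measurable]: "f \<in> borel_measurable borel"
  shows "(\<integral>\<^sup>+x. f x \<partial>lborel) = (\<integral>\<^sup>+a. \<integral>\<^sup>+b. \<integral>\<^sup>+c. f (vector [a, b, c]) \<partial>lborel \<partial>lborel \<partial>lborel)"
proof -
  interpret product_sigma_finite "\<lambda>_ :: real^3. lborel :: real measure" ..
  define e where "e = (\<lambda>i :: 3. axis i 1 :: real^3)"
  have dist: "e 1 \<noteq> e 2" "e 1 \<noteq> e 3" "e 2 \<noteq> e 3" "e 2 \<noteq> e 1" "e 3 \<noteq> e 1" "e 3 \<noteq> e 2"
    by (simp_all add: e_def axis_eq_axis)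
  have B: "(Basis :: (real^3) set) = {e 1, e 2, e 3}" by (simp add: Basis_real3 e_def)
  let ?M = "\<lambda>I. Pi\<^sub>M I (\<lambda>_ :: real^3. lborel :: real measure)"
  have sum: "(\<Sum>b\<in>Basis. g b *\<^sub>R b) = g (e 1) *\<^sub>R e 1 + g (e 2) *\<^sub>R e 2 + g (e 3) *\<^sub>R e 3" for g :: "real^3 \<Rightarrow> real"
    unfolding B using dist by (simp add: add.assoc)
  have "(\<integral>\<^sup>+x. f x \<partial>lborel) = (\<integral>\<^sup>+g. f (\<Sum>b\<in>Basis. g b *\<^sub>R b) \<partial>?M Basis)"
    by (subst lborel_eq, subst nn_integral_distr) auto
  also have "\<dots> = (\<integral>\<^sup>+g. f (g (e 1) *\<^sub>R e 1 + g (e 2) *\<^sub>R e 2 + g (e 3) *\<^sub>R e 3) \<partial>?M {e 1, e 2, e 3})"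
    by (simp only: sum) (simp only: B)
  also have "\<dots> = (\<integral>\<^sup>+a. \<integral>\<^sup>+g. f (a *\<^sub>R e 1 + g (e 2) *\<^sub>R e 2 + g (e 3) *\<^sub>R e 3) \<partial>?M {e 2, e 3} \<partial>lborel)"
    using dist by (subst product_nn_integral_insert_rev) auto
  also have "\<dots> = (\<integral>\<^sup>+a. \<integral>\<^sup>+b. \<integral>\<^sup>+g. f (a *\<^sub>R e 1 + b *\<^sub>R e 2 + g (e 3) *\<^sub>R e 3) \<partial>?M {e 3} \<partial>lborel \<partial>lborel)"
    using dist by (intro nn_integral_cong, subst product_nn_integral_insert_rev) auto
  also have "\<dots> = (\<integral>\<^sup>+a. \<integral>\<^sup>+b. \<integral>\<^sup>+c. f (a *\<^sub>R e 1 + b *\<^sub>R e 2 + c *\<^sub>R e 3) \<partial>lborel \<partial>lborel \<partial>lborel)"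
    by (intro nn_integral_cong product_nn_integral_singleton[of "\<lambda>c. f (_ *\<^sub>R e 1 + _ *\<^sub>R e 2 + c *\<^sub>R e 3)"]) measurable
  finally show ?thesis by (simp add: vector_3_eq_sum e_def)
qed

lemma nn_integral_inverse_linear_square:
  fixes P Q :: real
  assumes "P > 0" "Q > 0"
  shows "(\<integral>\<^sup>+c. ennreal (1 / (P + Q * c)\<^sup>2) * indicator {0..} c \<partial>lborel) = ennreal (1 / (P * Q))"
proof -
  have "(\<integral>\<^sup>+c. ennreal (1 / (P + Q * c)\<^sup>2) * indicator {0..} c \<partial>lborel) = ennreal (0 - (- 1 / (Q * (P + Q * 0))))"
  proof (rule nn_integral_FTC_atLeast)
    fix c :: real assume "0 \<le> c"
    then have "P + Q * c > 0" using assms by (simp add: add_pos_nonneg)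
    then show "((\<lambda>c. - 1 / (Q * (P + Q * c))) has_real_derivative 1 / (P + Q * c)\<^sup>2) (at c)"
      using assms by (auto intro!: derivative_eq_intros simp: power2_eq_square)
  next
    show "((\<lambda>c. - 1 / (Q * (P + Q * c))) \<longlongrightarrow> 0) at_top" using assms by real_asymp
  qed auto
  then show ?thesis by (simp add: mult.commute)
qed

lemma nn_integral_inverse_linear_prod:
  fixes \<alpha> \<beta> \<gamma> \<delta> :: real
  assumes pos: "\<alpha> > 0" "\<beta> > 0" "\<gamma> > 0" "\<delta> > 0" and E: "\<alpha> * \<delta> - \<beta> * \<gamma> > 0"
  shows "(\<integral>\<^sup>+b. ennreal (1 / ((\<alpha> * b + \<beta>) * (\<gamma> * b + \<delta>))) * indicator {0..} b \<partial>lborel) =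
    ennreal (ln (\<alpha> * \<delta> / (\<beta> * \<gamma>)) / (\<alpha> * \<delta> - \<beta> * \<gamma>))"
proof -
  define E where "E = \<alpha> * \<delta> - \<beta> * \<gamma>"
  have "E > 0" using E by (simp add: E_def)
  define F where "F = (\<lambda>b. (ln (\<alpha> * b + \<beta>) - ln (\<gamma> * b + \<delta>)) / E)"
  have "(\<integral>\<^sup>+b. ennreal (1 / ((\<alpha> * b + \<beta>) * (\<gamma> * b + \<delta>))) * indicator {0..} b \<partial>lborel) =
    ennreal (ln (\<alpha> / \<gamma>) / E - F 0)"
  proof (rule nn_integral_FTC_atLeast)
    fix b :: real assume b: "0 \<le> b"
    then have p: "\<alpha> * b + \<beta> > 0" "\<gamma> * b + \<delta> > 0" using pos by (simp_all add: add_nonneg_pos)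
    have "(F has_real_derivative (\<alpha> / (\<alpha> * b + \<beta>) - \<gamma> / (\<gamma> * b + \<delta>)) / E) (at b)"
      unfolding F_def using p \<open>E > 0\<close> by (auto intro!: derivative_eq_intros)
    also have "(\<alpha> / (\<alpha> * b + \<beta>) - \<gamma> / (\<gamma> * b + \<delta>)) / E = 1 / ((\<alpha> * b + \<beta>) * (\<gamma> * b + \<delta>))"
    proof -
      have "\<alpha> / (\<alpha> * b + \<beta>) - \<gamma> / (\<gamma> * b + \<delta>) = E / ((\<alpha> * b + \<beta>) * (\<gamma> * b + \<delta>))"
        using p by (simp add: E_def diff_frac_eq) (simp add: algebra_simps)
      then show ?thesis using \<open>E > 0\<close> by simp
    qed
    finally show "(F has_real_derivative 1 / ((\<alpha> * b + \<beta>) * (\<gamma> * b + \<delta>))) (at b)" .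
    show "0 \<le> 1 / ((\<alpha> * b + \<beta>) * (\<gamma> * b + \<delta>))" using p by simp
  next
    have "((\<lambda>b. (ln (\<alpha> * b + \<beta>) - ln (\<gamma> * b + \<delta>))) \<longlongrightarrow> ln \<alpha> - ln \<gamma>) at_top"
      using pos by real_asymp
    then show "(F \<longlongrightarrow> ln (\<alpha> / \<gamma>) / E) at_top"
      unfolding F_def using pos \<open>E > 0\<close> by (intro tendsto_divide) (auto simp: ln_div)
  qed auto
  also have "ln (\<alpha> / \<gamma>) / E - F 0 = ln (\<alpha> * \<delta> / (\<beta> * \<gamma>)) / E"
    using pos by (simp add: F_def ln_div ln_mult diff_divide_distrib add_divide_distrib)
  finally show ?thesis by (simp add: E_def)
qed

text \<open>The kernel is minus the m-derivative of ln ((a + m)(a m + 1) / (a (m^2 - 2 c m + 1))) /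
  (a^2 + 2 c a + 1), and this quantity tends to 0 for m tending to infinity; the factor a under the
  logarithm is there for that. Read from right to left, the equation turns a logarithm into an
  integral of a rational function.\<close>

lemma nn_integral_ln_kernel:
  fixes a c k :: real
  assumes a: "a > 0" and k: "k \<ge> 1" and c: "\<bar>c\<bar> < 1"
  shows "(\<integral>\<^sup>+m. ennreal ((m\<^sup>2 - 1) / ((a + m) * (a * m + 1) * (m\<^sup>2 - 2 * c * m + 1))) * indicator {k..} m \<partial>lborel) =
    ennreal (ln ((a + k) * (a * k + 1) / (a * (k\<^sup>2 - 2 * c * k + 1))) / (a\<^sup>2 + 2 * c * a + 1))"
proof -
  have quad: "x\<^sup>2 + 2 * d * x + 1 > 0" if "\<bar>d\<bar> < 1" for x d :: real
  proof -
    have "d\<^sup>2 < 1" using that by (simp add: abs_square_less_1)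
    then have "0 < (x + d)\<^sup>2 + (1 - d\<^sup>2)" by (intro add_nonneg_pos) auto
    then show ?thesis by (simp add: power2_eq_square algebra_simps)
  qed
  define X where "X = (\<lambda>m. m\<^sup>2 - 2 * c * m + 1)"
  have X: "X m > 0" for m using quad[of "- c" m] c by (simp add: X_def)
  define E where "E = a\<^sup>2 + 2 * c * a + 1"
  have E: "E > 0" using quad[of c a] c by (simp add: E_def)
  define F where "F = (\<lambda>m. - (ln (a + m) + ln (a * m + 1) - ln (X m)) / E)"
  have "(\<integral>\<^sup>+m. ennreal ((m\<^sup>2 - 1) / ((a + m) * (a * m + 1) * X m)) * indicator {k..} m \<partial>lborel) =
    ennreal (- ln a / E - F k)"
  proof (rule nn_integral_FTC_atLeast)
    show "(\<lambda>m. (m\<^sup>2 - 1) / ((a + m) * (a * m + 1) * X m)) \<in> borel_measurable borel"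
      unfolding X_def by measurable
    fix m :: real assume "k \<le> m"
    then have m: "m \<ge> 1" using k by simp
    have p: "a + m > 0" "a * m + 1 > 0" using a m by (auto intro: add_pos_nonneg add_nonneg_pos)
    have "(X has_real_derivative 2 * m - 2 * c) (at m)"
      unfolding X_def by (auto intro!: derivative_eq_intros)
    then have "((\<lambda>m. ln (a + m) + ln (a * m + 1) - ln (X m)) has_real_derivative
        1 / (a + m) + a / (a * m + 1) - (2 * m - 2 * c) / X m) (at m)"
      using p X[of m] by (auto intro!: derivative_eq_intros)
    then have "(F has_real_derivative - (1 / (a + m) + a / (a * m + 1) - (2 * m - 2 * c) / X m) / E) (at m)"
      unfolding F_def by (intro DERIV_cdivide DERIV_minus)
    also have "- (1 / (a + m) + a / (a * m + 1) - (2 * m - 2 * c) / X m) / E =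
        (m\<^sup>2 - 1) / ((a + m) * (a * m + 1) * X m)"
    proof -
      have "1 / (a + m) + a / (a * m + 1) = ((a * m + 1) + a * (a + m)) / ((a + m) * (a * m + 1))"
        using p by (simp add: add_frac_eq algebra_simps)
      then have "1 / (a + m) + a / (a * m + 1) - (2 * m - 2 * c) / X m =
         (((a * m + 1) + a * (a + m)) * X m - (2 * m - 2 * c) * ((a + m) * (a * m + 1))) / ((a + m) * (a * m + 1) * X m)"
        using p X[of m] by (simp add: diff_frac_eq)
      also have "((a * m + 1) + a * (a + m)) * X m - (2 * m - 2 * c) * ((a + m) * (a * m + 1)) = - (E * (m\<^sup>2 - 1))"
        unfolding X_def E_def by (simp add: power2_eq_square algebra_simps)
      finally show ?thesis using E by simp
    qed
    finally show "(F has_real_derivative (m\<^sup>2 - 1) / ((a + m) * (a * m + 1) * X m)) (at m)" .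
    have "m\<^sup>2 \<ge> 1" using m by simp
    then show "0 \<le> (m\<^sup>2 - 1) / ((a + m) * (a * m + 1) * X m)" using p X[of m] by simp
  next
    have "((\<lambda>m. ln (a + m) + ln (a * m + 1) - ln (X m)) \<longlongrightarrow> ln a) at_top"
      unfolding X_def using a by real_asymp
    then show "(F \<longlongrightarrow> - ln a / E) at_top"
      unfolding F_def using E by (intro tendsto_divide tendsto_minus) auto
  qed
  also have "- ln a / E - F k = ln ((a + k) * (a * k + 1) / (a * X k)) / E"
  proof -
    have "- ln a / E - F k = (ln (a + k) + ln (a * k + 1) - (ln a + ln (X k))) / E"
      unfolding F_def diff_divide_distrib[symmetric] by simp
    moreover have "a + k > 0" "a * k + 1 > 0" using a k by (auto intro: add_pos_nonneg add_nonneg_pos)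
    ultimately show ?thesis using a X[of k] by (simp add: ln_div ln_mult)
  qed
  finally show ?thesis by (simp add: X_def E_def)
qed

text \<open>The kernel of \<open>nn_integral_ln_kernel\<close>, integrated over the other variable:
  partial fractions give ln (a m + 1) - ln (a + m), which runs from -ln m to ln m.\<close>

lemma nn_integral_rational_kernel:
  fixes m X :: real
  assumes m: "m \<ge> 1" and X: "X > 0"
  shows "(\<integral>\<^sup>+a. ennreal ((m\<^sup>2 - 1) / ((a + m) * (a * m + 1) * X)) * indicator {0..} a \<partial>lborel) =
    ennreal (2 * ln m / X)"
proof -
  define F where "F = (\<lambda>a. (ln (a * m + 1) - ln (a + m)) / X)"
  have "(\<integral>\<^sup>+a. ennreal ((m\<^sup>2 - 1) / ((a + m) * (a * m + 1) * X)) * indicator {0..} a \<partial>lborel) =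
    ennreal (ln m / X - F 0)"
  proof (rule nn_integral_FTC_atLeast)
    fix a :: real assume a: "0 \<le> a"
    have p: "a + m > 0" "a * m + 1 > 0" using a m by (auto intro: add_nonneg_pos)
    have "(F has_real_derivative (m / (a * m + 1) - 1 / (a + m)) / X) (at a)"
      unfolding F_def using p X by (auto intro!: derivative_eq_intros)
    also have "(m / (a * m + 1) - 1 / (a + m)) / X = (m\<^sup>2 - 1) / ((a + m) * (a * m + 1) * X)"
      using p X by (simp add: diff_frac_eq) (simp add: power2_eq_square algebra_simps)
    finally show "(F has_real_derivative (m\<^sup>2 - 1) / ((a + m) * (a * m + 1) * X)) (at a)" .
    have "m\<^sup>2 \<ge> 1" using m by simp
    then show "0 \<le> (m\<^sup>2 - 1) / ((a + m) * (a * m + 1) * X)" using p X by simp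
  next
    have "((\<lambda>a. ln (a * m + 1) - ln (a + m)) \<longlongrightarrow> ln m) at_top"
      using m by real_asymp
    then show "(F \<longlongrightarrow> ln m / X) at_top"
      unfolding F_def using X by (intro tendsto_divide) auto
  qed auto
  also have "ln m / X - F 0 = 2 * ln m / X" by (simp add: F_def)
  finally show ?thesis .
qed

text \<open>The denominator is half the Gram form at the weights (a, b, c, 1). It is linear in c;
  the c-integral leaves a product of two linear factors in b, and the b-integral a logarithm in a,
  to which the exchange of the order of integration applies. The assumption \<open>s \<le> r\<close>
  makes k at least 1, where m^2 - 1 is nonnegative.\<close>

lemma nn_integral_inverse_gram_square:
  fixes r s t :: real
  assumes sum: "r + s + t = 1" and half: "r < 1 / 2" "s < 1 / 2" "t < 1 / 2" and "s \<le> r"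
  shows "(\<integral>\<^sup>+a. \<integral>\<^sup>+b. \<integral>\<^sup>+c. ennreal (1 / (r * (a * b + c) + s * (a * c + b) + t * (a + b * c))\<^sup>2) *
      indicator {0..} c * indicator {0..} b * indicator {0..} a \<partial>lborel \<partial>lborel \<partial>lborel)
    = ennreal (4 / sqrt (shape_disc (r, s, t)) * lob_volume (r, s, t))"
proof -
  have pos: "r > 0" "s > 0" "t > 0" using sum half by auto
  define \<rho> where "\<rho> = sqrt (shape_disc (r, s, t))"
  have \<rho>: "\<rho> > 0" "\<rho>\<^sup>2 = (1 - 2 * r) * (1 - 2 * s) * (1 - 2 * t)"
    using half by (simp_all add: \<rho>_def shape_disc_def)
  define c where "c = (r\<^sup>2 + s\<^sup>2 - t\<^sup>2) / (2 * r * s)"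
  define \<sigma> where "\<sigma> = \<rho> / (2 * r * s)"
  define k where "k = r / s"
  have k: "k \<ge> 1" using \<open>s \<le> r\<close> pos by (simp add: k_def)
  have \<sigma>: "\<sigma> > 0" using \<rho> pos by (simp add: \<sigma>_def)
  have c\<sigma>: "c\<^sup>2 + \<sigma>\<^sup>2 = 1"
  proof -
    have "(r\<^sup>2 + s\<^sup>2 - t\<^sup>2)\<^sup>2 + \<rho>\<^sup>2 = (2 * r * s)\<^sup>2"
    proof -
      have t: "t = 1 - r - s" using sum by simp
      show ?thesis unfolding \<rho>(2) t by (simp add: power2_eq_square algebra_simps)
    qed
    then show ?thesis using pos by (simp add: c_def \<sigma>_def power_divide add_divide_distrib[symmetric])
  qed
  have c: "\<bar>c\<bar> < 1"
  proof -
    have "\<sigma>\<^sup>2 > 0" using \<sigma> by simp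
    then have "c\<^sup>2 < 1" using c\<sigma> by linarith
    then show ?thesis by (simp add: abs_square_less_1)
  qed
  define X where "X = (\<lambda>m. m\<^sup>2 - 2 * c * m + 1)"
  have X: "X m > 0" for m
  proof -
    have "X m = (m - c)\<^sup>2 + \<sigma>\<^sup>2" using c\<sigma> by (simp add: X_def power2_eq_square algebra_simps)
    then show ?thesis using \<sigma> by (simp add: add_nonneg_pos)
  qed
  \<comment> \<open>Law of cosines: c is the cosine of the angle opposite t.\<close>
  have Xk: "X k = t\<^sup>2 / s\<^sup>2" using pos by (simp add: X_def c_def k_def field_simps power2_eq_square)
  define h where "h = (\<lambda>a m. ennreal ((m\<^sup>2 - 1) / ((a + m) * (a * m + 1) * X m)) * indicator {k..} m * indicator {0..} a)"
  have h_meas [measurable]: "case_prod h \<in> borel_measurable (lborel \<Otimes>\<^sub>M lborel)"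
    unfolding h_def X_def by measurable
  let ?g = "\<lambda>a b c. ennreal (1 / (r * (a * b + c) + s * (a * c + b) + t * (a + b * c))\<^sup>2) *
      indicator {0..} c * indicator {0..} b * indicator {0..} a"
  have inner: "(\<integral>\<^sup>+b. \<integral>\<^sup>+c. ?g a b c \<partial>lborel \<partial>lborel) = ennreal (1 / (r * s)) * (\<integral>\<^sup>+m. h a m \<partial>lborel)" if "a \<noteq> 0" for a
  proof (cases "a > 0")
    case True
    have E: "(r * a + s) * (s * a + r) - (t * a) * t = r * s * (a\<^sup>2 + 2 * c * a + 1)"
      using pos by (simp add: c_def field_simps power2_eq_square)
    have quad: "a\<^sup>2 + 2 * c * a + 1 > 0" using X[of "- a"] by (simp add: X_def)
    have "(\<integral>\<^sup>+b. \<integral>\<^sup>+c. ?g a b c \<partial>lborel \<partial>lborel) =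
      (\<integral>\<^sup>+b. ennreal (1 / (((r * a + s) * b + t * a) * (t * b + (s * a + r)))) * indicator {0..} b \<partial>lborel)"
    proof (rule nn_integral_cong_AE)
      show "AE b in lborel. (\<integral>\<^sup>+c. ?g a b c \<partial>lborel) =
        ennreal (1 / (((r * a + s) * b + t * a) * (t * b + (s * a + r)))) * indicator {0..} b"
      proof (rule AE_I2)
        fix b :: real
        show "(\<integral>\<^sup>+c. ?g a b c \<partial>lborel) =
            ennreal (1 / (((r * a + s) * b + t * a) * (t * b + (s * a + r)))) * indicator {0..} b"
        proof (cases "b \<ge> 0")
          case b: True
          have "(\<integral>\<^sup>+c. ?g a b c \<partial>lborel) =
            (\<integral>\<^sup>+c. ennreal (1 / (((r * a + s) * b + t * a) + (t * b + (s * a + r)) * c)\<^sup>2) * indicator {0..} c \<partial>lborel)"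
            using True b by (intro nn_integral_cong) (simp add: algebra_simps)
          also have "\<dots> = ennreal (1 / (((r * a + s) * b + t * a) * (t * b + (s * a + r))))"
          proof (rule nn_integral_inverse_linear_square)
            show "(r * a + s) * b + t * a > 0" "t * b + (s * a + r) > 0"
              using True b pos by (intro add_nonneg_pos mult_nonneg_nonneg mult_pos_pos add_nonneg_nonneg; simp)+
          qed
          finally show ?thesis using b by simp
        qed simp
      qed
    qed
    also have "\<dots> = ennreal (ln ((r * a + s) * (s * a + r) / ((t * a) * t)) / (r * s * (a\<^sup>2 + 2 * c * a + 1)))"
      unfolding E[symmetric] using True pos quad
      by (intro nn_integral_inverse_linear_prod) (auto simp: E add_pos_pos)
    also have "(r * a + s) * (s * a + r) / ((t * a) * t) = (a + k) * (a * k + 1) / (a * X k)"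
    proof -
      have "(a + k) * (a * k + 1) = (r * a + s) * (s * a + r) / s\<^sup>2"
        unfolding k_def using pos by (simp add: field_simps power2_eq_square)
      then show ?thesis unfolding Xk using True pos by (simp add: power2_eq_square)
    qed
    also have "ennreal (ln ((a + k) * (a * k + 1) / (a * X k)) / (r * s * (a\<^sup>2 + 2 * c * a + 1))) =
        ennreal (1 / (r * s)) * ennreal (ln ((a + k) * (a * k + 1) / (a * X k)) / (a\<^sup>2 + 2 * c * a + 1))"
      using pos by (subst ennreal_mult'[symmetric]) auto
    also have "ennreal (ln ((a + k) * (a * k + 1) / (a * X k)) / (a\<^sup>2 + 2 * c * a + 1)) = (\<integral>\<^sup>+m. h a m \<partial>lborel)"
      unfolding X_def h_def using nn_integral_ln_kernel[OF True k c] True by simp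
    finally show ?thesis .
  next
    case False
    then show ?thesis using that by (simp add: h_def)
  qed
  \<comment> \<open>The point a = 0, left out by \<open>inner\<close>, is a null set.\<close>
  have "(\<integral>\<^sup>+a. \<integral>\<^sup>+b. \<integral>\<^sup>+c. ?g a b c \<partial>lborel \<partial>lborel \<partial>lborel) =
      (\<integral>\<^sup>+a. ennreal (1 / (r * s)) * (\<integral>\<^sup>+m. h a m \<partial>lborel) \<partial>lborel)"
    using AE_lborel_singleton[of 0] by (intro nn_integral_cong_AE) (auto elim!: eventually_mono simp: inner)
  also have "\<dots> = ennreal (1 / (r * s)) * (\<integral>\<^sup>+a. \<integral>\<^sup>+m. h a m \<partial>lborel \<partial>lborel)"
    by (intro nn_integral_cmult) measurable
  also have "(\<integral>\<^sup>+a. \<integral>\<^sup>+m. h a m \<partial>lborel \<partial>lborel) = (\<integral>\<^sup>+m. \<integral>\<^sup>+a. h a m \<partial>lborel \<partial>lborel)"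
    by (rule lborel_pair.Fubini'[symmetric]) measurable
  also have "\<dots> = (\<integral>\<^sup>+m. ennreal (2 / \<sigma>) * (ennreal (\<sigma> * ln m / X m) * indicator {k..} m) \<partial>lborel)"
  proof (intro nn_integral_cong)
    fix m :: real
    show "(\<integral>\<^sup>+a. h a m \<partial>lborel) = ennreal (2 / \<sigma>) * (ennreal (\<sigma> * ln m / X m) * indicator {k..} m)"
    proof (cases "k \<le> m")
      case True
      then have m: "m \<ge> 1" using k by simp
      have "ennreal (2 / \<sigma>) * ennreal (\<sigma> * ln m / X m) = ennreal (2 * ln m / X m)"
        using \<sigma> m X[of m] by (subst ennreal_mult'[symmetric]) auto
      then show ?thesis
        using True nn_integral_rational_kernel[OF m X[of m]] by (simp add: h_def)
    qed (simp add: h_def)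
  qed
  also have "\<dots> = ennreal (2 / \<sigma>) * (\<integral>\<^sup>+m. ennreal (\<sigma> * ln m / X m) * indicator {k..} m \<partial>lborel)"
    unfolding X_def by (intro nn_integral_cmult) measurable
  also have "(\<integral>\<^sup>+m. ennreal (\<sigma> * ln m / X m) * indicator {k..} m \<partial>lborel) =
      ennreal (lob ((k - c) / \<sigma>) + lob ((1 / k - c) / \<sigma>) + lob (c / \<sigma>) - lob_limit)"
    unfolding X_def by (rule nn_integral_lob_tail[OF c\<sigma> \<sigma> k])
  also have "lob ((k - c) / \<sigma>) + lob ((1 / k - c) / \<sigma>) + lob (c / \<sigma>) - lob_limit = lob_volume (r, s, t)"
  proof -
    have "(k - c) / \<sigma> = (r\<^sup>2 + t\<^sup>2 - s\<^sup>2) / \<rho>" "(1 / k - c) / \<sigma> = (s\<^sup>2 + t\<^sup>2 - r\<^sup>2) / \<rho>" "c / \<sigma> = (r\<^sup>2 + s\<^sup>2 - t\<^sup>2) / \<rho>"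
      unfolding k_def c_def \<sigma>_def using pos \<rho>(1) by (simp_all add: divide_simps) (simp_all add: power2_eq_square algebra_simps)
    then show ?thesis by (simp add: lob_volume_def Let_def \<rho>_def[symmetric])
  qed
  also have "ennreal (1 / (r * s)) * (ennreal (2 / \<sigma>) * ennreal (lob_volume (r, s, t))) =
      ennreal (4 / \<rho> * lob_volume (r, s, t))"
  proof -
    have "1 / (r * s) * (2 / \<sigma>) = 4 / \<rho>" using pos by (simp add: \<sigma>_def)
    then show ?thesis using pos \<sigma>
      by (subst ennreal_mult'[symmetric], simp, subst ennreal_mult'[symmetric], simp)
        (simp only: mult.assoc[symmetric])
  qed
  finally show ?thesis by (simp add: \<rho>_def)
qed

section \<open>Symmetry in the sides and comparison of shapes\<close>

text \<open>On shapes this is the square root of the permanent of the Gram matrix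
  (\<open>permanent_shape_gram\<close>).\<close>

definition sumsq :: "real \<times> real \<times> real \<Rightarrow> real" where
  "sumsq = (\<lambda>(r, s, t). r\<^sup>2 + s\<^sup>2 + t\<^sup>2)"

lemma shape_disc_swap: "shape_disc (s, r, t) = shape_disc (r, s, t)" "shape_disc (r, t, s) = shape_disc (r, s, t)"
  by (simp_all add: shape_disc_def ac_simps)

lemma sumsq_swap: "sumsq (s, r, t) = sumsq (r, s, t)" "sumsq (r, t, s) = sumsq (r, s, t)"
  by (simp_all add: sumsq_def)

lemma lob_volume_swap: "lob_volume (s, r, t) = lob_volume (r, s, t)" "lob_volume (r, t, s) = lob_volume (r, s, t)"
proof -
  have "lob_volume (r, s, t) = lob ((sumsq (r, s, t) - 2 * r\<^sup>2) / sqrt (shape_disc (r, s, t))) +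
    lob ((sumsq (r, s, t) - 2 * s\<^sup>2) / sqrt (shape_disc (r, s, t))) +
    lob ((sumsq (r, s, t) - 2 * t\<^sup>2) / sqrt (shape_disc (r, s, t))) - lob_limit" for r s t
    by (simp add: lob_volume_def sumsq_def Let_def)
  then show "lob_volume (s, r, t) = lob_volume (r, s, t)" "lob_volume (r, t, s) = lob_volume (r, s, t)"
    by (simp_all add: shape_disc_swap[of s] sumsq_swap[of s] shape_disc_swap(2)[of r t] sumsq_swap(2)[of r t])
qed

text \<open>The integral formula is an equation in \<open>ennreal\<close>, where a negative number
  reads as 0, so it does not show the sign by itself. The integrand, however, is at least a positive
  constant on the cube [1, 2]^3; there each bracket is at most 2 * 2 + 2.\<close>

lemma lob_volume_pos:
  fixes r s t :: real
  assumes sum: "r + s + t = 1" and half: "r < 1 / 2" "s < 1 / 2" "t < 1 / 2" and "s \<le> r"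
  shows "lob_volume (r, s, t) > 0"
proof (rule ccontr)
  assume neg: "\<not> lob_volume (r, s, t) > 0"
  have pos: "r > 0" "s > 0" "t > 0" using sum half by auto
  define g where "g = (\<lambda>a b c. ennreal (1 / (r * (a * b + c) + s * (a * c + b) + t * (a + b * c))\<^sup>2) *
      indicator {0..} c * indicator {0..} b * indicator {0..} a)"
  define m where "m = ennreal (1 / (r * (2 * 2 + 2) + s * (2 * 2 + 2) + t * (2 + 2 * 2))\<^sup>2)"
  have m: "m > 0" using pos by (simp add: m_def add_pos_pos)
  let ?I = "indicator {1..2::real} :: real \<Rightarrow> ennreal"
  have le: "m * ?I c * ?I b * ?I a \<le> g a b c" for a b c
  proof (cases "a \<in> {1..2} \<and> b \<in> {1..2} \<and> c \<in> {1..2}")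
    case True
    have mono: "a' * b' + c' \<le> 2 * 2 + 2" if "a' \<in> {1..2}" "b' \<in> {1..2}" "c' \<in> {1..2::real}" for a' b' c'
      using that mult_mono[of a' 2 b' 2] by auto
    have "r * (a * b + c) + s * (a * c + b) + t * (a + b * c) \<le> r * (2 * 2 + 2) + s * (2 * 2 + 2) + t * (2 + 2 * 2)"
      using True pos mono[of a b c] mono[of a c b] mono[of b c a]
      by (intro add_mono[OF add_mono] mult_left_mono) (auto simp only: add.commute)
    moreover have "0 < r * (a * b + c) + s * (a * c + b) + t * (a + b * c)"
      using True pos by (auto intro!: add_pos_pos mult_pos_pos)
    ultimately have "m \<le> ennreal (1 / (r * (a * b + c) + s * (a * c + b) + t * (a + b * c))\<^sup>2)"
      unfolding m_def by (intro ennreal_leI divide_left_mono power_mono mult_pos_pos) auto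
    then show ?thesis using True by (simp add: g_def)
  qed (auto simp: indicator_def)
  have "m = (\<integral>\<^sup>+a. \<integral>\<^sup>+b. \<integral>\<^sup>+c. m * ?I c * ?I b * ?I a \<partial>lborel \<partial>lborel \<partial>lborel)"
    by (simp add: nn_integral_multc nn_integral_cmult)
  also have "\<dots> \<le> (\<integral>\<^sup>+a. \<integral>\<^sup>+b. \<integral>\<^sup>+c. g a b c \<partial>lborel \<partial>lborel \<partial>lborel)"
    by (intro nn_integral_mono le)
  also have "\<dots> = ennreal (4 / sqrt (shape_disc (r, s, t)) * lob_volume (r, s, t))"
    unfolding g_def by (rule nn_integral_inverse_gram_square[OF assms])
  also have "\<dots> = 0"
  proof -
    have "shape_disc (r, s, t) > 0" using half by (simp add: shape_disc_def)
    then show ?thesis using neg by (intro ennreal_neg mult_nonneg_nonpos) auto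
  qed
  finally show False using m by simp
qed

lemma shape_sorted:
  assumes "T \<in> shapes"
  obtains r s t where "r + s + t = 1" "s \<le> t" "t \<le> r" "r \<le> 1 / 2" "shape_disc T = shape_disc (r, s, t)"
    "sumsq T = sumsq (r, s, t)" "lob_volume T = lob_volume (r, s, t)"
proof -
  obtain x y z where T: "T = (x, y, z)" by (cases T)
  define Good where "Good = (\<lambda>r s t. r + s + t = 1 \<and> r \<le> 1 / 2 \<and> s \<le> 1 / 2 \<and> t \<le> 1 / 2 \<and> shape_disc T = shape_disc (r, s, t) \<and>
    sumsq T = sumsq (r, s, t) \<and> lob_volume T = lob_volume (r, s, t))"
  have base: "Good x y z" using assms by (auto simp: Good_def T shapes_def)
  have swap: "Good s r t" "Good r t s" if "Good r s t" for r s t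
    using that by (simp_all add: Good_def shape_disc_swap[of s] shape_disc_swap(2)[of r t] sumsq_swap[of s] sumsq_swap(2)[of r t]
      lob_volume_swap[of s] lob_volume_swap(2)[of r t])
  have "\<exists>r s t. Good r s t \<and> s \<le> t \<and> t \<le> r"
    using base swap by (metis linear)
  then show thesis using that unfolding Good_def by blast
qed

lemma shape_disc_pos_half:
  assumes "r + s + t = 1" "r \<le> 1 / 2" "s \<le> 1 / 2" "t \<le> 1 / 2" "shape_disc (r, s, t) > 0"
  shows "r < 1 / 2" "s < 1 / 2" "t < 1 / 2"
  using assms by (auto simp: shape_disc_def less_le)

text \<open>Sum and sum of squares determine the unordered pair of r and s, through the
  factorisation (r - r')(r - s') = 0; the ordering then identifies the members.\<close>

lemma sorted_shape_eqI:
  fixes r s t r' s' :: real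
  assumes "r + s + t = 1" "r' + s' + t = 1" "s \<le> r" "s' \<le> r'" "sumsq (r, s, t) = sumsq (r', s', t)"
  shows "r = r' \<and> s = s'"
proof -
  have s: "s = 1 - t - r" "s' = 1 - t - r'" using assms by auto
  have "(r - r') * (r - s') = 0"
    using assms(5) unfolding sumsq_def s by (simp add: power2_eq_square algebra_simps)
  then show ?thesis using assms by auto
qed

text \<open>On a level curve of the permanent both \<open>shape_disc\<close> and
  \<open>lob_volume\<close> increase strictly with the middle side, and equal middle sides mean
  equal sorted shapes. Comparing discriminants is therefore comparing middle sides.\<close>

lemma lob_volume_strict_mono_disc:
  assumes T: "T \<in> shapes" "T' \<in> shapes" and per: "sumsq T = sumsq T'"
    and disc: "0 < shape_disc T" "shape_disc T < shape_disc T'"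
  shows "lob_volume T < lob_volume T'"
proof -
  obtain r s t where 1: "r + s + t = 1" "s \<le> t" "t \<le> r" "r \<le> 1 / 2" "shape_disc T = shape_disc (r, s, t)"
    "sumsq T = sumsq (r, s, t)" "lob_volume T = lob_volume (r, s, t)" by (rule shape_sorted[OF T(1)])
  obtain r' s' t' where 2: "r' + s' + t' = 1" "s' \<le> t'" "t' \<le> r'" "r' \<le> 1 / 2" "shape_disc T' = shape_disc (r', s', t')"
    "sumsq T' = sumsq (r', s', t')" "lob_volume T' = lob_volume (r', s', t')" by (rule shape_sorted[OF T(2)])
  have half: "r < 1 / 2" "r' < 1 / 2"
    using shape_disc_pos_half(1)[of r s t] shape_disc_pos_half(1)[of r' s' t'] 1 2 disc by auto
  have per': "r\<^sup>2 + s\<^sup>2 + t\<^sup>2 = r'\<^sup>2 + s'\<^sup>2 + t'\<^sup>2" using 1(6) 2(6) per by (simp add: sumsq_def)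
  have "\<not> t' < t"
    using fixed_permanent_curve(1)[of r' s' t' r s t] 1 2 half per' disc by auto
  moreover have "t \<noteq> t'"
  proof
    assume t: "t = t'"
    have "r = r' \<and> s = s'"
      by (rule sorted_shape_eqI[of r s t]) (use 1 2 t per in auto)
    then show False using disc 1(5) 2(5) t by simp
  qed
  ultimately have "t < t'" by simp
  then show ?thesis
    using fixed_permanent_curve(2)[of r s t r' s' t'] 1 2 half per' by auto
qed

text \<open>This makes \<open>vol\<close> well defined for \<alpha> different from 0: two sorted
  shapes with the same invariants coincide.\<close>

lemma lob_volume_eqI:
  assumes T: "T \<in> shapes" "T' \<in> shapes" and per: "sumsq T = sumsq T'" and disc: "0 < shape_disc T" "shape_disc T = shape_disc T'"
  shows "lob_volume T = lob_volume T'"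
proof -
  obtain r s t where 1: "r + s + t = 1" "s \<le> t" "t \<le> r" "r \<le> 1 / 2" "shape_disc T = shape_disc (r, s, t)"
    "sumsq T = sumsq (r, s, t)" "lob_volume T = lob_volume (r, s, t)" by (rule shape_sorted[OF T(1)])
  obtain r' s' t' where 2: "r' + s' + t' = 1" "s' \<le> t'" "t' \<le> r'" "r' \<le> 1 / 2" "shape_disc T' = shape_disc (r', s', t')"
    "sumsq T' = sumsq (r', s', t')" "lob_volume T' = lob_volume (r', s', t')" by (rule shape_sorted[OF T(2)])
  have half: "r < 1 / 2" "r' < 1 / 2"
    using shape_disc_pos_half(1)[of r s t] shape_disc_pos_half(1)[of r' s' t'] 1 2 disc by auto
  have per': "r\<^sup>2 + s\<^sup>2 + t\<^sup>2 = r'\<^sup>2 + s'\<^sup>2 + t'\<^sup>2" using 1(6) 2(6) per by (simp add: sumsq_def)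
  have "\<not> t' < t" "\<not> t < t'"
    using fixed_permanent_curve(1)[of r' s' t' r s t] fixed_permanent_curve(1)[of r s t r' s' t'] 1 2 half per' disc by auto
  then have t: "t = t'" by simp
  have "r = r' \<and> s = s'"
    by (rule sorted_shape_eqI[of r s t]) (use 1 2 t per in auto)
  then show ?thesis using 1 2 t by simp
qed

lemma lob_volume_strict_mono_sumsq:
  assumes T: "T \<in> shapes" "T' \<in> shapes" and disc: "0 < shape_disc T" "shape_disc T = shape_disc T'"
    and per: "sumsq T < sumsq T'"
  shows "lob_volume T < lob_volume T'"
proof -
  obtain r s t where 1: "r + s + t = 1" "s \<le> t" "t \<le> r" "r \<le> 1 / 2" "shape_disc T = shape_disc (r, s, t)"
    "sumsq T = sumsq (r, s, t)" "lob_volume T = lob_volume (r, s, t)" by (rule shape_sorted[OF T(1)])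
  obtain r' s' t' where 2: "r' + s' + t' = 1" "s' \<le> t'" "t' \<le> r'" "r' \<le> 1 / 2" "shape_disc T' = shape_disc (r', s', t')"
    "sumsq T' = sumsq (r', s', t')" "lob_volume T' = lob_volume (r', s', t')" by (rule shape_sorted[OF T(2)])
  have half: "r < 1 / 2" "r' < 1 / 2" and t_half: "t < 1 / 2"
    using shape_disc_pos_half[of r s t] shape_disc_pos_half(1)[of r' s' t'] 1 2 disc by auto
  have disc': "shape_disc (r, s, t) = shape_disc (r', s', t')" using disc 1 2 by simp
  have per': "r\<^sup>2 + s\<^sup>2 + t\<^sup>2 < r'\<^sup>2 + s'\<^sup>2 + t'\<^sup>2" using 1(6) 2(6) per by (simp add: sumsq_def)
  have "\<not> t' < t"
    using fixed_det_curve(1)[of r' s' t' r s t] 1 2 half disc' per' by auto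
  moreover have "t \<noteq> t'"
  proof
    assume t: "t = t'"
    have s: "s = 1 - t - r" "s' = 1 - t - r'" using 1 2 t by auto
    have "(1 - 2 * t) * ((1 - 2 * r) * (1 - 2 * s)) = (1 - 2 * t) * ((1 - 2 * r') * (1 - 2 * s'))"
      using disc' t by (simp add: shape_disc_def ac_simps)
    then have "(1 - 2 * r) * (1 - 2 * s) = (1 - 2 * r') * (1 - 2 * s')" using t_half by simp
    then have "r\<^sup>2 + s\<^sup>2 = r'\<^sup>2 + s'\<^sup>2" unfolding s by (simp add: power2_eq_square algebra_simps)
    then show False using per' t by simp
  qed
  ultimately have "t < t'" by simp
  then show ?thesis
    using fixed_det_curve(2)[of r s t r' s' t'] 1 2 half disc' by auto
qed

section \<open>Ideal simplices and their geodesic hulls\<close>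

lemma span_singleton_eq_iff:
  fixes v w :: "'a::real_vector"
  assumes "v \<noteq> 0"
  shows "span {v} = span {w} \<longleftrightarrow> (\<exists>c. c \<noteq> 0 \<and> w = c *\<^sub>R v)"
proof
  assume eq: "span {v} = span {w}"
  have "w \<in> span {v}" unfolding eq by (simp add: span_base)
  moreover have "v \<in> span {w}" unfolding eq[symmetric] by (simp add: span_base)
  ultimately obtain c where c: "w = c *\<^sub>R v" by (auto simp: span_singleton)
  have "w \<noteq> 0" using \<open>v \<in> span {w}\<close> assms by auto
  then show "\<exists>c. c \<noteq> 0 \<and> w = c *\<^sub>R v" using c by auto
next
  assume "\<exists>c. c \<noteq> 0 \<and> w = c *\<^sub>R v"
  then obtain c where c: "c \<noteq> 0" "w = c *\<^sub>R v" by blast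
  then have "v = (1 / c) *\<^sub>R w" by simp
  then have "v \<in> span {w}" by (metis span_base span_scale singletonI)
  moreover have "w \<in> span {v}" using c by (simp add: span_base span_scale)
  ultimately show "span {v} = span {w}" by (simp add: span_eq)
qed

section \<open>Time and space coordinates of the Lorentz form\<close>

locale lorentz =
  fixes B :: "'v::real_vector \<Rightarrow> 'v \<Rightarrow> real" and b :: "3 \<Rightarrow> 'v" and e :: 'v
  assumes bilinear: "bilinear B"
    and sym: "B u w = B w u"
    and basis: "lorentz_basis B UNIV b e"
begin

definition tc :: "'v \<Rightarrow> real" where "tc v = B v e"

text \<open>The minus sign yields the coordinates along the vectors \<open>b i\<close>, which have
  square -1.\<close>

definition sp :: "'v \<Rightarrow> real^3" where "sp v = (\<chi> i. - B v (b i))"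

lemma linear_B: "linear (\<lambda>u. B u w)" "linear (B u)"
  using bilinear by (auto simp: bilinear_def)

lemma B_add: "B (u + u') w = B u w + B u' w" "B u (w + w') = B u w + B u w'"
  using bilinear by (simp_all add: bilinear_ladd bilinear_radd)

lemma B_diff: "B (u - u') w = B u w - B u' w" "B u (w - w') = B u w - B u w'"
  using bilinear by (simp_all add: bilinear_lsub bilinear_rsub)

lemma B_scaleR: "B (c *\<^sub>R u) w = c * B u w" "B u (c *\<^sub>R w) = c * B u w"
  using bilinear by (simp_all add: bilinear_lmul bilinear_rmul)

lemma B_minus: "B (- u) w = - B u w" "B u (- w) = - B u w"
  using bilinear by (simp_all add: bilinear_lneg bilinear_rneg)

lemma B_zero: "B 0 w = 0" "B u 0 = 0"
  using bilinear by (simp_all add: bilinear_lzero bilinear_rzero)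

lemma B_sum: "B (\<Sum>i\<in>A. f i) w = (\<Sum>i\<in>A. B (f i) w)" "B u (\<Sum>i\<in>A. f i) = (\<Sum>i\<in>A. B u (f i))"
  using linear_sum[OF linear_B(1)] linear_sum[OF linear_B(2)] by auto

lemmas B_simps = B_add B_diff B_scaleR B_minus B_zero B_sum

lemma B_basis: "B e e = 1" "B (b i) e = 0" "B e (b i) = 0" "B (b i) (b j) = (if i = j then - 1 else 0)"
  using basis by (auto simp: lorentz_basis_def)

lemma tc_simps: "tc (u + w) = tc u + tc w" "tc (u - w) = tc u - tc w" "tc (c *\<^sub>R u) = c * tc u"
  "tc 0 = 0" "tc (- u) = - tc u" "tc (\<Sum>i\<in>A. f i) = (\<Sum>i\<in>A. tc (f i))" "tc e = 1" "tc (b i) = 0"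
  by (simp_all add: tc_def B_simps B_basis)

lemma sp_simps: "sp (u + w) = sp u + sp w" "sp (u - w) = sp u - sp w" "sp (c *\<^sub>R u) = c *\<^sub>R sp u"
  "sp 0 = 0" "sp (- u) = - sp u" "sp (\<Sum>i\<in>A. f i) = (\<Sum>i\<in>A. sp (f i))" "sp e = 0" "sp (b i) = axis i 1"
  by (auto simp: sp_def B_simps B_basis vec_eq_iff axis_def sum_negf)

definition emb :: "real \<Rightarrow> real^3 \<Rightarrow> 'v" where "emb c x = c *\<^sub>R e + (\<Sum>i\<in>UNIV. (x $ i) *\<^sub>R b i)"

lemma tc_emb [simp]: "tc (emb c x) = c"
  by (simp add: emb_def tc_simps)

lemma sp_emb [simp]: "sp (emb c x) = x"
  by (simp add: emb_def sp_simps vec_eq_iff axis_def if_distrib if_distribR cong: if_cong)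

lemma emb_tc_sp [simp]: "emb (tc v) (sp v) = v"
proof -
  have "v \<in> span (insert e (range b))" using basis by (simp add: lorentz_basis_def)
  then show ?thesis
  proof (induction rule: span_induct_alt)
    case base
    then show ?case by (simp add: emb_def tc_simps sp_simps)
  next
    case (step c x y)
    have add: "emb (c + d) (x + y) = emb c x + emb d y" for c d x y
      by (simp add: emb_def scaleR_add_left sum.distrib)
    have scale: "emb (c * d) (c *\<^sub>R x) = c *\<^sub>R emb d x" for c d x
      by (simp add: emb_def scaleR_add_right scaleR_sum_right)
    have "emb (tc x) (sp x) = x"
    proof (cases "x = e")
      case False
      then obtain i where "x = b i" using step by auto
      then show ?thesis by (simp add: emb_def tc_simps sp_simps axis_def if_distrib[of "\<lambda>c. c *\<^sub>R _"] cong: if_cong)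
    qed (simp add: emb_def tc_simps sp_simps)
    then show ?case by (simp add: tc_simps sp_simps add scale step)
  qed
qed

lemma coord_eqI: "tc v = tc w \<Longrightarrow> sp v = sp w \<Longrightarrow> v = w"
  by (metis emb_tc_sp)

lemma B_eq: "B v w = tc v * tc w - sp v \<bullet> sp w"
proof -
  have "B v w = B v (emb (tc w) (sp w))" by simp
  also have "\<dots> = tc w * B v e + (\<Sum>i\<in>UNIV. sp w $ i * B v (b i))"
    by (simp only: emb_def B_simps)
  also have "\<dots> = tc v * tc w - sp v \<bullet> sp w"
    by (simp add: inner_vec_def tc_def) (simp add: sp_def sum_negf mult.commute)
  finally show ?thesis .
qed

lemma chart_eq_emb: "chart b e x = emb 1 x"
  by (simp add: chart_def emb_def)

lemma B_chart: "B (chart b e x) (chart b e x) = 1 - x \<bullet> x"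
  by (simp add: B_eq chart_eq_emb)

lemma chart_nonzero: "chart b e x \<noteq> 0"
proof
  assume "chart b e x = 0"
  then have "tc (chart b e x) = 0" by (simp add: tc_simps)
  then show False by (simp add: chart_eq_emb)
qed

lemma causal_tc_nonzero:
  assumes "B v v \<ge> 0" "v \<noteq> 0"
  shows "tc v \<noteq> 0"
proof
  assume 0: "tc v = 0"
  then have "sp v \<bullet> sp v \<le> 0" using assms by (simp add: B_eq)
  then have "sp v = 0" by (metis inner_eq_zero_iff inner_ge_zero antisym)
  then show False using 0 assms coord_eqI[of v 0] by (simp add: tc_simps sp_simps)
qed

text \<open>Subtracting the multiple of v that removes the time coordinate of w leaves a vector u
  with B u u \<le> 0. Orthogonality gives B u u = B w w + c^2 B v v \<ge> 0, so u = 0.\<close>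

lemma causal_orthogonal:
  assumes v: "B v v \<ge> 0" "v \<noteq> 0" and w: "B w w \<ge> 0" "w \<noteq> 0" and "B v w = 0"
  obtains c where "c \<noteq> 0" "w = c *\<^sub>R v"
proof -
  define c where "c = tc w / tc v"
  define u where "u = w - c *\<^sub>R v"
  have tc: "tc u = 0" using causal_tc_nonzero[OF v] by (simp add: u_def c_def tc_simps)
  have "B u u = B w w + c\<^sup>2 * B v v"
    using assms(5) sym[of w v] by (simp add: u_def B_simps power2_eq_square)
  then have "B u u \<ge> 0" using v w by simp
  then have "sp u \<bullet> sp u \<le> 0" using tc by (simp add: B_eq)
  then have "sp u = 0" by (metis inner_eq_zero_iff inner_ge_zero antisym)
  then have "u = 0" using tc coord_eqI[of u 0] by (simp add: tc_simps sp_simps)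
  then have "w = c *\<^sub>R v" by (simp add: u_def)
  moreover from this w have "c \<noteq> 0" by auto
  ultimately show thesis using that by blast
qed

lemma orthogonal_timelike_neg:
  assumes "B f f > 0" "B u f = 0" "u \<noteq> 0"
  shows "B u u < 0"
proof (rule ccontr)
  assume "\<not> B u u < 0"
  moreover have "f \<noteq> 0" using assms by (auto simp: B_zero)
  ultimately obtain c where c: "c \<noteq> 0" "u = c *\<^sub>R f"
    using causal_orthogonal[of f u] assms sym[of f u] by auto
  then show False using assms by (simp add: B_scaleR)
qed

text \<open>The space part of an isotropic vector has norm equal to the absolute value of its time
  coordinate. By Cauchy-Schwarz the inner product of the space parts is at least -|tc v * tc w|,
  which B v w > 0 turns into the claim.\<close>

lemma isotropic_tc_same_sign:
  assumes "B v v = 0" "B w w = 0" "B v w > 0"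
  shows "tc v * tc w > 0"
proof -
  have "sp v \<bullet> sp v = (tc v)\<^sup>2" "sp w \<bullet> sp w = (tc w)\<^sup>2"
    using assms(1,2) by (simp_all add: B_eq power2_eq_square)
  then have "norm (sp v) = \<bar>tc v\<bar>" "norm (sp w) = \<bar>tc w\<bar>"
    by (metis norm_eq_sqrt_inner real_sqrt_abs)+
  then have "\<bar>sp v \<bullet> sp w\<bar> \<le> \<bar>tc v * tc w\<bar>"
    using Cauchy_Schwarz_ineq2[of "sp v" "sp w"] by (simp add: abs_mult)
  then show ?thesis using assms(3) by (simp add: B_eq)
qed

text \<open>Three linear conditions on four coordinates have a nonzero solution.\<close>

lemma exists_orthogonal3:
  fixes a :: "3 \<Rightarrow> 'v"
  obtains n where "n \<noteq> 0" "\<And>i. B n (a i) = 0"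
proof -
  define L where "L = (\<lambda>p. \<chi> i. fst p * tc (a i) - snd p \<bullet> sp (a i) :: real^3)"
  have "linear L"
    by (rule linearI) (simp_all add: L_def vec_eq_iff inner_add_left algebra_simps)
  have "\<not> inj L"
  proof
    assume "inj L"
    then have "dim (range L) = dim (UNIV :: (real \<times> (real^3)) set)"
      using \<open>linear L\<close> by (intro dim_image_eq) auto
    then show False using dim_subset_UNIV[of "range L"] by (simp add: dim_UNIV)
  qed
  then obtain p where "p \<noteq> 0" "L p = 0"
    using linear_injective_0[OF \<open>linear L\<close>] by blast
  then obtain c x where cx: "(c, x) \<noteq> 0" "L (c, x) = 0" by (cases p) auto
  show thesis
  proof (rule that[of "emb c x"])
    show "emb c x \<noteq> 0"
    proof
      assume "emb c x = 0"
      then have "tc (emb c x) = 0" "sp (emb c x) = 0" by (simp_all add: tc_simps sp_simps del: tc_emb sp_emb)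
      then show False using cx by (simp add: zero_prod_def)
    qed
  qed (use cx in \<open>simp add: L_def vec_eq_iff B_eq\<close>)
qed

lemma mem_hyp_points_iff: "v \<noteq> 0 \<Longrightarrow> span {v} \<in> hyp_points B \<longleftrightarrow> B v v > 0"
  unfolding hyp_points_def
proof safe
  fix w assume "v \<noteq> 0" "span {v} = span {w}" "B w w > 0"
  then obtain c where "w = c *\<^sub>R v" using span_singleton_eq_iff by blast
  then have "0 < (c * c) * B v v" using \<open>B w w > 0\<close> by (simp add: B_scaleR mult.assoc)
  then show "B v v > 0" by (metis zero_less_mult_iff not_less zero_le_square)
qed auto

lemma mem_ideal_points_iff: "v \<noteq> 0 \<Longrightarrow> span {v} \<in> ideal_points B \<longleftrightarrow> B v v = 0"
  unfolding ideal_points_def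
proof safe
  fix w assume "v \<noteq> 0" "span {v} = span {w}" "B w w = 0" "w \<noteq> 0"
  then obtain c where "c \<noteq> 0" "w = c *\<^sub>R v" using span_singleton_eq_iff by blast
  then show "B v v = 0" using \<open>B w w = 0\<close> by (simp add: B_scaleR)
qed auto

section \<open>Projective cones as geodesic hulls\<close>

definition proj_cone :: "('i::finite \<Rightarrow> 'v) \<Rightarrow> 'v set set" where
  "proj_cone v = {span {p} | p y. p = (\<Sum>i\<in>UNIV. y i *\<^sub>R v i) \<and> (\<forall>i. y i \<ge> 0) \<and> p \<noteq> 0}"

lemma proj_coneI:
  assumes "\<And>i. y i \<ge> 0" "(\<Sum>i\<in>UNIV. y i *\<^sub>R v i) \<noteq> 0"
  shows "span {\<Sum>i\<in>UNIV. y i *\<^sub>R v i} \<in> proj_cone v"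
  using assms unfolding proj_cone_def by blast

text \<open>A point is a line, so the given u and w lie in the cone only up to scalars c and d. For
  scalars of equal sign the combination lies in the cone up to a global sign.\<close>

lemma proj_cone_convex:
  fixes v :: "'i::finite \<Rightarrow> 'v"
  assumes nonneg: "\<And>i j. B (v i) (v j) \<ge> 0"
  shows "geodesically_convex B (proj_cone v)"
proof -
  have B_nonneg: "B (\<Sum>i\<in>UNIV. y i *\<^sub>R v i) (\<Sum>i\<in>UNIV. z i *\<^sub>R v i) \<ge> 0"
    if "\<And>i. y i \<ge> 0" "\<And>i. z i \<ge> 0" for y z
    using that nonneg by (auto simp: B_simps intro!: sum_nonneg mult_nonneg_nonneg)
  have "proj_cone v \<subseteq> hyp_points B \<union> ideal_points B"
  proof
    fix P assume "P \<in> proj_cone v"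
    then obtain p y where P: "P = span {p}" "p = (\<Sum>i\<in>UNIV. y i *\<^sub>R v i)" "\<forall>i. y i \<ge> 0" "p \<noteq> 0"
      by (auto simp: proj_cone_def)
    then have "B p p \<ge> 0" using B_nonneg[of y y] by simp
    then show "P \<in> hyp_points B \<union> ideal_points B"
      using P(1,4) mem_hyp_points_iff mem_ideal_points_iff by fastforce
  qed
  moreover have "span {x *\<^sub>R u + y *\<^sub>R w} \<in> proj_cone v"
    if uw: "u \<noteq> 0" "w \<noteq> 0" "span {u} \<in> proj_cone v" "span {w} \<in> proj_cone v" "B u w \<ge> 0"
      and xy: "x \<ge> 0" "y \<ge> 0" "x *\<^sub>R u + y *\<^sub>R w \<noteq> 0" for u w x y
  proof -
    have rep: "\<exists>c y. c \<noteq> 0 \<and> (\<forall>i. y i \<ge> 0) \<and> c *\<^sub>R u = (\<Sum>i\<in>UNIV. y i *\<^sub>R v i)"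
      if "u \<noteq> 0" "span {u} \<in> proj_cone v" for u
      using that unfolding proj_cone_def by (auto simp: span_singleton_eq_iff)
    obtain c y1 where c: "c \<noteq> 0" "\<And>i. y1 i \<ge> 0" "c *\<^sub>R u = (\<Sum>i\<in>UNIV. y1 i *\<^sub>R v i)"
      using rep[OF uw(1,3)] by blast
    obtain d y2 where d: "d \<noteq> 0" "\<And>i. y2 i \<ge> 0" "d *\<^sub>R w = (\<Sum>i\<in>UNIV. y2 i *\<^sub>R v i)"
      using rep[OF uw(2,4)] by blast
    show ?thesis
    proof (cases "c * d > 0")
      case True
      define k where "k = (if c > 0 then 1 else - 1 :: real)"
      have k: "k \<noteq> 0" "k / c \<ge> 0" "k / d \<ge> 0"
        using True c d by (auto simp: k_def zero_less_mult_iff divide_nonpos_neg)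
      have "k *\<^sub>R (x *\<^sub>R u + y *\<^sub>R w) = (k * x / c) *\<^sub>R (c *\<^sub>R u) + (k * y / d) *\<^sub>R (d *\<^sub>R w)"
        using c(1) d(1) by (simp add: scaleR_add_right)
      also have "\<dots> = (\<Sum>i\<in>UNIV. (k * x / c * y1 i + k * y / d * y2 i) *\<^sub>R v i)"
        unfolding c(3) d(3) by (simp add: scaleR_sum_right scaleR_add_left sum.distrib)
      finally have eq: "k *\<^sub>R (x *\<^sub>R u + y *\<^sub>R w) = \<dots>" .
      have "span {x *\<^sub>R u + y *\<^sub>R w} = span {k *\<^sub>R (x *\<^sub>R u + y *\<^sub>R w)}"
        using xy k by (subst span_singleton_eq_iff) auto
      moreover have "k * x / c * y1 i + k * y / d * y2 i \<ge> 0" for i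
      proof -
        have "0 \<le> k / c * x * y1 i" "0 \<le> k / d * y * y2 i"
          using k xy c d by (intro mult_nonneg_nonneg; simp)+
        then show ?thesis by simp
      qed
      moreover have "k *\<^sub>R (x *\<^sub>R u + y *\<^sub>R w) \<noteq> 0" using xy k by simp
      ultimately show ?thesis unfolding eq by (simp add: proj_coneI)
    next
      case False
      \<comment> \<open>With c and d of opposite sign, B u w is both nonnegative and nonpositive,
        hence 0. Orthogonal causal vectors are proportional, so u and w represent the same point and
        the segment is trivial.\<close>
      have "0 \<le> B (c *\<^sub>R u) (d *\<^sub>R w)" unfolding c(3) d(3) using c d by (intro B_nonneg) auto
      then have "B u w = 0"
        using False uw(5) c(1) d(1) by (auto simp: B_scaleR zero_le_mult_iff not_less mult_le_0_iff)
      moreover have "0 \<le> B (c *\<^sub>R u) (c *\<^sub>R u)" "0 \<le> B (d *\<^sub>R w) (d *\<^sub>R w)"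
        unfolding c(3) d(3) using c d by (intro B_nonneg; auto)+
      then have "B u u \<ge> 0" "B w w \<ge> 0"
        using c(1) d(1) by (auto simp: B_scaleR zero_le_mult_iff mult_le_0_iff)
      ultimately obtain f where f: "f \<noteq> 0" "w = f *\<^sub>R u" using causal_orthogonal uw by metis
      then have "x *\<^sub>R u + y *\<^sub>R w = (x + y * f) *\<^sub>R u" by (simp add: scaleR_add_left)
      moreover from this xy have "x + y * f \<noteq> 0" by auto
      ultimately have "span {u} = span {x *\<^sub>R u + y *\<^sub>R w}"
        using uw(1) by (subst span_singleton_eq_iff) auto
      then show ?thesis using uw(3) by simp
    qed
  qed
  ultimately show ?thesis unfolding geodesically_convex_def by blast
qed

text \<open>For minimality a nonnegative combination is built by adding one generator at a time. The
  new generator has nonnegative product with the partial sum, so each addition stays on a geodesic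
  segment.\<close>

lemma geodesic_hull_eq:
  fixes v :: "'i::finite \<Rightarrow> 'v"
  assumes nonneg: "\<And>i j. B (v i) (v j) \<ge> 0" and nonzero: "\<And>i. v i \<noteq> 0"
  shows "geodesically_convex B hull range (\<lambda>i. span {v i}) = proj_cone v"
proof (rule hull_unique)
  have "span {v i} \<in> proj_cone v" for i
  proof -
    have eq: "(\<Sum>j\<in>UNIV. (if j = i then 1 else 0) *\<^sub>R v j) = v i"
      proof -
      have "(\<Sum>j\<in>UNIV. (if j = i then 1 else 0) *\<^sub>R v j) = (\<Sum>j\<in>UNIV. if j = i then v j else 0)"
        by (intro sum.cong) auto
      then show ?thesis by simp
    qed
    show ?thesis
      using proj_coneI[of "\<lambda>j. if j = i then 1 else 0" v, unfolded eq] nonzero by simp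
  qed
  then show "range (\<lambda>i. span {v i}) \<subseteq> proj_cone v" by blast
next
  show "geodesically_convex B (proj_cone v)" by (rule proj_cone_convex[OF nonneg])
next
  fix C assume C: "range (\<lambda>i. span {v i}) \<subseteq> C" "geodesically_convex B C"
  have conv: "span {x *\<^sub>R u + y *\<^sub>R w} \<in> C"
    if "u \<noteq> 0" "w \<noteq> 0" "span {u} \<in> C" "span {w} \<in> C" "B u w \<ge> 0" "x \<ge> 0" "y \<ge> 0" "x *\<^sub>R u + y *\<^sub>R w \<noteq> 0"
    for u w x y
    using C(2) that unfolding geodesically_convex_def by blast
  have *: "span {\<Sum>i\<in>I. y i *\<^sub>R v i} \<in> C"
    if "finite I" "\<And>i. y i \<ge> 0" "(\<Sum>i\<in>I. y i *\<^sub>R v i) \<noteq> 0" for I y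
    using that
  proof (induction I rule: finite_induct)
    case (insert j I)
    let ?p = "\<Sum>i\<in>I. y i *\<^sub>R v i"
    have vj: "span {v j} \<in> C" using C(1) by blast
    have sum: "(\<Sum>i\<in>insert j I. y i *\<^sub>R v i) = y j *\<^sub>R v j + 1 *\<^sub>R ?p" using insert by simp
    show ?case
    proof (cases "?p = 0")
      case True
      then have "span {v j} = span {\<Sum>i\<in>insert j I. y i *\<^sub>R v i}"
        using insert nonzero[of j] by (subst span_singleton_eq_iff) auto
      then show ?thesis using vj by simp
    next
      case False
      have p: "span {?p} \<in> C" using insert False by blast
      have "B (v j) ?p \<ge> 0" using nonneg insert by (auto simp: B_simps intro!: sum_nonneg)
      then show ?thesis
        using insert.prems unfolding sum by (intro conv vj p nonzero False) simp_all
    qed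
  qed simp
  show "proj_cone v \<subseteq> C" unfolding proj_cone_def using * by auto
qed

end

section \<open>The volume of a non-degenerate tetrahedron\<close>

lemma det_4:
  "det (A :: 'a::comm_ring_1^4^4) =
    A$1$1 * (A$2$2 * A$3$3 * A$4$4 + A$2$3 * A$3$4 * A$4$2 + A$2$4 * A$3$2 * A$4$3
      - A$2$2 * A$3$4 * A$4$3 - A$2$3 * A$3$2 * A$4$4 - A$2$4 * A$3$3 * A$4$2)
    - A$1$2 * (A$2$1 * A$3$3 * A$4$4 + A$2$3 * A$3$4 * A$4$1 + A$2$4 * A$3$1 * A$4$3
      - A$2$1 * A$3$4 * A$4$3 - A$2$3 * A$3$1 * A$4$4 - A$2$4 * A$3$3 * A$4$1)
    + A$1$3 * (A$2$1 * A$3$2 * A$4$4 + A$2$2 * A$3$4 * A$4$1 + A$2$4 * A$3$1 * A$4$2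
      - A$2$1 * A$3$4 * A$4$2 - A$2$2 * A$3$1 * A$4$4 - A$2$4 * A$3$2 * A$4$1)
    - A$1$4 * (A$2$1 * A$3$2 * A$4$3 + A$2$2 * A$3$3 * A$4$1 + A$2$3 * A$3$1 * A$4$2
      - A$2$1 * A$3$3 * A$4$2 - A$2$2 * A$3$1 * A$4$3 - A$2$3 * A$3$2 * A$4$1)"
proof -
  have f: "finite {2, 3, 4 :: 4}" "1 \<notin> {2, 3, 4 :: 4}" "finite {3, 4 :: 4}" "2 \<notin> {3, 4 :: 4}"
    "finite {4 :: 4}" "3 \<notin> {4 :: 4}"
    by auto
  show ?thesis
    unfolding det_def UNIV_4
    unfolding sum_over_permutations_insert[OF f(1,2)]
    unfolding sum_over_permutations_insert[OF f(3,4)]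
    unfolding sum_over_permutations_insert[OF f(5,6)]
    unfolding permutes_sing
    by (simp add: sign_swap_id permutation_swap_id sign_compose sign_id swap_id_eq permutation_compose algebra_simps)
qed

text \<open>Only the nine derangements contribute: the three double transpositions give the fourth
  powers, the six 4-cycles give each mixed product of two squares twice.\<close>

lemma permanent_shape_gram:
  "permanent (shape_gram (r, s, t)) = (r\<^sup>2 + s\<^sup>2 + t\<^sup>2)\<^sup>2"
proof -
  have f: "finite {2, 3, 4 :: 4}" "1 \<notin> {2, 3, 4 :: 4}" "finite {3, 4 :: 4}" "2 \<notin> {3, 4 :: 4}"
    "finite {4 :: 4}" "3 \<notin> {4 :: 4}"
    by auto
  show ?thesis
    unfolding permanent_def UNIV_4
    unfolding sum_over_permutations_insert[OF f(1,2)]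
    unfolding sum_over_permutations_insert[OF f(3,4)]
    unfolding sum_over_permutations_insert[OF f(5,6)]
    unfolding permutes_sing
    by (simp add: swap_id_eq vector_def power2_eq_square algebra_simps)
qed

lemma shape_gram_nth:
  "shape_gram (r, s, t) $ 1 = vector [0, r, s, t]" "shape_gram (r, s, t) $ 2 = vector [r, 0, t, s]"
  "shape_gram (r, s, t) $ 3 = vector [s, t, 0, r]" "shape_gram (r, s, t) $ 4 = vector [t, s, r, 0]"
  by (simp_all add: vector_def)

lemma vector_4_nth:
  "(vector [x, y, z, w] :: ('a::zero)^4) $ 1 = x" "(vector [x, y, z, w] :: 'a^4) $ 2 = y"
  "(vector [x, y, z, w] :: 'a^4) $ 3 = z" "(vector [x, y, z, w] :: 'a^4) $ 4 = w"
  by (simp_all add: vector_def)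

definition triple :: "real^3 \<Rightarrow> real^3 \<Rightarrow> real^3 \<Rightarrow> real" where
  "triple x y z = x$1 * (y$2 * z$3 - y$3 * z$2) - x$2 * (y$1 * z$3 - y$3 * z$1) + x$3 * (y$1 * z$2 - y$2 * z$1)"

lemma vec_has_derivative_nth: "((\<lambda>y. y $ i) has_derivative (\<lambda>h. h $ i)) F"
  by (rule bounded_linear_imp_has_derivative) (rule bounded_linear_vec_nth)

text \<open>M is the Jacobian matrix of N / D for affine N and D whose linear coefficients are the
  n_k and c_k. Expanding by columns, the terms that contain N twice vanish.\<close>

lemma det_projective_jacobian:
  fixes n\<^sub>1 n\<^sub>2 n\<^sub>3 N :: "real^3" and M :: "real^3^3"
  assumes D: "D \<noteq> 0"
    and M: "\<And>k. M $ k $ 1 = n\<^sub>1 $ k / D - c\<^sub>1 * N $ k / D\<^sup>2" "\<And>k. M $ k $ 2 = n\<^sub>2 $ k / D - c\<^sub>2 * N $ k / D\<^sup>2"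
      "\<And>k. M $ k $ 3 = n\<^sub>3 $ k / D - c\<^sub>3 * N $ k / D\<^sup>2"
  shows "det M = (D * triple n\<^sub>1 n\<^sub>2 n\<^sub>3 - c\<^sub>1 * triple N n\<^sub>2 n\<^sub>3 - c\<^sub>2 * triple n\<^sub>1 N n\<^sub>3 - c\<^sub>3 * triple n\<^sub>1 n\<^sub>2 N) / D ^ 4"
proof -
  define k where "k = 1 / D"
  have eq: "x / D - c * y / D\<^sup>2 = k * x - c * k\<^sup>2 * y" for x y c by (simp add: k_def power_divide)
  have "det M = k ^ 3 * triple n\<^sub>1 n\<^sub>2 n\<^sub>3 - k ^ 4 * (c\<^sub>1 * triple N n\<^sub>2 n\<^sub>3 + c\<^sub>2 * triple n\<^sub>1 N n\<^sub>3 + c\<^sub>3 * triple n\<^sub>1 n\<^sub>2 N)"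
    unfolding det_3 M eq triple_def by (simp add: power2_eq_square power3_eq_cube power4_eq_xxxx algebra_simps)
  also have "k ^ 3 = k ^ 4 * D" using D by (simp add: k_def power4_eq_xxxx power3_eq_cube)
  also have "k ^ 4 * D * triple n\<^sub>1 n\<^sub>2 n\<^sub>3 - k ^ 4 * (c\<^sub>1 * triple N n\<^sub>2 n\<^sub>3 + c\<^sub>2 * triple n\<^sub>1 N n\<^sub>3 + c\<^sub>3 * triple n\<^sub>1 n\<^sub>2 N) =
    k ^ 4 * (D * triple n\<^sub>1 n\<^sub>2 n\<^sub>3 - c\<^sub>1 * triple N n\<^sub>2 n\<^sub>3 - c\<^sub>2 * triple n\<^sub>1 N n\<^sub>3 - c\<^sub>3 * triple n\<^sub>1 n\<^sub>2 N)"
    by (simp add: algebra_simps)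
  finally show ?thesis by (simp add: k_def power_divide)
qed

lemma det_shape_gram:
  assumes "r + s + t = 1"
  shows "det (shape_gram (r, s, t)) = - shape_disc (r, s, t)"
proof -
  have r: "r = 1 - s - t" using assms by simp
  show ?thesis
    unfolding det_4 shape_gram_nth vector_4_nth shape_disc_def r prod.case
    by (simp add: algebra_simps power2_eq_square)
qed

text \<open>Up to sign the squared expression is the determinant of the matrix A whose rows (c_i,
  n_i) are time and space coordinates, and G = A J A^T with J = diag (1, -1, -1, -1).\<close>

lemma triple_sum_square:
  fixes c :: "4 \<Rightarrow> real" and n :: "4 \<Rightarrow> real^3"
  assumes "\<And>i j. c i * c j - n i \<bullet> n j = G $ i $ j"
  shows "(c 4 * triple (n 1) (n 2) (n 3) - c 1 * triple (n 4) (n 2) (n 3) - c 2 * triple (n 1) (n 4) (n 3)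
    - c 3 * triple (n 1) (n 2) (n 4))\<^sup>2 = - det G" (is "?\<Delta>\<^sup>2 = _")
proof -
  define A where "A = (\<chi> i. vector [c i, n i $ 1, n i $ 2, n i $ 3] :: real^4^4)"
  define A' where "A' = (\<chi> i. vector [c i, - n i $ 1, - n i $ 2, - n i $ 3] :: real^4^4)"
  have "G = A ** transpose A'"
    using assms by (simp add: vec_eq_iff matrix_matrix_mult_def transpose_def A_def A'_def sum_4 vector_4_nth
        inner_vec_def sum_3 flip: assms)
  then have "det G = det A * det A'" by (simp add: det_mul)
  also have "det A' = - det A" by (simp add: det_4 A_def A'_def vector_4_nth algebra_simps)
  also have "det A = - ?\<Delta>" by (simp add: det_4 A_def vector_4_nth triple_def algebra_simps)
  finally have "det G = - ?\<Delta> * - (- ?\<Delta>)" .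
  moreover have "x\<^sup>2 = - y" if "y = - x * - (- x)" for x y :: real
    using that by (simp add: power2_eq_square)
  ultimately show ?thesis by blast
qed

text \<open>The Gram matrix has eigenvectors (1, 1, 1, 1), (1, 1, -1, -1), (1, -1, 1, -1), (1, -1,
  -1, 1) with eigenvalues 1, 2 r - 1, 2 s - 1, 2 t - 1. Pairing the equations with these vectors
  gives the four relations.\<close>

lemma shape_gram_independent:
  fixes r s t :: real
  assumes half: "r < 1 / 2" "s < 1 / 2" "t < 1 / 2" and sum: "r + s + t = 1"
    and zero: "r * b + s * c + t * d = 0" "r * a + t * c + s * d = 0" "s * a + t * b + r * d = 0" "t * a + s * b + r * c = 0"
  shows "a = 0 \<and> b = 0 \<and> c = 0 \<and> d = 0"
proof -
  have r: "r = 1 - s - t" using sum by simp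
  have "a + b + c + d = 0" using zero unfolding r by (simp add: algebra_simps)
  moreover have "(1 - 2 * r) * (a + b - c - d) = 0" using zero unfolding r by (simp add: algebra_simps)
  moreover have "(1 - 2 * s) * (a - b + c - d) = 0" using zero unfolding r by (simp add: algebra_simps)
  moreover have "(1 - 2 * t) * (a - b - c + d) = 0" using zero unfolding r by (simp add: algebra_simps)
  ultimately show ?thesis using half by auto
qed

section \<open>Hyperbolic volume in the affine chart\<close>

context lorentz
begin

text \<open>On the unit sphere both sides are \<open>0\<close>, by division by zero.\<close>

lemma hyp_density:
  "sqrt (det (\<chi> i j. hyp_metric B (chart b e x) (b i) (b j))) = 1 / (1 - x \<bullet> x)\<^sup>2"
proof -
  define p where "p = chart b e x"
  define q where "q = 1 - x \<bullet> x"
  have pp: "B p p = q" by (simp add: p_def q_def B_chart)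
  have bp: "B (b i) p = - x $ i" "B p (b i) = - x $ i" for i
    by (simp_all add: p_def B_eq chart_eq_emb tc_simps sp_simps inner_axis inner_axis')
  have entry: "hyp_metric B p (b i) (b j) = ((if i = j then 1 else 0) + x $ i * x $ j / q) / q" for i j
  proof (cases "q = 0")
    case False
    then show ?thesis
      by (simp add: hyp_metric_def Let_def pp bp B_simps B_basis field_simps)
  qed (simp add: hyp_metric_def pp)
  show ?thesis
  proof (cases "q = 0")
    case True
    then show ?thesis by (simp add: entry[unfolded p_def] det_3 flip: q_def)
  next
    case False
    have xx: "x $ 1 * x $ 1 + x $ 2 * x $ 2 + x $ 3 * x $ 3 = 1 - q"
      by (simp add: q_def inner_vec_def sum_3)
    \<comment> \<open>The matrix is 1/q times the identity plus a matrix of rank one, whose trace is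
      |x|^2 / q.\<close>
    have "det (\<chi> i j. hyp_metric B p (b i) (b j)) =
        (1 + (x $ 1 * x $ 1 + x $ 2 * x $ 2 + x $ 3 * x $ 3) / q) / q ^ 3"
      unfolding det_3 entry using False by (simp add: entry field_simps power3_eq_cube)
    also have "\<dots> = 1 / q ^ 4" unfolding xx using False by (simp add: field_simps power4_eq_xxxx power3_eq_cube)
    also have "sqrt \<dots> = 1 / q\<^sup>2"
    proof -
      have "1 / q ^ 4 = (1 / q\<^sup>2)\<^sup>2" by (simp add: power_divide flip: power_mult)
      then show ?thesis by simp
    qed
    finally show ?thesis by (simp add: p_def q_def)
  qed
qed

definition hyp_measure :: "(real^3) measure" where
  "hyp_measure = density lborel (\<lambda>x. ennreal (1 / (1 - x \<bullet> x)\<^sup>2))"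

lemma tetrahedron_volume_eq:
  fixes v :: "4 \<Rightarrow> 'v"
  assumes "\<And>i j. B (v i) (v j) \<ge> 0" "\<And>i. v i \<noteq> 0" "\<And>i. P i = span {v i}"
  shows "tetrahedron_volume B b e P =
    measure hyp_measure {x. span {chart b e x} \<in> proj_cone v \<and> x \<bullet> x < 1}"
proof -
  have P: "P = (\<lambda>i. span {v i})" using assms(3) by auto
  show ?thesis
    unfolding tetrahedron_volume_def hyp_volume_def P geodesic_hull_eq[of v, OF assms(1,2)] hyp_density hyp_measure_def
    by (simp add: mem_hyp_points_iff chart_nonzero B_chart)
qed

lemma negligible_chart_hyperplane:
  assumes "n \<noteq> 0"
  shows "negligible {x. B n (chart b e x) = 0}"
proof -
  have "{x. B n (chart b e x) = 0} = {x. sp n \<bullet> x = tc n}"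
    by (auto simp: B_eq chart_eq_emb)
  moreover have "sp n \<noteq> 0 \<or> tc n \<noteq> 0" using assms coord_eqI[of n 0] by (auto simp: tc_simps sp_simps)
  ultimately show ?thesis using negligible_hyperplane[of "sp n" "tc n"] by simp
qed

lemma measure_hyp_measure_null:
  assumes "A \<subseteq> {x. B n (chart b e x) = 0}" "n \<noteq> 0"
  shows "measure hyp_measure A = 0"
proof (cases "A \<in> sets borel")
  case True
  have "negligible A" using assms negligible_chart_hyperplane negligible_subset by blast
  then have "A \<in> null_sets lborel"
    using True by (simp add: negligible_iff_null_sets null_sets_completion_iff)
  then have "AE x in lborel. x \<notin> A" by (rule AE_not_in)
  then have "emeasure hyp_measure A = 0"
    using True unfolding hyp_measure_def
    by (subst emeasure_density) (auto simp: nn_integral_0_iff_AE indicator_def)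
  then show ?thesis by (simp add: measure_def)
\<comment> \<open>Sets that are not measurable have \<open>measure\<close> 0 by convention.\<close>
qed (simp add: measure_notin_sets hyp_measure_def)

text \<open>The weights carry no normalisation of their own: \<open>chart\<close> has time
  coordinate 1, which forces the sum of y i * tc (v i) to be 1.\<close>

definition region :: "(4 \<Rightarrow> 'v) \<Rightarrow> (real^3) set" where
  "region v = {x. x \<bullet> x < 1 \<and> (\<exists>y. (\<forall>i. y i \<ge> 0) \<and> chart b e x = (\<Sum>i\<in>UNIV. y i *\<^sub>R v i))}"

lemma regionI:
  assumes "x \<bullet> x < 1" "\<And>i. y i \<ge> 0" "chart b e x = (\<Sum>i\<in>UNIV. y i *\<^sub>R v i)"
  shows "x \<in> region v"
  unfolding region_def by (intro CollectI conjI exI[of _ y] allI assms)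

lemma regionE:
  assumes "x \<in> region v"
  obtains y where "x \<bullet> x < 1" "\<forall>i. y i \<ge> 0" "chart b e x = (\<Sum>i\<in>UNIV. y i *\<^sub>R v i)"
  using assms unfolding region_def mem_Collect_eq by (elim conjE exE)

text \<open>Equality of lines gives a combination only up to a scalar. Positive time coordinates of
  all v i make this scalar positive, so dividing by it keeps the weights nonnegative.\<close>

lemma region_eq:
  assumes "\<And>i. tc (v i) > 0"
  shows "{x. span {chart b e x} \<in> proj_cone v \<and> x \<bullet> x < 1} = region v"
proof (intro equalityI subsetI)
  fix x assume "x \<in> {x. span {chart b e x} \<in> proj_cone v \<and> x \<bullet> x < 1}"
  then have "span {chart b e x} \<in> proj_cone v" and x: "x \<bullet> x < 1" by auto
  then obtain p y where "\<forall>i. y i \<ge> 0" "p = (\<Sum>i\<in>UNIV. y i *\<^sub>R v i)" "span {chart b e x} = span {p}"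
    unfolding proj_cone_def by blast
  then have y: "\<And>i. y i \<ge> 0" and eq: "span {chart b e x} = span {\<Sum>i\<in>UNIV. y i *\<^sub>R v i}"
    by auto
  obtain c where c: "c \<noteq> 0" "(\<Sum>i\<in>UNIV. y i *\<^sub>R v i) = c *\<^sub>R chart b e x"
    using eq span_singleton_eq_iff[OF chart_nonzero] by blast
  have "c = tc (c *\<^sub>R chart b e x)" by (simp add: tc_simps chart_eq_emb)
  also have "\<dots> = (\<Sum>i\<in>UNIV. y i * tc (v i))" unfolding c(2)[symmetric] by (simp add: tc_simps)
  also have "\<dots> \<ge> 0" using y assms by (intro sum_nonneg mult_nonneg_nonneg) (auto simp: less_imp_le)
  finally have "c > 0" using c by simp
  have "chart b e x = (1 / c) *\<^sub>R (\<Sum>i\<in>UNIV. y i *\<^sub>R v i)" using c by simp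
  also have "\<dots> = (\<Sum>i\<in>UNIV. (y i / c) *\<^sub>R v i)" by (simp add: scaleR_sum_right)
  finally have "chart b e x = (\<Sum>i\<in>UNIV. (y i / c) *\<^sub>R v i)" .
  then show "x \<in> region v" by (rule regionI[OF x, rotated]) (use y \<open>c > 0\<close> in simp)
next
  fix x assume "x \<in> region v"
  then obtain y where "x \<bullet> x < 1" "\<forall>i. y i \<ge> 0" "chart b e x = (\<Sum>i\<in>UNIV. y i *\<^sub>R v i)"
    by (rule regionE)
  then show "x \<in> {x. span {chart b e x} \<in> proj_cone v \<and> x \<bullet> x < 1}"
    using proj_coneI[of y v] chart_nonzero[of x] by simp
qed

text \<open>Positive time coordinates make the set of normalised weights compact; the region is the
  part of its continuous image inside the open unit ball.\<close>

lemma region_borel: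
  assumes pos: "\<And>i. tc (v i) > 0"
  shows "region v \<in> sets borel"
proof -
  define K where "K = cbox 0 (\<chi> i. 1 / tc (v i)) \<inter> {y :: real^4. (\<Sum>i\<in>UNIV. y $ i * tc (v i)) = 1}"
  define f where "f = (\<lambda>y :: real^4. \<Sum>i\<in>UNIV. y $ i *\<^sub>R sp (v i))"
  have K_iff: "y \<in> K \<longleftrightarrow> (\<forall>i. y $ i \<ge> 0) \<and> (\<Sum>i\<in>UNIV. y $ i * tc (v i)) = 1" for y
  proof
    assume "(\<forall>i. y $ i \<ge> 0) \<and> (\<Sum>i\<in>UNIV. y $ i * tc (v i)) = 1"
    then have y: "\<And>i. y $ i \<ge> 0" "(\<Sum>i\<in>UNIV. y $ i * tc (v i)) = 1" by auto
    have "y $ i \<le> 1 / tc (v i)" for i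
    proof -
      have "y $ i * tc (v i) \<le> (\<Sum>i\<in>UNIV. y $ i * tc (v i))"
        using y pos by (intro member_le_sum) (auto simp: less_imp_le)
      then show ?thesis using y pos[of i] by (simp add: field_simps)
    qed
    then show "y \<in> K" using y by (auto simp: K_def mem_box_cart)
  qed (auto simp: K_def mem_box_cart)
  have "compact K" unfolding K_def
    by (intro compact_Int_closed compact_cbox closed_Collect_eq continuous_intros)
  then have "compact (f ` K)" unfolding f_def by (intro compact_continuous_image continuous_intros)
  then have "f ` K \<in> sets borel" by (intro borel_closed compact_imp_closed)
  moreover have "region v = {x. x \<bullet> x < 1} \<inter> f ` K"
  proof (intro equalityI subsetI)
    fix x assume "x \<in> region v"
    then obtain y where y: "x \<bullet> x < 1" "\<forall>i. y i \<ge> 0" "chart b e x = (\<Sum>i\<in>UNIV. y i *\<^sub>R v i)"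
      by (rule regionE)
    have "tc (chart b e x) = (\<Sum>i\<in>UNIV. y i * tc (v i))" "sp (chart b e x) = (\<Sum>i\<in>UNIV. y i *\<^sub>R sp (v i))"
      unfolding y(3) by (simp_all add: tc_simps sp_simps)
    then have "(\<chi> i. y i) \<in> K" "x = f (\<chi> i. y i)" using y by (simp_all add: chart_eq_emb K_iff f_def)
    then show "x \<in> {x. x \<bullet> x < 1} \<inter> f ` K" using y by blast
  next
    fix x assume "x \<in> {x. x \<bullet> x < 1} \<inter> f ` K"
    then obtain y where y: "x \<bullet> x < 1" "y \<in> K" "x = f y" by blast
    have "chart b e x = (\<Sum>i\<in>UNIV. (y $ i) *\<^sub>R v i)"
      using y by (intro coord_eqI) (simp_all add: tc_simps sp_simps chart_eq_emb f_def K_iff)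
    then show "x \<in> region v" by (rule regionI[OF y(1), rotated]) (use y(2) in \<open>simp add: K_iff\<close>)
  qed
  moreover have "{x :: real^3. x \<bullet> x < 1} \<in> sets borel" by measurable
  ultimately show ?thesis by simp
qed

text \<open>The weight of v 4 is normalised to 1, which parametrises the region by the octant
  \<open>U\<close> up to null sets. The Jacobian \<rho> / D^4 and the pulled-back density D^4 / (4
  Q^2) combine to \<rho> / (4 Q^2), in which the chart no longer appears: this is the integrand of
  \<open>nn_integral_inverse_gram_square\<close>.\<close>

lemma measure_region:
  fixes v :: "4 \<Rightarrow> 'v" and r s t :: real
  assumes gram: "\<And>i j. B (v i) (v j) = shape_gram (r, s, t) $ i $ j"
    and sum: "r + s + t = 1" and half: "r < 1 / 2" "s < 1 / 2" "t < 1 / 2" and "s \<le> r"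
    and pos: "\<And>i. tc (v i) > 0"
  shows "measure hyp_measure (region v) = lob_volume (r, s, t)"
proof -
  define \<rho> where "\<rho> = sqrt (shape_disc (r, s, t))"
  have disc: "shape_disc (r, s, t) > 0" using half by (simp add: shape_disc_def)
  then have \<rho>: "\<rho> > 0" "\<rho>\<^sup>2 = shape_disc (r, s, t)" by (simp_all add: \<rho>_def)
  have rst: "r > 0" "s > 0" "t > 0" using sum half by auto

  have G: "B (v 1) (v 1) = 0" "B (v 1) (v 2) = r" "B (v 1) (v 3) = s" "B (v 1) (v 4) = t"
    "B (v 2) (v 1) = r" "B (v 2) (v 2) = 0" "B (v 2) (v 3) = t" "B (v 2) (v 4) = s"
    "B (v 3) (v 1) = s" "B (v 3) (v 2) = t" "B (v 3) (v 3) = 0" "B (v 3) (v 4) = r"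
    "B (v 4) (v 1) = t" "B (v 4) (v 2) = s" "B (v 4) (v 3) = r" "B (v 4) (v 4) = 0"
    unfolding gram shape_gram_nth vector_4_nth by (rule refl)+
  have independent: "a = 0 \<and> b' = 0 \<and> c = 0 \<and> d = 0"
    if zero: "a *\<^sub>R v 1 + b' *\<^sub>R v 2 + c *\<^sub>R v 3 + d *\<^sub>R v 4 = 0" for a b' c d
  proof -
    have "B (v i) (a *\<^sub>R v 1 + b' *\<^sub>R v 2 + c *\<^sub>R v 3 + d *\<^sub>R v 4) = 0" for i
      unfolding zero by (simp add: B_zero)
    from this[of 1] this[of 2] this[of 3] this[of 4] show ?thesis
      by (intro shape_gram_independent[OF half sum]) (simp_all add: B_simps G ac_simps)
  qed
  define p where "p = (\<lambda>y :: real^3. y $ 1 *\<^sub>R v 1 + y $ 2 *\<^sub>R v 2 + y $ 3 *\<^sub>R v 3 + v 4)"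
  define D where "D = (\<lambda>y. tc (p y))"
  define N where "N = (\<lambda>y. sp (p y))"
  define Q where "Q = (\<lambda>y :: real^3. r * (y $ 1 * y $ 2 + y $ 3) + s * (y $ 1 * y $ 3 + y $ 2) + t * (y $ 1 + y $ 2 * y $ 3))"
  define \<phi> where "\<phi> = (\<lambda>y. inverse (D y) *\<^sub>R N y)"
  define U where "U = {y :: real^3. \<forall>i. 0 \<le> y $ i}"
  define f where "f = (\<lambda>x :: real^3. 1 / (1 - x \<bullet> x)\<^sup>2)"
  have D_eq: "D y = y $ 1 * tc (v 1) + y $ 2 * tc (v 2) + y $ 3 * tc (v 3) + tc (v 4)" for y
    by (simp add: D_def p_def tc_simps)
  have N_eq: "N y = y $ 1 *\<^sub>R sp (v 1) + y $ 2 *\<^sub>R sp (v 2) + y $ 3 *\<^sub>R sp (v 3) + sp (v 4)" for y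
    by (simp add: N_def p_def sp_simps)
  have Bp: "B (p y) (p y) = 2 * Q y" for y
    unfolding p_def Q_def B_simps G by (simp add: algebra_simps)
  have NN: "N y \<bullet> N y = (D y)\<^sup>2 - 2 * Q y" for y
    using Bp[of y] by (simp add: B_eq D_def N_def power2_eq_square)
  have D_pos: "D y > 0" if "y \<in> U" for y
    unfolding D_eq using that pos by (intro add_nonneg_pos add_nonneg_nonneg mult_nonneg_nonneg) (auto simp: U_def less_imp_le)
  have Q_nonneg: "Q y \<ge> 0" if "y \<in> U" for y
    unfolding Q_def using that rst by (intro add_nonneg_nonneg mult_nonneg_nonneg) (auto simp: U_def)
  have one_minus: "1 - \<phi> y \<bullet> \<phi> y = 2 * Q y / (D y)\<^sup>2" if "y \<in> U" for y
    using D_pos[OF that] unfolding \<phi>_def by (simp add: NN field_simps power2_eq_square)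
  have chart_\<phi>: "chart b e (\<phi> y) = inverse (D y) *\<^sub>R p y" if "y \<in> U" for y
    using D_pos[OF that] by (intro coord_eqI) (simp_all add: chart_eq_emb tc_simps sp_simps \<phi>_def D_def N_def)
  define dN where "dN = (\<lambda>h :: real^3. h $ 1 *\<^sub>R sp (v 1) + h $ 2 *\<^sub>R sp (v 2) + h $ 3 *\<^sub>R sp (v 3))"
  define dD where "dD = (\<lambda>h :: real^3. h $ 1 * tc (v 1) + h $ 2 * tc (v 2) + h $ 3 * tc (v 3))"
  define \<phi>' where "\<phi>' = (\<lambda>y h. inverse (D y) *\<^sub>R dN h - (dD h / (D y)\<^sup>2) *\<^sub>R N y)"
  have der: "(\<phi> has_derivative \<phi>' y) (at y within U)" if "y \<in> U" for y
  proof -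
    have "(N has_derivative dN) (at y within U)"
      unfolding N_eq[abs_def] dN_def
      by (auto intro!: derivative_eq_intros vec_has_derivative_nth)
    moreover have "(D has_derivative dD) (at y within U)"
      unfolding D_eq[abs_def] dD_def
      by (auto intro!: derivative_eq_intros vec_has_derivative_nth)
    ultimately show ?thesis
      unfolding \<phi>_def \<phi>'_def using D_pos[OF that]
      by (auto intro!: derivative_eq_intros simp: fun_eq_iff power2_eq_square divide_inverse algebra_simps)
  qed
  have inj: "inj_on \<phi> U"
  proof (rule inj_onI)
    fix y z assume yz: "y \<in> U" "z \<in> U" "\<phi> y = \<phi> z"
    define c where "c = inverse (D y)"
    define d where "d = inverse (D z)"
    have "c *\<^sub>R p y - d *\<^sub>R p z = 0" using chart_\<phi>[OF yz(1)] chart_\<phi>[OF yz(2)] yz(3) by (simp add: c_def d_def)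
    then have "(c * y $ 1 - d * z $ 1) *\<^sub>R v 1 + (c * y $ 2 - d * z $ 2) *\<^sub>R v 2 + (c * y $ 3 - d * z $ 3) *\<^sub>R v 3 + (c - d) *\<^sub>R v 4 = 0"
      by (simp add: p_def algebra_simps)
    then have *: "c * y $ 1 - d * z $ 1 = 0 \<and> c * y $ 2 - d * z $ 2 = 0 \<and> c * y $ 3 - d * z $ 3 = 0 \<and> c - d = 0"
      by (rule independent)
    have c: "c \<noteq> 0" using D_pos[OF yz(1)] by (simp add: c_def)
    have d: "d = c" using * by simp
    show "y = z" using * c unfolding d by (simp add: vec_eq_iff forall_3)
  qed
  have jac: "\<bar>det (matrix (\<phi>' y))\<bar> = \<rho> / (D y) ^ 4" if "y \<in> U" for y
  proof -
    define \<Delta> where "\<Delta> = tc (v 4) * triple (sp (v 1)) (sp (v 2)) (sp (v 3)) - tc (v 1) * triple (sp (v 4)) (sp (v 2)) (sp (v 3))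
      - tc (v 2) * triple (sp (v 1)) (sp (v 4)) (sp (v 3)) - tc (v 3) * triple (sp (v 1)) (sp (v 2)) (sp (v 4))"
    have entry: "matrix (\<phi>' y) $ k $ 1 = sp (v 1) $ k / D y - tc (v 1) * N y $ k / (D y)\<^sup>2"
      "matrix (\<phi>' y) $ k $ 2 = sp (v 2) $ k / D y - tc (v 2) * N y $ k / (D y)\<^sup>2"
      "matrix (\<phi>' y) $ k $ 3 = sp (v 3) $ k / D y - tc (v 3) * N y $ k / (D y)\<^sup>2" for k
      by (simp_all add: matrix_def \<phi>'_def dN_def dD_def axis_def divide_inverse mult.commute)
    have "det (matrix (\<phi>' y)) = (D y * triple (sp (v 1)) (sp (v 2)) (sp (v 3)) - tc (v 1) * triple (N y) (sp (v 2)) (sp (v 3))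
      - tc (v 2) * triple (sp (v 1)) (N y) (sp (v 3)) - tc (v 3) * triple (sp (v 1)) (sp (v 2)) (N y)) / (D y) ^ 4"
      using D_pos[OF that] by (intro det_projective_jacobian entry) auto
    \<comment> \<open>D and N are affine in y; by multilinearity all terms containing y cancel,
      leaving minus the determinant of the coordinates of the four vertices.\<close>
    also have "D y * triple (sp (v 1)) (sp (v 2)) (sp (v 3)) - tc (v 1) * triple (N y) (sp (v 2)) (sp (v 3))
      - tc (v 2) * triple (sp (v 1)) (N y) (sp (v 3)) - tc (v 3) * triple (sp (v 1)) (sp (v 2)) (N y) = \<Delta>"
      unfolding D_eq N_eq triple_def \<Delta>_def by (simp add: algebra_simps)
    finally have "\<bar>det (matrix (\<phi>' y))\<bar> = \<bar>\<Delta>\<bar> / (D y) ^ 4" using D_pos[OF that] by (simp add: abs_divide)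
    moreover have "\<Delta>\<^sup>2 = - det (shape_gram (r, s, t))"
      unfolding \<Delta>_def by (rule triple_sum_square) (simp only: gram[symmetric] B_eq[symmetric])
    then have "\<Delta>\<^sup>2 = \<rho>\<^sup>2" using det_shape_gram[of r s t] sum \<rho> by simp
    then have "\<bar>\<Delta>\<bar> = \<rho>" using \<rho>(1) by (auto simp: power2_eq_iff)
    ultimately show ?thesis by simp
  qed
  have pullback: "\<bar>det (matrix (\<phi>' y))\<bar> * f (\<phi> y) = \<rho> / 4 * (1 / (Q y)\<^sup>2)" if "y \<in> U" for y
    unfolding jac[OF that] f_def one_minus[OF that] using D_pos[OF that]
    by (simp add: power_divide power_mult_distrib power2_eq_square power4_eq_xxxx)
  define g where "g = (\<lambda>y. \<rho> / 4 * (1 / (Q y)\<^sup>2) * indicator U y)"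
  have U_borel [measurable]: "U \<in> sets borel" unfolding U_def forall_3 by measurable
  have g_borel [measurable]: "g \<in> borel_measurable borel" unfolding g_def Q_def by measurable
  have "(\<integral>\<^sup>+y. g y \<partial>lborel) = (\<integral>\<^sup>+a. \<integral>\<^sup>+b. \<integral>\<^sup>+c. ennreal (g (vector [a, b, c])) \<partial>lborel \<partial>lborel \<partial>lborel)"
    by (rule nn_integral_real3) measurable
  also have "\<dots> = (\<integral>\<^sup>+a. \<integral>\<^sup>+b. \<integral>\<^sup>+c. ennreal (\<rho> / 4) * (ennreal (1 / (r * (a * b + c) + s * (a * c + b) + t * (a + b * c))\<^sup>2) *
      indicator {0..} c * indicator {0..} b * indicator {0..} a) \<partial>lborel \<partial>lborel \<partial>lborel)"
  proof (intro nn_integral_cong)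
    fix a b c :: real
    show "ennreal (g (vector [a, b, c])) = ennreal (\<rho> / 4) * (ennreal (1 / (r * (a * b + c) + s * (a * c + b) + t * (a + b * c))\<^sup>2) *
      indicator {0..} c * indicator {0..} b * indicator {0..} a)"
    proof (cases "a \<ge> 0 \<and> b \<ge> 0 \<and> c \<ge> 0")
      case True
      then show ?thesis using \<rho>(1) by (simp add: g_def Q_def U_def forall_3 flip: ennreal_mult')
    next
      case False
      then have "vector [a, b, c] \<notin> U" by (auto simp: U_def forall_3)
      then show ?thesis using False by (auto simp: g_def indicator_def)
    qed
  qed
  also have "\<dots> = ennreal (\<rho> / 4) * (\<integral>\<^sup>+a. \<integral>\<^sup>+b. \<integral>\<^sup>+c. ennreal (1 / (r * (a * b + c) + s * (a * c + b) + t * (a + b * c))\<^sup>2) *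
      indicator {0..} c * indicator {0..} b * indicator {0..} a \<partial>lborel \<partial>lborel \<partial>lborel)"
    by (simp add: nn_integral_cmult)
  also have "\<dots> = ennreal (\<rho> / 4) * ennreal (4 / \<rho> * lob_volume (r, s, t))"
    unfolding \<rho>_def using nn_integral_inverse_gram_square[OF sum half \<open>s \<le> r\<close>] by simp
  also have "\<dots> = ennreal (lob_volume (r, s, t))"
    using \<rho>(1) by (simp flip: ennreal_mult')
  finally have int_g: "(\<integral>\<^sup>+y. g y \<partial>lborel) = ennreal (lob_volume (r, s, t))" .
  have vol_pos: "lob_volume (r, s, t) > 0" by (rule lob_volume_pos[OF sum half \<open>s \<le> r\<close>])
  have "(g has_integral lob_volume (r, s, t)) UNIV"
    by (rule nn_integral_has_integral[OF g_borel _ int_g]) (use \<rho>(1) vol_pos in \<open>auto simp: g_def\<close>)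
  moreover have "g = (\<lambda>y. if y \<in> U then \<rho> / 4 * (1 / (Q y)\<^sup>2) else 0)" by (auto simp: g_def)
  ultimately have "((\<lambda>y. \<rho> / 4 * (1 / (Q y)\<^sup>2)) has_integral lob_volume (r, s, t)) U"
    by (simp add: has_integral_restrict_UNIV)
  then have int_U: "((\<lambda>y. \<bar>det (matrix (\<phi>' y))\<bar> * f (\<phi> y)) has_integral lob_volume (r, s, t)) U"
    by (rule has_integral_eq[rotated]) (simp add: pullback)
  then have "(\<lambda>y. \<bar>det (matrix (\<phi>' y))\<bar> * f (\<phi> y)) absolutely_integrable_on U"
    by (intro nonnegative_absolutely_integrable_1) (auto simp: f_def)
  \<comment> \<open>Change of variables is stated for integrands with values in
    \<open>real^'n\<close>, so f is carried to \<open>real^1\<close> and back.\<close>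
  have lin: "bounded_linear (vec :: real \<Rightarrow> real^1)"
    by (simp add: linear_conv_bounded_linear[symmetric] linear_vec)
  have "(\<lambda>y. \<bar>det (matrix (\<phi>' y))\<bar> *\<^sub>R (vec (f (\<phi> y)) :: real^1)) absolutely_integrable_on U \<and>
      integral U (\<lambda>y. \<bar>det (matrix (\<phi>' y))\<bar> *\<^sub>R (vec (f (\<phi> y)) :: real^1)) = vec (lob_volume (r, s, t))"
  proof -
    have eq: "(\<lambda>y. \<bar>det (matrix (\<phi>' y))\<bar> *\<^sub>R (vec (f (\<phi> y)) :: real^1)) = vec \<circ> (\<lambda>y. \<bar>det (matrix (\<phi>' y))\<bar> * f (\<phi> y))"
      by (auto simp: vec_eq_iff)
    show ?thesis
      unfolding eq
      using absolutely_integrable_linear[OF \<open>_ absolutely_integrable_on U\<close> lin]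
        has_integral_linear[OF int_U lin] by (auto intro: integral_unique)
  qed
  then have "(\<lambda>x. vec (f x) :: real^1) absolutely_integrable_on (\<phi> ` U) \<and>
      integral (\<phi> ` U) (\<lambda>x. vec (f x) :: real^1) = vec (lob_volume (r, s, t))"
    by (subst (asm) has_absolute_integral_change_of_variables[OF _ der inj]) auto
  then have "((\<lambda>x. vec (f x) :: real^1) has_integral vec (lob_volume (r, s, t))) (\<phi> ` U)"
    by (metis absolutely_integrable_on_def integrable_integral)
  from has_integral_linear[OF this bounded_linear_vec_nth[of 1]]
  have int_image: "(f has_integral lob_volume (r, s, t)) (\<phi> ` U)" by (simp add: o_def)
  obtain n where n: "n \<noteq> 0" "\<And>i. B n (v (if i = (1 :: 3) then 1 else if i = 2 then 2 else 3)) = 0"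
    using exists_orthogonal3[of "\<lambda>i. v (if i = (1 :: 3) then 1 else if i = 2 then 2 else 3)"] by blast
  have n': "B n (v 1) = 0" "B n (v 2) = 0" "B n (v 3) = 0" using n(2)[of 1] n(2)[of 2] n(2)[of 3] by auto
  text \<open>\<open>\<phi> ` U\<close> and \<open>region v\<close> differ by ideal points, where \<open>f\<close> vanishes by division by zero, and by
    the face opposite to \<open>v 4\<close>, which is null.\<close>
  have "{x \<in> \<phi> ` U - region v. f x \<noteq> 0} = {}"
  proof -
    have "\<phi> y \<in> region v" if "y \<in> U" "f (\<phi> y) \<noteq> 0" for y
    proof (rule regionI)
      have "2 * Q y / (D y)\<^sup>2 \<noteq> 0" using that by (auto simp: f_def one_minus)
      moreover have "2 * Q y / (D y)\<^sup>2 \<ge> 0" using Q_nonneg[OF that(1)] by simp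
      ultimately show "\<phi> y \<bullet> \<phi> y < 1" using one_minus[OF that(1)] by linarith
      define w where "w = (\<lambda>i :: 4. inverse (D y) * (if i = 1 then y $ 1 else if i = 2 then y $ 2 else if i = 3 then y $ 3 else 1))"
      show "w i \<ge> 0" for i using that(1) D_pos[OF that(1)] by (simp add: w_def U_def)
      show "chart b e (\<phi> y) = (\<Sum>i\<in>UNIV. w i *\<^sub>R v i)"
        unfolding chart_\<phi>[OF that(1)] by (simp add: sum_4 w_def p_def scaleR_add_right)
    qed
    then show ?thesis by blast
  qed
  then have neg1: "negligible {x \<in> \<phi> ` U - region v. f x \<noteq> 0}" by (simp only: negligible_empty)
  have "{x \<in> region v - \<phi> ` U. f x \<noteq> 0} \<subseteq> {x. B n (chart b e x) = 0}"
  proof safe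
    fix x assume x: "x \<in> region v" "x \<notin> \<phi> ` U"
    from x(1) obtain w where "x \<bullet> x < 1" and w: "\<forall>i. w i \<ge> 0" "chart b e x = (\<Sum>i\<in>UNIV. w i *\<^sub>R v i)"
      by (rule regionE)
    have "w 4 = 0"
    proof (rule ccontr)
      assume "w 4 \<noteq> 0"
      then have w4: "w 4 > 0" using w(1) by (simp add: less_le)
      define y where "y = (vector [w 1 / w 4, w 2 / w 4, w 3 / w 4] :: real^3)"
      have y: "y \<in> U" using w(1) w4 by (simp add: U_def y_def forall_3)
      have eq: "chart b e x = w 4 *\<^sub>R p y"
        unfolding w(2) using w4 by (simp add: sum_4 p_def y_def scaleR_add_right)
      have "1 = w 4 * D y" using arg_cong[OF eq, of tc] by (simp add: tc_simps chart_eq_emb D_def)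
      then have "w 4 = inverse (D y)" using D_pos[OF y] by (simp add: field_simps)
      then have "x = \<phi> y" using arg_cong[OF eq, of sp] by (simp add: sp_simps chart_eq_emb \<phi>_def N_def)
      then show False using x y by blast
    qed
    then show "B n (chart b e x) = 0" unfolding w(2) by (simp add: B_simps sum_4 n')
  qed
  then have neg2: "negligible {x \<in> region v - \<phi> ` U. f x \<noteq> 0}"
    using negligible_chart_hyperplane[OF n(1)] negligible_subset by blast
  have "(f has_integral lob_volume (r, s, t)) (region v)"
    using int_image has_integral_spike_set_eq[OF neg1 neg2] by blast
  then have "(\<integral>\<^sup>+x. ennreal (indicator (region v) x * f x) \<partial>lborel) = ennreal (lob_volume (r, s, t))"
    by (intro nn_integral_has_integral_lebesgue) (auto simp: f_def)
  moreover have "ennreal (indicator (region v) x * f x) = ennreal (f x) * indicator (region v) x" for x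
    by (auto simp: indicator_def)
  moreover have "emeasure hyp_measure (region v) = (\<integral>\<^sup>+x. ennreal (f x) * indicator (region v) x \<partial>lborel)"
    unfolding hyp_measure_def f_def using region_borel[of v, OF pos] by (intro emeasure_density) auto
  ultimately have "emeasure hyp_measure (region v) = ennreal (lob_volume (r, s, t))" by simp
  then show ?thesis using vol_pos by (simp add: measure_def)
qed

end

section \<open>Degenerate tetrahedra and the volume function\<close>

lemma shapes_iff:
  "(r, s, t) \<in> shapes \<longleftrightarrow> r + s + t = 1 \<and> r \<le> 1 / 2 \<and> s \<le> 1 / 2 \<and> t \<le> 1 / 2"
  by (auto simp: shapes_def)

lemma shape_disc_nonneg: "T \<in> shapes \<Longrightarrow> shape_disc T \<ge> 0"
  by (cases T) (auto simp: shapes_iff shape_disc_def)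

lemma det_per_eq:
  assumes "T \<in> shapes"
  shows "det_per T = (- shape_disc T, sumsq T)"
proof -
  obtain r s t where T: "T = (r, s, t)" by (cases T)
  have "det (shape_gram T) = - shape_disc T"
    using assms det_shape_gram[of r s t] by (simp add: T shapes_iff del: shape_gram.simps)
  moreover have "sqrt (permanent (shape_gram T)) = sumsq T"
    by (simp add: T permanent_shape_gram sumsq_def del: shape_gram.simps)
  ultimately show ?thesis by (simp add: det_per_def)
qed

lemma doubly_stochastic_shape_gram:
  assumes "T \<in> shapes"
  shows "doubly_stochastic (shape_gram T)"
proof -
  obtain r s t where T: "T = (r, s, t)" by (cases T)
  have "r \<ge> 0" "s \<ge> 0" "t \<ge> 0" "r + s + t = 1" using assms by (auto simp: T shapes_iff)
  then show ?thesis
    unfolding T doubly_stochastic_def forall_4 sum_4 shape_gram_nth vector_4_nth by auto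
qed

context lorentz
begin

lemma has_shape_iff:
  "has_shape B P T \<longleftrightarrow> T \<in> shapes \<and>
    (\<exists>v. (\<forall>i. v i \<noteq> 0 \<and> P i = span {v i}) \<and> (\<forall>i j. B (v i) (v j) = shape_gram T $ i $ j))"
proof -
  have diag: "shape_gram T $ i $ i = 0" for i
  proof -
    obtain r s t where T: "T = (r, s, t)" by (cases T)
    have "\<forall>i. shape_gram T $ i $ i = 0" unfolding T forall_4 shape_gram_nth vector_4_nth by simp
    then show ?thesis ..
  qed
  have "is_gram_matrix B P (shape_gram T) \<longleftrightarrow>
      (\<exists>v. (\<forall>i. v i \<noteq> 0 \<and> P i = span {v i}) \<and> (\<forall>i j. B (v i) (v j) = shape_gram T $ i $ j))"
    unfolding is_gram_matrix_def vec_eq_iff by (intro ex_cong1 conj_cong refl) auto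
  moreover have "ideal_tetrahedron B P" if "\<forall>i. v i \<noteq> 0 \<and> P i = span {v i}" "\<forall>i j. B (v i) (v j) = shape_gram T $ i $ j" for v
    unfolding ideal_tetrahedron_def using that diag by (simp add: mem_ideal_points_iff)
  ultimately show ?thesis unfolding has_shape_def using doubly_stochastic_shape_gram[of T] by blast
qed

text \<open>Opposite edges have equal Gram entries, so transposing vertices 2 and 3 exchanges r and
  s and keeps t, and transposing 2 and 4 exchanges r and t. Volume and degeneracy depend only on the
  set of vertices, hence the form with \<open>range\<close>.\<close>

lemma has_shape_relabel:
  assumes "has_shape B P (r, s, t)"
  shows "\<exists>P'. range P' = range P \<and> has_shape B P' (s, r, t)"
    and "\<exists>P'. range P' = range P \<and> has_shape B P' (t, s, r)"
proof -
  obtain v where T: "(r, s, t) \<in> shapes" and v: "\<And>i. v i \<noteq> 0" "\<And>i. P i = span {v i}"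
    "\<And>i j. B (v i) (v j) = shape_gram (r, s, t) $ i $ j"
    using assms unfolding has_shape_iff by blast
  have *: "\<exists>P'. range P' = range P \<and> has_shape B P' T'"
    if "surj \<pi>" "T' \<in> shapes" "\<forall>i j. shape_gram (r, s, t) $ \<pi> i $ \<pi> j = shape_gram T' $ i $ j" for \<pi> T'
  proof (intro exI[of _ "P \<circ> \<pi>"] conjI)
    show "range (P \<circ> \<pi>) = range P" by (simp only: image_comp[symmetric] that(1))
    show "has_shape B (P \<circ> \<pi>) T'"
      unfolding has_shape_iff using that v by (intro conjI exI[of _ "v \<circ> \<pi>"]) auto
  qed
  show "\<exists>P'. range P' = range P \<and> has_shape B P' (s, r, t)"
  proof (rule *)
    let ?\<pi> = "\<lambda>i :: 4. if i = 2 then 3 else if i = 3 then 2 else i"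
    show "surj ?\<pi>" by (rule surjI[of _ ?\<pi>]) simp
    show "(s, r, t) \<in> shapes" using T by (auto simp: shapes_iff)
    show "\<forall>i j. shape_gram (r, s, t) $ ?\<pi> i $ ?\<pi> j = shape_gram (s, r, t) $ i $ j"
      unfolding forall_4 by (simp add: shape_gram_nth vector_4_nth del: shape_gram.simps)
  qed
  show "\<exists>P'. range P' = range P \<and> has_shape B P' (t, s, r)"
  proof (rule *)
    let ?\<pi> = "\<lambda>i :: 4. if i = 2 then 4 else if i = 4 then 2 else i"
    show "surj ?\<pi>" by (rule surjI[of _ ?\<pi>]) simp
    show "(t, s, r) \<in> shapes" using T by (auto simp: shapes_iff)
    show "\<forall>i j. shape_gram (r, s, t) $ ?\<pi> i $ ?\<pi> j = shape_gram (t, s, r) $ i $ j"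
      unfolding forall_4 by (simp add: shape_gram_nth vector_4_nth del: shape_gram.simps)
  qed
qed

lemma has_shape_exists:
  assumes "T \<in> shapes"
  shows "\<exists>P. has_shape B P T"
proof -
  obtain r s t where T: "T = (r, s, t)" by (cases T)
  text \<open>Four alternate vertices of a box inscribed in the unit sphere.\<close>
  define x where "x = sqrt (1 - 2 * r)"
  define y where "y = sqrt (1 - 2 * s)"
  define z where "z = sqrt (1 - 2 * t)"
  have sq: "x * x = 1 - 2 * r" "y * y = 1 - 2 * s" "z * z = 1 - 2 * t"
    using assms by (simp_all add: T shapes_iff x_def y_def z_def)
  have sum: "t = 1 - r - s" using assms by (simp add: T shapes_iff)
  define u where "u = (vector [vector [x, y, z], vector [x, - y, - z], vector [- x, y, - z], vector [- x, - y, z]] :: real^3^4)"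
  \<comment> \<open>The vectors \<open>u $ i\<close> have norm 1. The factor 1/2 gives B (v i) (v j)
    = (1 - u_i . u_j) / 4, and for instance u_1 . u_2 = 1 - 4 r.\<close>
  define v where "v = (\<lambda>i. emb (1 / 2) ((1 / 2) *\<^sub>R (u $ i)))"
  have "v i \<noteq> 0" for i
  proof
    assume "v i = 0"
    then have "tc (v i) = 0" by (simp add: tc_simps)
    then show False by (simp add: v_def)
  qed
  moreover have "\<forall>i j. B (v i) (v j) = shape_gram T $ i $ j"
    unfolding B_eq T forall_4 shape_gram_nth vector_4_nth v_def tc_emb sp_emb u_def inner_vec_def sum_3
    by (simp add: sq sum) (simp add: field_simps)
  ultimately have "has_shape B (\<lambda>i. span {v i}) T"
    unfolding has_shape_iff using assms by (intro conjI exI[of _ v]) simp_all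
  then show ?thesis by blast
qed

lemma tetrahedron_volume_aux:
  assumes shape: "has_shape B P (r, s, t)" and disc: "shape_disc (r, s, t) > 0" and "s \<le> r"
  shows "tetrahedron_volume B b e P = lob_volume (r, s, t)"
proof -
  obtain v where T: "(r, s, t) \<in> shapes" and v: "\<And>i. v i \<noteq> 0" "\<And>i. P i = span {v i}"
    "\<And>i j. B (v i) (v j) = shape_gram (r, s, t) $ i $ j"
    using shape unfolding has_shape_iff by blast
  have sum: "r + s + t = 1" using T by (simp add: shapes_iff)
  have half: "r < 1 / 2" "s < 1 / 2" "t < 1 / 2"
    using shape_disc_pos_half[OF sum _ _ _ disc] T by (auto simp: shapes_iff)
  then have rst: "r > 0" "s > 0" "t > 0" using sum by auto
  \<comment> \<open>A common sign leaves the Gram matrix unchanged. This one moves v 1 into the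
    future half of the light cone, and the positive products with v 1 bring the other vertices
    along.\<close>
  define k where "k = (if tc (v 1) > 0 then 1 else - 1 :: real)"
  have k: "k * k = 1" "k \<noteq> 0" by (auto simp: k_def)
  define v' where "v' = (\<lambda>i. k *\<^sub>R v i)"
  have gram: "B (v' i) (v' j) = shape_gram (r, s, t) $ i $ j" for i j
    using k by (simp add: v'_def B_scaleR v(3) flip: mult.assoc)
  have nonneg: "B (v' i) (v' j) \<ge> 0" for i j
    using doubly_stochastic_shape_gram[OF T] unfolding gram doubly_stochastic_def by blast
  have nz: "v' i \<noteq> 0" for i using v(1) k by (simp add: v'_def)
  have P: "P i = span {v' i}" for i
    unfolding v(2) v'_def using v(1) k by (subst span_singleton_eq_iff) auto
  have diag: "\<forall>i. B (v' i) (v' i) = 0" and row: "B (v' 1) (v' 2) > 0" "B (v' 1) (v' 3) > 0" "B (v' 1) (v' 4) > 0"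
    unfolding forall_4 gram shape_gram_nth vector_4_nth using rst by auto
  have "tc (v 1) \<noteq> 0" using causal_tc_nonzero[of "v' 1"] diag nz by (auto simp: v'_def tc_simps)
  then have tc1: "tc (v' 1) > 0" by (auto simp: v'_def k_def tc_simps)
  have "\<forall>i. tc (v' i) > 0"
    unfolding forall_4
    using tc1 isotropic_tc_same_sign[OF _ _ row(1)] isotropic_tc_same_sign[OF _ _ row(2)]
      isotropic_tc_same_sign[OF _ _ row(3)] diag
    by (simp add: zero_less_mult_iff)
  then have tc: "tc (v' i) > 0" for i by blast
  have "tetrahedron_volume B b e P = measure hyp_measure (region v')"
    using tetrahedron_volume_eq[of v' P, OF nonneg nz P] region_eq[of v', OF tc] by simp
  also have "\<dots> = lob_volume (r, s, t)"
    by (rule measure_region[OF gram sum half \<open>s \<le> r\<close> tc])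
  finally show ?thesis .
qed

lemma tetrahedron_volume_eq_lob_volume:
  assumes shape: "has_shape B P T" and disc: "shape_disc T > 0"
  shows "tetrahedron_volume B b e P = lob_volume T"
proof -
  obtain r s t where T: "T = (r, s, t)" by (cases T)
  show ?thesis
  proof (cases "s \<le> r")
    case True
    then show ?thesis using tetrahedron_volume_aux assms by (simp add: T)
  next
    case False
    obtain P' where P': "range P' = range P" "has_shape B P' (s, r, t)"
      using has_shape_relabel(1)[of P r s t] shape T by blast
    have "tetrahedron_volume B b e P = tetrahedron_volume B b e P'"
      by (simp add: tetrahedron_volume_def P'(1))
    also have "\<dots> = lob_volume (s, r, t)"
      using tetrahedron_volume_aux[OF P'(2)] False disc by (simp add: T shape_disc_swap[of s])
    finally show ?thesis by (simp add: T lob_volume_swap)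
  qed
qed

text \<open>For r = 1/2 the representatives satisfy v 1 + v 2 = v 3 + v 4, so they span at most
  three dimensions. Since B (v 1) (v 2) = 1/2, the sum and the difference of v 1 and v 2 already
  have squares 1 and -1 and are orthogonal; one further vector completes the basis of a
  plane.\<close>

lemma degenerate_half:
  assumes "has_shape B P (1 / 2, s, t)"
  shows "degenerate B P"
proof -
  obtain v where T: "(1 / 2, s, t) \<in> shapes" and v: "\<And>i. v i \<noteq> 0" "\<And>i. P i = span {v i}"
    "\<And>i j. B (v i) (v j) = shape_gram (1 / 2, s, t) $ i $ j"
    using assms unfolding has_shape_iff by blast
  have t: "t = 1 / 2 - s" using T by (simp add: shapes_iff)
  have G: "B (v 1) (v 1) = 0" "B (v 1) (v 2) = 1 / 2" "B (v 1) (v 3) = s" "B (v 1) (v 4) = t"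
    "B (v 2) (v 1) = 1 / 2" "B (v 2) (v 2) = 0" "B (v 2) (v 3) = t" "B (v 2) (v 4) = s"
    "B (v 3) (v 1) = s" "B (v 3) (v 2) = t" "B (v 3) (v 3) = 0" "B (v 3) (v 4) = 1 / 2"
    "B (v 4) (v 1) = t" "B (v 4) (v 2) = s" "B (v 4) (v 3) = 1 / 2" "B (v 4) (v 4) = 0"
    unfolding v(3) shape_gram_nth vector_4_nth by (rule refl)+
  text \<open>\<open>n\<close> is an isotropic vector orthogonal to two isotropic lines, hence \<open>0\<close>.\<close>
  define n where "n = v 1 + v 2 - v 3 - v 4"
  have Bn: "B n (v 1) = 0" "B n (v 2) = 0" "B n (v 3) = 0" "B n (v 4) = 0"
    by (simp_all add: n_def B_simps G t)
  have "n = 0"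
  proof (rule ccontr)
    assume "n \<noteq> 0"
    have "B n n = B n (v 1) + B n (v 2) - B n (v 3) - B n (v 4)" by (simp only: n_def B_simps)
    then have "B n n = 0" using Bn by simp
    then obtain c where "c \<noteq> 0" "n = c *\<^sub>R v 1"
      using causal_orthogonal[of "v 1" n] v(1) G(1) Bn(1) sym[of n "v 1"] \<open>n \<noteq> 0\<close> by (metis order_refl)
    then show False using Bn(2) G(2) by (simp add: B_scaleR)
  qed
  then have v4: "v 4 = v 1 + v 2 - v 3" by (simp add: n_def algebra_simps)
  define f where "f = v 1 + v 2"
  define w where "w = v 1 - v 2"
  \<comment> \<open>Orthogonal projection away from f and w; the last sign is plus because B w w =
    -1.\<close>
  define u where "u = v 3 - B (v 3) f *\<^sub>R f + B (v 3) w *\<^sub>R w"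
  have fw: "B f f = 1" "B w w = - 1" "B f w = 0" "B w f = 0"
    by (simp_all add: f_def w_def B_simps G)
  obtain u' where u': "u' \<noteq> 0" "B u' f = 0" "B u' w = 0" "u \<in> span {u'}"
  proof (cases "u = 0")
    \<comment> \<open>If v 3 lies in the span of v 1 and v 2, any nonzero vector orthogonal to f and
      w serves as the third basis vector.\<close>
    case True
    obtain n where "n \<noteq> 0" "\<And>i. B n (if i = (1 :: 3) then f else w) = 0"
      using exists_orthogonal3[of "\<lambda>i. if i = 1 then f else w"] by blast
    from this(1) this(2)[of 1] this(2)[of 2] show thesis using that[of n] True by (simp add: span_zero)
  next
    case False
    then show thesis using that[of u] by (simp add: span_base u_def B_simps fw)
  qed
  have neg: "B u' u' < 0" using orthogonal_timelike_neg[of f u'] u' fw by simp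
  define q where "q = sqrt (- B u' u')"
  have q: "q > 0" "B u' u' = - (q * q)" using neg by (simp_all add: q_def)
  define w\<^sub>2 where "w\<^sub>2 = (1 / q) *\<^sub>R u'"
  have w2: "B w\<^sub>2 f = 0" "B f w\<^sub>2 = 0" "B w\<^sub>2 w = 0" "B w w\<^sub>2 = 0" "B w\<^sub>2 w\<^sub>2 = - 1"
    using u' q sym[of f u'] sym[of w u'] by (simp_all add: w\<^sub>2_def B_scaleR)
  define W where "W = span {f, w, w\<^sub>2}"
  have f_W: "f \<in> W" "w \<in> W" "w\<^sub>2 \<in> W" by (simp_all add: W_def span_base)
  have W_lin: "x + y \<in> W" "x - y \<in> W" "c *\<^sub>R x \<in> W" if "x \<in> W" "y \<in> W" for x y c
    using that by (simp_all add: W_def span_add span_diff span_scale)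
  have "u' = q *\<^sub>R w\<^sub>2" using q by (simp add: w\<^sub>2_def)
  then have "u' \<in> W" using W_lin f_W by simp
  then have u_W: "u \<in> W" using u'(4) span_minimal[of "{u'}" W] by (auto simp: W_def)
  have "v 1 = (1 / 2) *\<^sub>R (f + w)" "v 2 = (1 / 2) *\<^sub>R (f - w)"
    by (simp_all add: f_def w_def flip: scaleR_2)
  then have v12: "v 1 \<in> W" "v 2 \<in> W" using W_lin f_W by (metis, metis)
  have "v 3 = u + B (v 3) f *\<^sub>R f - B (v 3) w *\<^sub>R w" by (simp add: u_def)
  then have v3: "v 3 \<in> W" using W_lin f_W u_W by metis
  have "\<forall>i. v i \<in> W" unfolding forall_4 v4 using v12 v3 W_lin by simp
  then have "P i \<subseteq> W" for i unfolding v(2) by (metis W_def empty_subsetI insert_subset span_minimal subspace_span)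
  moreover have "lorentz_basis B W (\<lambda>i :: 2. if i = 1 then w else w\<^sub>2) f"
  proof -
    have "range (\<lambda>i :: 2. if i = 1 then w else w\<^sub>2) = {w, w\<^sub>2}" by (auto simp: UNIV_2)
    then show ?thesis
      unfolding lorentz_basis_def forall_2 by (simp add: W_def fw w2)
  qed
  ultimately show ?thesis unfolding degenerate_def by blast
qed

lemma degenerate_if_disc_0:
  assumes shape: "has_shape B P T" and "shape_disc T = 0"
  shows "degenerate B P"
proof -
  have range: "degenerate B P" if "range P' = range P" "degenerate B P'" for P'
  proof -
    have "(\<forall>i. P' i \<subseteq> W) \<longleftrightarrow> (\<forall>i. P i \<subseteq> W)" for W
      using that(1) by (metis rangeE rangeI)
    then show ?thesis using that(2) unfolding degenerate_def by simp
  qed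
  obtain r s t where T: "T = (r, s, t)" by (cases T)
  then consider "r = 1 / 2" | "s = 1 / 2" | "t = 1 / 2" using assms(2) by (auto simp: shape_disc_def)
  then show ?thesis
  proof cases
    case 1
    have "has_shape B P (1 / 2, s, t)" using shape unfolding T 1 .
    then show ?thesis by (rule degenerate_half)
  next
    case 2
    from shape obtain P' where "range P' = range P" "has_shape B P' (1 / 2, r, t)"
      using has_shape_relabel(1)[of P r s t] unfolding T 2 by blast
    then show ?thesis using range[OF _ degenerate_half] by blast
  next
    case 3
    from shape obtain P' where "range P' = range P" "has_shape B P' (1 / 2, s, r)"
      using has_shape_relabel(2)[of P r s t] unfolding T 3 by blast
    then show ?thesis using range[OF _ degenerate_half] by blast
  qed
qed

text \<open>W has three generators, so a nonzero n is orthogonal to all of W. The whole cone lies in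
  the hyperplane orthogonal to n, which meets the chart in a null set.\<close>

lemma degenerate_volume:
  assumes shape: "has_shape B P T" and deg: "degenerate B P"
  shows "tetrahedron_volume B b e P = 0"
proof -
  obtain v where T: "T \<in> shapes" and v: "\<And>i. v i \<noteq> 0" "\<And>i. P i = span {v i}"
    "\<And>i j. B (v i) (v j) = shape_gram T $ i $ j"
    using shape unfolding has_shape_iff by blast
  have nonneg: "B (v i) (v j) \<ge> 0" for i j
    using doubly_stochastic_shape_gram[OF T] unfolding v(3) doubly_stochastic_def by blast
  obtain W and w :: "2 \<Rightarrow> 'v" and f where W: "span (insert f (range w)) = W" "\<And>i. P i \<subseteq> W"
    using deg unfolding degenerate_def lorentz_basis_def by blast
  obtain n where n: "n \<noteq> 0" "\<And>i. B n (if i = (1 :: 3) then f else if i = 2 then w 1 else w 2) = 0"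
    using exists_orthogonal3[of "\<lambda>i. if i = 1 then f else if i = 2 then w 1 else w 2"] by blast
  have "B n f = 0" "B n (w 1) = 0" "B n (w 2) = 0" using n(2)[of 1] n(2)[of 2] n(2)[of 3] by auto
  then have "insert f (range w) \<subseteq> {x. B n x = 0}" by (auto simp: UNIV_2)
  then have orth: "W \<subseteq> {x. B n x = 0}"
    unfolding W(1)[symmetric] by (intro span_minimal) (auto simp: subspace_def B_simps)
  have v_orth: "B n (v i) = 0" for i
    using orth W(2)[of i] unfolding v(2) by (auto intro: span_base)
  have "{x. span {chart b e x} \<in> proj_cone v \<and> x \<bullet> x < 1} \<subseteq> {x. B n (chart b e x) = 0}"
  proof safe
    fix x assume "span {chart b e x} \<in> proj_cone v"
    then obtain p y where p: "p = (\<Sum>i\<in>UNIV. y i *\<^sub>R v i)" "span {chart b e x} = span {p}"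
      unfolding proj_cone_def by blast
    obtain c where "c \<noteq> 0" "p = c *\<^sub>R chart b e x" using p(2) span_singleton_eq_iff[OF chart_nonzero] by blast
    moreover have "B n p = 0" unfolding p(1) by (simp add: B_simps v_orth)
    ultimately show "B n (chart b e x) = 0" by (simp add: B_scaleR)
  qed
  then show ?thesis
    using measure_hyp_measure_null n(1) tetrahedron_volume_eq[of v P, OF nonneg v(1,2)] by simp
qed

text \<open>The description in \<open>vol\<close> is unique for two different reasons: for nonzero
  determinant by \<open>lob_volume_eqI\<close>, for determinant 0 because every tetrahedron there is
  degenerate and has volume 0. The case distinction replaces the meaningless value of
  \<open>lob_volume\<close> at \<rho> = 0.\<close>

lemma vol_eq:
  assumes T: "T \<in> shapes"
  shows "vol B b e (- shape_disc T) (sumsq T) = (if shape_disc T = 0 then 0 else lob_volume T)"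
proof -
  have vol_shape: "tetrahedron_volume B b e P = (if shape_disc T' = 0 then 0 else lob_volume T')" if "has_shape B P T'" for P T'
  proof -
    have "T' \<in> shapes" using that by (simp add: has_shape_iff)
    then show ?thesis
      using shape_disc_nonneg[of T'] that degenerate_volume degenerate_if_disc_0 tetrahedron_volume_eq_lob_volume
      by (metis less_le)
  qed
  obtain P where P: "has_shape B P T" using has_shape_exists[OF T] by blast
  show ?thesis
    unfolding vol_def
  proof (rule the_equality)
    show "\<exists>T' P. has_shape B P T' \<and> det_per T' = (- shape_disc T, sumsq T) \<and>
        (if shape_disc T = 0 then 0 else lob_volume T) = tetrahedron_volume B b e P"
      using P vol_shape[OF P] det_per_eq[OF T] by metis
  next
    fix c assume "\<exists>T' P. has_shape B P T' \<and> det_per T' = (- shape_disc T, sumsq T) \<and> c = tetrahedron_volume B b e P"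
    then obtain T' P' where T': "has_shape B P' T'" "det_per T' = (- shape_disc T, sumsq T)" "c = tetrahedron_volume B b e P'"
      by blast
    have mem: "T' \<in> shapes" using T'(1) by (simp add: has_shape_iff)
    then have eq: "shape_disc T' = shape_disc T" "sumsq T' = sumsq T" using T'(2) det_per_eq[OF mem] by auto
    show "c = (if shape_disc T = 0 then 0 else lob_volume T)"
      unfolding T'(3) vol_shape[OF T'(1)] eq
      using lob_volume_eqI[OF mem T eq(2)] eq(1) shape_disc_nonneg[OF T] by auto
  qed
qed

end

theorem theorem6p10:
  fixes B :: "'v::real_vector \<Rightarrow> 'v \<Rightarrow> real" and b :: "3 \<Rightarrow> 'v" and e :: 'v
  assumes "bilinear B"
    and "\<And>u w. B u w = B w u"
    and "lorentz_basis B UNIV b e"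
  shows "(\<forall>\<omega>. strict_antimono_on {\<alpha>. (\<alpha>, \<omega>) \<in> det_per_region} (\<lambda>\<alpha>. vol B b e \<alpha> \<omega>)) \<and>
    (\<forall>\<alpha>. \<alpha> \<noteq> 0 \<longrightarrow> strict_mono_on {\<omega>. (\<alpha>, \<omega>) \<in> det_per_region} (\<lambda>\<omega>. vol B b e \<alpha> \<omega>)) \<and>
    (\<forall>T P. has_shape B P T \<and> det (shape_gram T) = 0 \<longrightarrow>
      degenerate B P \<and> tetrahedron_volume B b e P = 0)"
proof -
  interpret lorentz B b e by unfold_locales (rule assms)+
  have region: "(\<alpha>, \<omega>) \<in> det_per_region \<longleftrightarrow> (\<exists>T\<in>shapes. \<alpha> = - shape_disc T \<and> \<omega> = sumsq T)" for \<alpha> \<omega>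
    unfolding det_per_region_def image_iff using det_per_eq by (metis prod.inject)
  have pos: "lob_volume T > 0" if T: "T \<in> shapes" "shape_disc T > 0" for T
  proof -
    obtain r s t where *: "r + s + t = 1" "s \<le> t" "t \<le> r" "r \<le> 1 / 2" "shape_disc T = shape_disc (r, s, t)"
      "sumsq T = sumsq (r, s, t)" "lob_volume T = lob_volume (r, s, t)" by (rule shape_sorted[OF T(1)])
    then have "r < 1 / 2" "s < 1 / 2" "t < 1 / 2" using shape_disc_pos_half[of r s t] T by auto
    then show ?thesis using lob_volume_pos[of r s t] * by auto
  qed
  have "strict_antimono_on {\<alpha>. (\<alpha>, \<omega>) \<in> det_per_region} (\<lambda>\<alpha>. vol B b e \<alpha> \<omega>)" for \<omega>
  proof (rule monotone_onI)
    fix \<alpha> \<beta> assume ab: "\<alpha> \<in> {\<alpha>. (\<alpha>, \<omega>) \<in> det_per_region}" "\<beta> \<in> {\<alpha>. (\<alpha>, \<omega>) \<in> det_per_region}" "\<alpha> < \<beta>"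
    then obtain T where T: "T \<in> shapes" "\<alpha> = - shape_disc T" "\<omega> = sumsq T" using region by blast
    obtain T' where T': "T' \<in> shapes" "\<beta> = - shape_disc T'" "\<omega> = sumsq T'" using ab region by blast
    have less: "shape_disc T' < shape_disc T" using ab T T' by simp
    then have "shape_disc T > 0" using shape_disc_nonneg[OF T'(1)] by simp
    \<comment> \<open>Since \<alpha> is minus \<open>shape_disc\<close>, the order is reversed. The
      remaining case \<beta> = 0 has volume 0 at T' and reduces to positivity at T.\<close>
    moreover have "lob_volume T' < lob_volume T" if "shape_disc T' \<noteq> 0"
      using lob_volume_strict_mono_disc[OF T'(1) T(1)] T(3) T'(3) less that shape_disc_nonneg[OF T'(1)] by simp
    ultimately show "vol B b e \<alpha> \<omega> > vol B b e \<beta> \<omega>"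
      using vol_eq[OF T(1)] vol_eq[OF T'(1)] pos[OF T(1)] T T' by auto
  qed
  moreover have "strict_mono_on {\<omega>. (\<alpha>, \<omega>) \<in> det_per_region} (\<lambda>\<omega>. vol B b e \<alpha> \<omega>)" if "\<alpha> \<noteq> 0" for \<alpha>
  proof (rule monotone_onI)
    fix \<omega> \<omega>' assume ab: "\<omega> \<in> {\<omega>. (\<alpha>, \<omega>) \<in> det_per_region}" "\<omega>' \<in> {\<omega>. (\<alpha>, \<omega>) \<in> det_per_region}" "\<omega> < \<omega>'"
    then obtain T where T: "T \<in> shapes" "\<alpha> = - shape_disc T" "\<omega> = sumsq T" using region by blast
    obtain T' where T': "T' \<in> shapes" "\<alpha> = - shape_disc T'" "\<omega>' = sumsq T'" using ab region by blast
    have "shape_disc T > 0" using that T shape_disc_nonneg[OF T(1)] by simp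
    then have "lob_volume T < lob_volume T'"
      using lob_volume_strict_mono_sumsq[OF T(1) T'(1)] ab T T' by simp
    then show "vol B b e \<alpha> \<omega> < vol B b e \<alpha> \<omega>'"
      using vol_eq[OF T(1)] vol_eq[OF T'(1)] that T T' by auto
  qed
  moreover have "degenerate B P \<and> tetrahedron_volume B b e P = 0"
    if "has_shape B P T" "det (shape_gram T) = 0" for T P
  proof -
    have "T \<in> shapes" using that by (simp add: has_shape_def)
    then have "shape_disc T = 0" using det_per_eq[of T] that by (simp add: det_per_def)
    then have "degenerate B P" using degenerate_if_disc_0 that by blast
    then show ?thesis using degenerate_volume that by blast
  qed
  ultimately show ?thesis by blast
qed

end
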